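(* Assume $k_+>k_->0$. Let $y$ be an arbitrary fixed point in $\mathbb R^2_+\cup\mathbb R^2_-$ and, for $x=|x|\hat x=|x|(\cos\theta_{\hat x},\sin\theta_{\hat x})\in\mathbb R^2_+$, let $$G_{Res}(x,y):=G(x,y)-\frac{e^{ik_+|x|}}{\sqrt{|x|}}G^\infty(\hat x,y).$$ Then $$\lim_{|x|\to+\infty}|G_{Res}(x,y)|\,|x|^{3/4}\ne0\qquad\text{for }\theta_{\hat x}\in\{\theta_c,\pi-\theta_c\}.$$ In particular, $G_{Res}(x,y)=O(|x|^{-3/2})$ as $|x|\to+\infty$ does not hold for $\theta_{\hat x}\in\{\theta_c,\pi-\theta_c\}$.
   Context: Notation. $\mathbb R^2_\pm=\{(x_1,x_2)\in\mathbb R^2: x_2\gtrless 0\}$, $\Gamma_0=\{(x_1,0):x_1\in\mathbb R\}$, $\mathbb S^1_\pm=\{x\in\mathbb R^2_\pm:|x|=1\}$, $\hat x=x/|x|$, $y'=(y_1,-y_2)$ for $y=(y_1,y_2)$, $n:=k_-/k_+<1$, $\theta_c:=\arccos(n)\in(0,\pi/2)$. Function $\mathcal S$. For $z=|z|e^{i\theta_1}\ne0$ with $\theta_1\in(-\frac{3\pi}2,\frac\pi2)$ let $\mathcal S_1(z)=\sqrt{|z|}e^{i\theta_1/2}$; for $z=|z|e^{i\theta_2}\neq 0$ with $\theta_2\in(-\frac\pi2,\frac{3\pi}2)$ let $\mathcal S_2(z)=\sqrt{|z|}e^{i\theta_2/2}$; $\mathcal S_1(0)=\mathcal S_2(0)=0$.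 For $a>0$ let $\mathcal S(z,a)=\mathcal S_1(z-a)\mathcal S_2(z+a)$. (For real $z$: $\mathcal S(z,a)=\sqrt{z^2-a^2}$ if $|z|\ge a$ and $\mathcal S(z,a)=-i\sqrt{a^2-z^2}$ if $|z|<a$.) For $\theta\in\mathbb R$, $$\mathcal R(\theta)=\frac{i\sin\theta+\mathcal S(\cos\theta,n)}{i\sin\theta-\mathcal S(\cos\theta,n)},\qquad \mathcal T(\theta)=\mathcal R(\theta)+1.$$ For $\hat x\in\mathbb S^1_+$, $$G^\infty(\hat x,y):=\frac{e^{i\pi/4}}{\sqrt{8\pi k_+}}\begin{cases}e^{-ik_+\hat x\cdot y}+\mathcal R(\theta_{\hat x})e^{-ik_+\hat x\cdot y'}, & y\in\mathbb R^2_+,\\ \mathcal T(\theta_{\hat x})e^{-ik_+(y_1\cos\theta_{\hat x}+iy_2\mathcal S(\cos\theta_{\hat x},n))}, & y\in\mathbb R^2_-.\end{cases}$$ Two-layered Green function. For $y\in\mathbb R^2_+\cup\mathbb R^2_-$, $G(\cdot,y)$ is the solution of $\Delta_xG(x,y)+k_\pm^2G(x,y)=-\delta(x,y)$ in $\mathbb R^2_\pm$, $[G(x,y)]=0$ and $[\partial G(x,y)/\partial\nu(x)]=0$ on $\Gamma_0$ (jumps across $\Gamma_0$, $\nu$ the unit normal pointing into $\mathbb R^2_+$), and $\lim_{|x|\to\infty}\sqrt{|x|}(\partial G(x,y)/\partial|x|-ik_\pm G(x,y))=0$ uniformly for all $\hat x\in\mathbb S^1_\pm$. Explicitly, for $x\in\mathbb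 R^2_+$, $$G(x,y)=\frac i4H^{(1)}_0(k_+|x-y|)+\frac1{4\pi}\int_{-\infty}^{\infty}\frac{\mathcal S(\xi,k_+)-\mathcal S(\xi,k_-)}{\mathcal S(\xi,k_+)+\mathcal S(\xi,k_-)}\frac{e^{-\mathcal S(\xi,k_+)|x_2+y_2|}}{\mathcal S(\xi,k_+)}e^{i\xi(x_1-y_1)}d\xi\quad(y\in\mathbb R^2_+),$$ $$G(x,y)=\frac1{2\pi}\int_{-\infty}^{\infty}\frac{e^{\mathcal S(\xi,k_-)y_2-\mathcal S(\xi,k_+)x_2}}{\mathcal S(\xi,k_+)+\mathcal S(\xi,k_-)}e^{i\xi(x_1-y_1)}d\xi\quad(y\in\mathbb R^2_-),$$ with $H_0^{(1)}$ the Hankel function of the first kind of order $0$. The limit is taken along the ray of fixed direction $\hat x$. *)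

theory Defs
  imports "HOL-Analysis.Analysis" "HOL-Library.Landau_Symbols"
begin

definition upper_half :: "(real^2) set" where
  "upper_half = {x. x $ 2 > 0}"

definition lower_half :: "(real^2) set" where
  "lower_half = {x. x $ 2 < 0}"

definition circle_upper :: "(real^2) set" where
  "circle_upper = {x \<in> upper_half. norm x = 1}"

definition reflect :: "real^2 \<Rightarrow> real^2" where
  "reflect y = vector [y $ 1, - (y $ 2)]"

text \<open>The angle of a point of the open upper unit semicircle; unspecified elsewhere.\<close>

definition angle :: "real^2 \<Rightarrow> real" where
  "angle d = (THE t. t \<in> {0<..<pi} \<and> d = vector [cos t, sin t])"

lemma angle_eqI:
  assumes "0 < t" "t < pi"
  shows "angle (vector [cos t, sin t]) = t"
  unfolding angle_def
proof (rule the_equality)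
  show "t \<in> {0<..<pi} \<and> (vector [cos t, sin t] :: real^2) = vector [cos t, sin t]"
    using assms by simp
next
  fix s
  assume s: "s \<in> {0<..<pi} \<and> (vector [cos t, sin t] :: real^2) = vector [cos s, sin s]"
  then have "(vector [cos t, sin t] :: real^2) $ 1 = (vector [cos s, sin s] :: real^2) $ 1"
    by simp
  then have "cos t = cos s" by simp
  then show "s = t" using s assms cos_inj_pi[of s t] by auto
qed

text \<open>
  Square root with argument taken in the open interval \<open>(\<alpha>, \<alpha> + 2 * pi)\<close>. On the branch cut
  (nonzero \<open>z\<close> of argument \<open>\<alpha>\<close>) no such argument exists and the value is unspecified.
\<close>

definition branch_sqrt :: "real \<Rightarrow> complex \<Rightarrow> complex" where
  "branch_sqrt \<alpha> z =
     (if z = 0 then 0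
      else rcis (sqrt (cmod z))
             ((THE t. t \<in> {\<alpha><..<\<alpha> + 2 * pi} \<and> z = rcis (cmod z) t) / 2))"

definition S1 :: "complex \<Rightarrow> complex" where
  "S1 = branch_sqrt (- (3 * pi / 2))"

definition S2 :: "complex \<Rightarrow> complex" where
  "S2 = branch_sqrt (- (pi / 2))"

definition S :: "complex \<Rightarrow> real \<Rightarrow> complex" where
  "S z a = S1 (z - of_real a) * S2 (z + of_real a)"

lemma branch_sqrt_rcis:
  assumes "r > 0" "\<alpha> < t" "t < \<alpha> + 2 * pi"
  shows "branch_sqrt \<alpha> (rcis r t) = rcis (sqrt r) (t / 2)"
proof -
  have "(THE u. u \<in> {\<alpha><..<\<alpha> + 2 * pi} \<and> rcis r t = rcis r u) = t"
  proof (rule the_equality)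
    show "t \<in> {\<alpha><..<\<alpha> + 2 * pi} \<and> rcis r t = rcis r t" using assms by simp
  next
    fix u
    assume u: "u \<in> {\<alpha><..<\<alpha> + 2 * pi} \<and> rcis r t = rcis r u"
    then have "cis t = cis u" using assms by (simp add: rcis_def)
    then have "sin u = sin t \<and> cos u = cos t" by (simp add: complex_eq_iff)
    then obtain m :: int where m: "u = t + 2 * m * pi"
      unfolding sin_cos_eq_iff by auto
    have "\<bar>u - t\<bar> < 2 * pi" using u assms by auto
    then have "\<bar>2 * real_of_int m * pi\<bar> < 2 * pi" using m by simp
    then have "\<bar>real_of_int m\<bar> < 1" by (simp add: abs_mult)
    then have "m = 0" by linarith
    then show "u = t" using m by simp
  qed
  moreover have "rcis r t \<noteq> 0" using assms by simp
  ultimately show ?thesis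
    using assms by (simp add: branch_sqrt_def)
qed

lemma S1_pos: "r > 0 \<Longrightarrow> S1 (of_real r) = of_real (sqrt r)"
  using branch_sqrt_rcis[of r "- (3 * pi / 2)" 0] by (simp add: S1_def)

lemma S2_pos: "r > 0 \<Longrightarrow> S2 (of_real r) = of_real (sqrt r)"
  using branch_sqrt_rcis[of r "- (pi / 2)" 0] by (simp add: S2_def)

lemma S1_neg:
  assumes "r > 0"
  shows "S1 (- of_real r) = - \<i> * of_real (sqrt r)"
proof -
  have "rcis r (- pi) = - of_real r" "rcis (sqrt r) (- pi / 2) = - \<i> * of_real (sqrt r)"
    by (simp_all add: complex_eq_iff)
  then show ?thesis
    using branch_sqrt_rcis[of r "- (3 * pi / 2)" "- pi"] assms by (simp add: S1_def)
qed

lemma S2_neg: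
  assumes "r > 0"
  shows "S2 (- of_real r) = \<i> * of_real (sqrt r)"
proof -
  have "rcis r pi = - of_real r" "rcis (sqrt r) (pi / 2) = \<i> * of_real (sqrt r)"
    by (simp_all add: complex_eq_iff)
  then show ?thesis
    using branch_sqrt_rcis[of r "- (pi / 2)" pi] assms by (simp add: S2_def)
qed

lemma S_of_real:
  assumes "a > 0"
  shows "S (of_real z) a =
    (if \<bar>z\<bar> \<ge> a then of_real (sqrt (z\<^sup>2 - a\<^sup>2)) else - \<i> * of_real (sqrt (a\<^sup>2 - z\<^sup>2)))"
proof -
  have sq: "z\<^sup>2 - a\<^sup>2 = (z - a) * (z + a)" "a\<^sup>2 - z\<^sup>2 = (a - z) * (z + a)"
      "z\<^sup>2 - a\<^sup>2 = (a - z) * (- z - a)"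
    by (simp_all add: power2_eq_square algebra_simps)
  consider "z = a" | "z = - a" | "z > a" | "z < - a" | "\<bar>z\<bar> < a" by linarith
  then show ?thesis
  proof cases
    case 3
    then show ?thesis
      using assms S1_pos[of "z - a"] S2_pos[of "z + a"] by (simp add: S_def sq(1) real_sqrt_mult)
  next
    case 4
    then have "S (of_real z) a = of_real (sqrt (a - z)) * of_real (sqrt (- z - a))"
      using assms S1_neg[of "a - z"] S2_neg[of "- z - a"] by (simp add: S_def algebra_simps)
    also have "\<dots> = of_real (sqrt (z\<^sup>2 - a\<^sup>2))"
      by (simp add: sq(3) real_sqrt_mult)
    finally show ?thesis using 4 assms by simp
  next
    case 5
    then show ?thesis
      using assms S1_neg[of "a - z"] S2_pos[of "z + a"]
      by (simp add: S_def sq(2) real_sqrt_mult)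
  qed (use assms in \<open>simp_all add: S_def S1_def S2_def branch_sqrt_def\<close>)
qed

definition refl_coeff :: "real \<Rightarrow> real \<Rightarrow> complex" where
  "refl_coeff n t =
     (\<i> * of_real (sin t) + S (of_real (cos t)) n) / (\<i> * of_real (sin t) - S (of_real (cos t)) n)"

definition trans_coeff :: "real \<Rightarrow> real \<Rightarrow> complex" where
  "trans_coeff n t = refl_coeff n t + 1"

text \<open>Power series of the Bessel functions of order \<open>0\<close>; \<open>bessel_Y0\<close> and \<open>hankel1_0\<close> are
  meant for positive arguments.\<close>

definition bessel_J0 :: "real \<Rightarrow> real" where
  "bessel_J0 x = (\<Sum>k. (- 1) ^ k * (x\<^sup>2 / 4) ^ k / (fact k)\<^sup>2)"

definition bessel_Y0 :: "real \<Rightarrow> real" where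
  "bessel_Y0 x =
     2 / pi * (ln (x / 2) + euler_mascheroni) * bessel_J0 x +
     2 / pi * (\<Sum>k. (- 1) ^ (k + 1) * harm k * (x\<^sup>2 / 4) ^ k / (fact k)\<^sup>2)"

definition hankel1_0 :: "real \<Rightarrow> complex" where
  "hankel1_0 x = of_real (bessel_J0 x) + \<i> * of_real (bessel_Y0 x)"

text \<open>
  The two-layered Green function for \<open>x \<in> upper_half\<close> and \<open>y \<in> upper_half \<union> lower_half\<close>, by its
  explicit Fourier representation. Both integrals converge absolutely for such \<open>x\<close> and \<open>y\<close>.
  For \<open>x\<close> outside \<open>upper_half\<close> the value has no meaning.
\<close>

definition green :: "real \<Rightarrow> real \<Rightarrow> real^2 \<Rightarrow> real^2 \<Rightarrow> complex" where
  "green kp km x y =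
     (if y \<in> upper_half then
        \<i> / 4 * hankel1_0 (kp * norm (x - y)) +
        1 / (4 * of_real pi) *
          (LINT \<xi>|lborel.
             (S (of_real \<xi>) kp - S (of_real \<xi>) km) / (S (of_real \<xi>) kp + S (of_real \<xi>) km) *
             (exp (- S (of_real \<xi>) kp * of_real \<bar>x $ 2 + y $ 2\<bar>) / S (of_real \<xi>) kp) *
             exp (\<i> * of_real (\<xi> * (x $ 1 - y $ 1))))
      else
        1 / (2 * of_real pi) *
          (LINT \<xi>|lborel.
             exp (S (of_real \<xi>) km * of_real (y $ 2) - S (of_real \<xi>) kp * of_real (x $ 2)) /
             (S (of_real \<xi>) kp + S (of_real \<xi>) km) *
             exp (\<i> * of_real (\<xi> * (x $ 1 - y $ 1)))))"

definition green_far :: "real \<Rightarrow> real \<Rightarrow> real^2 \<Rightarrow> real^2 \<Rightarrow> complex" where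
  "green_far kp km d y =
     (let n = km / kp; t = angle d in
      exp (\<i> * of_real (pi / 4)) / of_real (sqrt (8 * pi * kp)) *
      (if y \<in> upper_half then
         exp (- \<i> * of_real (kp * (d \<bullet> y))) +
         refl_coeff n t * exp (- \<i> * of_real (kp * (d \<bullet> reflect y)))
       else
         trans_coeff n t *
         exp (- \<i> * of_real kp *
              (of_real (y $ 1 * cos t) + \<i> * of_real (y $ 2) * S (of_real (cos t)) n))))"

definition green_res :: "real \<Rightarrow> real \<Rightarrow> real^2 \<Rightarrow> real^2 \<Rightarrow> complex" where
  "green_res kp km x y =
     green kp km x y -
     exp (\<i> * of_real (kp * norm x)) / of_real (sqrt (norm x)) * green_far kp km (x /\<^sub>R norm x) y"

definition crit_angle :: "real \<Rightarrow> real \<Rightarrow> real" where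
  "crit_angle kp km = arccos (km / kp)"

end

theory Submission imports Defs "HOL-Real_Asymp.Real_Asymp" begin

text \<open>
  Write \<open>k\<close> for the wave number of the upper medium, \<open>n = km / kp\<close>, and \<open>t\<close> for the direction of
  observation. Up to the free-space source wave, \<open>G\<close> is a Fourier integral over the tangential
  wave number \<open>\<xi>\<close>. The part \<open>\<bar>\<xi>\<bar> > k\<close> consists of evanescent waves and contributes only \<open>O(1/r)\<close>.
  On the rest, \<open>\<xi> = k cos \<phi>\<close> turns the integral into a superposition of plane waves,
  \<open>\<integral>\<^sub>0\<^sup>\<pi> g(\<phi>) exp(i k r cos (\<phi> - t)) d\<phi>\<close>, whose stationary point is \<open>\<phi> = t\<close>. The amplitude has the form
  \<open>g = (A + B S) exp(\<kappa> S)\<close> with smooth \<open>A, B\<close> and \<open>S = sqrt (cos\<^sup>2 \<phi> - n\<^sup>2)\<close>, which is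
  proportional to the vertical wave number in the lower medium.

  For a direction of observation with \<open>cos\<^sup>2 t \<noteq> n\<^sup>2\<close> this amplitude is smooth at the stationary point.
  At the critical angle \<open>S\<close> has its branch point precisely there, so that near \<open>t\<close>
  \<open>g \<approx> A(t) + (B(t) + \<kappa> A(t)) S\<close>, where \<open>S\<close> behaves like \<open>sqrt \<bar>sin 2t\<bar>\<close> times the square root of
  the distance to \<open>t\<close> on one side and like \<open>- i\<close> times the same function on the other. The constant
  term produces the far field \<open>r\<^sup>-\<^sup>1\<^sup>/\<^sup>2\<close>; the square root produces a term of exact order \<open>r\<^sup>-\<^sup>3\<^sup>/\<^sup>4\<close>. Its
  coefficient is a nonzero multiple of
  \<open>(B(t) + \<kappa> A(t)) sqrt \<bar>sin 2t\<bar> (1 - i) \<integral>\<^sub>0\<^sup>\<infinity> w\<^sup>-\<^sup>1\<^sup>/\<^sup>4 exp(- i w) dw\<close>. Here \<open>1 - i\<close> adds up the two sides,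
  the Fresnel integral has negative imaginary part, and \<open>B(t) + \<kappa> A(t) \<noteq> 0\<close> is read off the
  reflection and transmission coefficients. All else is \<open>O(r\<^sup>-\<^sup>7\<^sup>/\<^sup>8)\<close>, which gives the limit, and the limit
  being nonzero excludes \<open>O(r\<^sup>-\<^sup>3\<^sup>/\<^sup>2)\<close>.

  The expansion is \<open>stationary_phase_square_root\<close> (one side) and \<open>stationary_phase_at_direction\<close>
  (both sides). The phase \<open>1 - cos u\<close> is itself used as the variable of integration, so the main
  terms are exact Fresnel integrals; the remaining amplitude vanishes at the stationary point, and
  one integration by parts against a primitive of the oscillating factor suffices, provided that
  the derivative of the amplitude is absolutely integrable against \<open>u\<^sup>-\<^sup>3\<^sup>/\<^sup>4\<close>. Integrability of the
  derivative is the right requirement because \<open>S\<close> has a second branch point, at \<open>\<pi> - t\<close>.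

  For a source in the upper half-plane the source wave \<open>i/4 H(k \<bar>x - y\<bar>)\<close> must match its own
  far field up to \<open>o(r\<^sup>-\<^sup>3\<^sup>/\<^sup>4)\<close>. The Hankel function is given by power series, so it is first
  identified with \<open>1/\<pi> \<integral>\<^sub>0\<^sup>\<pi> exp(i t sin \<phi>) d\<phi> - 2i/\<pi> \<integral>\<^sub>0\<^sup>\<infinity> exp(- t s) / sqrt (1 + s\<^sup>2) ds\<close>, by uniqueness for
  Bessel's equation with prescribed behaviour at \<open>0\<close> (\<open>hankel1_0_integral\<close>); then the same
  stationary phase lemma applies. \<open>critical_residual_limit\<close> assembles the limit for both positions
  of the source, and \<open>residual_upper\<close>, \<open>residual_lower\<close> check its hypotheses.
\<close>

section \<open>Differentiation under the integral sign\<close>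

lemma abs_exp_minus_one_le: "\<bar>exp x - 1\<bar> \<le> \<bar>x\<bar> * exp \<bar>x\<bar>" for x :: real
proof (cases "x \<ge> 0")
  case True
  have "1 - x \<le> exp (- x)" using exp_ge_add_one_self[of "- x"] by simp
  then have "(1 - x) * exp x \<le> exp (- x) * exp x" by (intro mult_right_mono) auto
  then have "exp x - 1 \<le> x * exp x" by (simp add: algebra_simps flip: exp_add)
  then show ?thesis using True by simp
next
  case False
  have "\<bar>exp x - 1\<bar> = 1 - exp x" using False by simp
  also have "\<dots> \<le> \<bar>x\<bar> * 1" using exp_ge_add_one_self[of x] False by linarith
  also have "\<dots> \<le> \<bar>x\<bar> * exp \<bar>x\<bar>" by (intro mult_left_mono) auto
  finally show ?thesis .
qed

lemma has_vector_derivative_of_quotient: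
  fixes f :: "real \<Rightarrow> 'a::real_normed_vector"
  assumes "((\<lambda>h. (1 / h) *\<^sub>R (f (x + h) - f x)) \<longlongrightarrow> D) (at 0)"
  shows "(f has_vector_derivative D) (at x)"
  unfolding has_vector_derivative_def has_derivative_at
proof (intro conjI bounded_linear_scaleR_left)
  have "((\<lambda>h. norm ((1 / h) *\<^sub>R (f (x + h) - f x) - D)) \<longlongrightarrow> 0) (at 0)"
    using assms by (simp add: LIM_zero tendsto_norm_zero)
  moreover have "\<forall>\<^sub>F h in at 0. norm ((1 / h) *\<^sub>R (f (x + h) - f x) - D) = norm (f (x + h) - f x - h *\<^sub>R D) / norm h"
    unfolding eventually_at_filter
  proof (intro always_eventually allI impI)
    fix h :: real assume h: "h \<noteq> 0"
    have "(1 / h) *\<^sub>R (f (x + h) - f x) - D = (1 / h) *\<^sub>R (f (x + h) - f x - h *\<^sub>R D)"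
      using h by (simp add: scaleR_diff_right)
    then show "norm ((1 / h) *\<^sub>R (f (x + h) - f x) - D) = norm (f (x + h) - f x - h *\<^sub>R D) / norm h"
      by (simp add: divide_inverse)
  qed
  ultimately show "((\<lambda>h. norm (f (x + h) - f x - h *\<^sub>R D) / norm h) \<longlongrightarrow> 0) (at 0)"
    by (rule Lim_transform_eventually)
qed

lemma dominated_convergence_at:
  fixes s :: "real \<Rightarrow> 'a \<Rightarrow> 'b::{banach,second_countable_topology}"
  assumes [measurable]: "f \<in> borel_measurable M" "\<And>t. s t \<in> borel_measurable M"
    and w: "integrable M w"
    and lim: "\<And>x. x \<in> space M \<Longrightarrow> ((\<lambda>t. s t x) \<longlongrightarrow> f x) (at a within A)"
    and bnd: "\<forall>\<^sub>F t in at a within A. \<forall>x\<in>space M. norm (s t x) \<le> w x"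
  shows "((\<lambda>t. integral\<^sup>L M (s t)) \<longlongrightarrow> integral\<^sup>L M f) (at a within A)"
proof (rule tendsto_at_iff_sequentially[THEN iffD2], intro allI impI)
  fix X :: "nat \<Rightarrow> real" assume X: "\<forall>i. X i \<in> A - {a}" "X \<longlonglongrightarrow> a"
  have fl: "filterlim X (at a within A) sequentially"
    using X by (auto simp: filterlim_at)
  from filterlim_iff[THEN iffD1, OF this, rule_format, OF bnd]
  obtain N where N: "\<And>n x. N \<le> n \<Longrightarrow> x \<in> space M \<Longrightarrow> norm (s (X n) x) \<le> w x"
    by (auto simp: eventually_sequentially)
  have "(\<lambda>n. integral\<^sup>L M (s (X (n + N)))) \<longlonglongrightarrow> integral\<^sup>L M f"
  proof (rule integral_dominated_convergence[where w = w])
    show "AE x in M. (\<lambda>n. s (X (n + N)) x) \<longlonglongrightarrow> f x"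
    proof (intro AE_I2)
      fix x assume "x \<in> space M"
      then have "(\<lambda>n. s (X n) x) \<longlonglongrightarrow> f x" by (rule filterlim_compose[OF lim fl])
      then show "(\<lambda>n. s (X (n + N)) x) \<longlonglongrightarrow> f x" by (rule LIMSEQ_ignore_initial_segment)
    qed
  qed (use N w in auto)
  then show "((\<lambda>t. integral\<^sup>L M (s t)) \<circ> X) \<longlonglongrightarrow> integral\<^sup>L M f"
    unfolding comp_def by (rule LIMSEQ_offset)
qed


text \<open>
  One lemma serves three integrals: the tails of Fresnel integrals and the Laplace integral of
  \<open>1 / sqrt (1 + s\<^sup>2)\<close> (exponent \<open>- s\<close>), and Euler's integral for \<open>Gamma\<close> (exponent \<open>ln s\<close>).
  Integrability in a whole half-line of parameters already dominates the difference quotients: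
  \<open>\<bar>x\<bar> exp (t x)\<close> is at most a multiple of \<open>exp ((t + 2\<delta>) x) + exp ((t - 2\<delta>) x)\<close>.
\<close>

lemma laplace_deriv:
  fixes a :: "'c \<Rightarrow> real" and q :: "'c \<Rightarrow> 'b::{banach,second_countable_topology}"
  assumes [measurable]: "a \<in> borel_measurable M" "q \<in> borel_measurable M"
    and int: "\<And>t. l < t \<Longrightarrow> integrable M (\<lambda>s. exp (t * a s) *\<^sub>R q s)"
    and t: "l < t"
  shows "integrable M (\<lambda>s. exp (t * a s) *\<^sub>R (a s *\<^sub>R q s))"
    and "((\<lambda>t. LINT s|M. exp (t * a s) *\<^sub>R q s) has_vector_derivative
            (LINT s|M. exp (t * a s) *\<^sub>R (a s *\<^sub>R q s))) (at t)"
proof -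
  define \<delta> where "\<delta> = (t - l) / 3"
  have \<delta>: "\<delta> > 0" "l < t + 2 * \<delta>" "l < t - 2 * \<delta>" using t by (auto simp: \<delta>_def field_simps)
  define w where "w s = (1 / \<delta>) * norm (exp ((t + 2 * \<delta>) * a s) *\<^sub>R q s) +
      (1 / \<delta>) * norm (exp ((t - 2 * \<delta>) * a s) *\<^sub>R q s)" for s
  have w_int: "integrable M w"
    unfolding w_def using int \<delta> by (intro Bochner_Integration.integrable_add integrable_mult_right integrable_norm) auto
  have key: "\<bar>x\<bar> * exp (t * x) * exp (\<delta> * \<bar>x\<bar>) \<le> (1 / \<delta>) * exp ((t + 2 * \<delta>) * x) + (1 / \<delta>) * exp ((t - 2 * \<delta>) * x)" for x
  proof -
    have "\<delta> * \<bar>x\<bar> \<le> exp (\<delta> * \<bar>x\<bar>)" using exp_ge_add_one_self[of "\<delta> * \<bar>x\<bar>"] by linarith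
    then have "\<bar>x\<bar> \<le> (1 / \<delta>) * exp (\<delta> * \<bar>x\<bar>)" using \<delta> by (simp add: field_simps)
    then have "\<bar>x\<bar> * (exp (t * x) * exp (\<delta> * \<bar>x\<bar>)) \<le> ((1 / \<delta>) * exp (\<delta> * \<bar>x\<bar>)) * (exp (t * x) * exp (\<delta> * \<bar>x\<bar>))"
      by (intro mult_right_mono) auto
    also have "\<dots> = (1 / \<delta>) * exp (t * x + 2 * \<delta> * \<bar>x\<bar>)" by (simp add: exp_add [symmetric] field_simps flip: exp_add)
    also have "exp (t * x + 2 * \<delta> * \<bar>x\<bar>) \<le> exp ((t + 2 * \<delta>) * x) + exp ((t - 2 * \<delta>) * x)"
    proof (cases "x \<ge> 0")
      case True
      then have "t * x + 2 * \<delta> * \<bar>x\<bar> = (t + 2 * \<delta>) * x" by (simp add: algebra_simps)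
      then show ?thesis by simp
    next
      case False
      then have "t * x + 2 * \<delta> * \<bar>x\<bar> = (t - 2 * \<delta>) * x" by (simp add: algebra_simps)
      then show ?thesis by simp
    qed
    finally show ?thesis using \<delta> by (simp add: algebra_simps divide_right_mono)
  qed
  have bnd0: "norm (exp (t * a s) *\<^sub>R (a s *\<^sub>R q s)) \<le> w s" for s
  proof -
    have "\<bar>a s\<bar> * exp (t * a s) * 1 \<le> \<bar>a s\<bar> * exp (t * a s) * exp (\<delta> * \<bar>a s\<bar>)"
      using \<delta> by (intro mult_left_mono) auto
    then have "\<bar>a s\<bar> * exp (t * a s) * norm (q s) \<le> ((1 / \<delta>) * exp ((t + 2 * \<delta>) * a s) + (1 / \<delta>) * exp ((t - 2 * \<delta>) * a s)) * norm (q s)"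
      using key[of "a s"] by (intro mult_right_mono) auto
    then show ?thesis by (simp add: w_def abs_mult algebra_simps)
  qed
  show "integrable M (\<lambda>s. exp (t * a s) *\<^sub>R (a s *\<^sub>R q s))"
    by (rule Bochner_Integration.integrable_bound[OF w_int]) (use bnd0 in \<open>auto intro!: AE_I2 order_trans[OF _ abs_ge_self] simp del: norm_scaleR\<close>)
  have bnd: "norm ((1 / h) *\<^sub>R (exp ((t + h) * a s) *\<^sub>R q s - exp (t * a s) *\<^sub>R q s)) \<le> w s" if h: "h \<noteq> 0" "\<bar>h\<bar> < \<delta>" for h s
  proof -
    have "\<bar>exp (h * a s) - 1\<bar> \<le> \<bar>h * a s\<bar> * exp \<bar>h * a s\<bar>"
      by (rule abs_exp_minus_one_le)
    also have "\<dots> \<le> \<bar>h * a s\<bar> * exp (\<delta> * \<bar>a s\<bar>)"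
      using h by (intro mult_left_mono) (auto simp: abs_mult mult_right_mono)
    finally have "\<bar>exp (h * a s) - 1\<bar> / \<bar>h\<bar> \<le> \<bar>a s\<bar> * exp (\<delta> * \<bar>a s\<bar>)"
      using h by (simp add: abs_mult field_simps)
    then have "exp (t * a s) * (\<bar>exp (h * a s) - 1\<bar> / \<bar>h\<bar>) * norm (q s) \<le> exp (t * a s) * (\<bar>a s\<bar> * exp (\<delta> * \<bar>a s\<bar>)) * norm (q s)"
      by (intro mult_right_mono mult_left_mono) auto
    also have "\<dots> \<le> ((1 / \<delta>) * exp ((t + 2 * \<delta>) * a s) + (1 / \<delta>) * exp ((t - 2 * \<delta>) * a s)) * norm (q s)"
      using key[of "a s"] by (intro mult_right_mono) (auto simp: mult_ac)
    also have "\<dots> = w s" by (simp add: w_def algebra_simps)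
    finally have *: "exp (t * a s) * (\<bar>exp (h * a s) - 1\<bar> / \<bar>h\<bar>) * norm (q s) \<le> w s" .
    have "(1 / h) *\<^sub>R (exp ((t + h) * a s) *\<^sub>R q s - exp (t * a s) *\<^sub>R q s)
        = (exp (t * a s) * ((exp (h * a s) - 1) / h)) *\<^sub>R q s"
    proof -
      have "exp (t * a s) * ((exp (h * a s) - 1) / h) = (1 / h) * (exp ((t + h) * a s) - exp (t * a s))"
        by (simp add: distrib_right exp_add right_diff_distrib diff_divide_distrib)
      then show ?thesis by (simp only: scaleR_scaleR[symmetric] scaleR_diff_left)
    qed
    then show ?thesis using * by (simp add: abs_mult)
  qed
  have "((\<lambda>h. LINT s|M. (1 / h) *\<^sub>R (exp ((t + h) * a s) *\<^sub>R q s - exp (t * a s) *\<^sub>R q s))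
      \<longlongrightarrow> (LINT s|M. exp (t * a s) *\<^sub>R (a s *\<^sub>R q s))) (at 0)"
  proof (rule dominated_convergence_at[OF _ _ w_int])
    fix s assume "s \<in> space M"
    have "((\<lambda>h. (exp ((t + h) * a s) - exp (t * a s)) / h) \<longlongrightarrow> a s * exp (t * a s)) (at 0)"
    proof -
      have "((\<lambda>t. exp (t * a s)) has_real_derivative a s * exp (t * a s)) (at t)"
        by (auto intro!: derivative_eq_intros)
      then show ?thesis by (simp add: DERIV_def)
    qed
    then have "((\<lambda>h. ((exp ((t + h) * a s) - exp (t * a s)) / h) *\<^sub>R q s) \<longlongrightarrow> (a s * exp (t * a s)) *\<^sub>R q s) (at 0)"
      by (rule tendsto_scaleR[OF _ tendsto_const])
    then show "((\<lambda>h. (1 / h) *\<^sub>R (exp ((t + h) * a s) *\<^sub>R q s - exp (t * a s) *\<^sub>R q s)) \<longlongrightarrow> exp (t * a s) *\<^sub>R (a s *\<^sub>R q s)) (at 0)"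
      by (simp add: scaleR_diff_left[symmetric] mult_ac)
  next
    show "\<forall>\<^sub>F h in at 0. \<forall>s\<in>space M. norm ((1 / h) *\<^sub>R (exp ((t + h) * a s) *\<^sub>R q s - exp (t * a s) *\<^sub>R q s)) \<le> w s"
      unfolding eventually_at by (rule exI[of _ \<delta>]) (use \<delta> bnd in auto)
  qed auto
  moreover have "\<forall>\<^sub>F h in at (0::real). (LINT s|M. (1 / h) *\<^sub>R (exp ((t + h) * a s) *\<^sub>R q s - exp (t * a s) *\<^sub>R q s))
      = (1 / h) *\<^sub>R ((LINT s|M. exp ((t + h) * a s) *\<^sub>R q s) - (LINT s|M. exp (t * a s) *\<^sub>R q s))"
    unfolding eventually_at
  proof (intro exI[of _ \<delta>] conjI ballI impI)
    fix h :: real assume "h \<noteq> 0 \<and> dist h 0 < \<delta>"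
    then have "l < t + h" using \<delta> by (auto simp: abs_if split: if_splits)
    then show "(LINT s|M. (1 / h) *\<^sub>R (exp ((t + h) * a s) *\<^sub>R q s - exp (t * a s) *\<^sub>R q s))
      = (1 / h) *\<^sub>R ((LINT s|M. exp ((t + h) * a s) *\<^sub>R q s) - (LINT s|M. exp (t * a s) *\<^sub>R q s))"
      using int[of "t + h"] int[of t] t
      by (subst integral_scaleR_right, subst Bochner_Integration.integral_diff) simp_all
  qed (use \<delta> in auto)
  ultimately have "((\<lambda>h. (1 / h) *\<^sub>R ((LINT s|M. exp ((t + h) * a s) *\<^sub>R q s) - (LINT s|M. exp (t * a s) *\<^sub>R q s)))
      \<longlongrightarrow> (LINT s|M. exp (t * a s) *\<^sub>R (a s *\<^sub>R q s))) (at 0)"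
    by (rule Lim_transform_eventually)
  then show "((\<lambda>t. LINT s|M. exp (t * a s) *\<^sub>R q s) has_vector_derivative
            (LINT s|M. exp (t * a s) *\<^sub>R (a s *\<^sub>R q s))) (at t)"
    by (rule has_vector_derivative_of_quotient)
qed

section \<open>Tails of Fresnel integrals\<close>

lemma has_bochner_integral_of_has_integral:
  fixes f :: "real \<Rightarrow> real"
  assumes [measurable]: "f \<in> borel_measurable borel" "A \<in> sets borel"
    and nn: "\<And>x. x \<in> A \<Longrightarrow> 0 \<le> f x" and I: "(f has_integral I) A"
  shows "has_bochner_integral lborel (\<lambda>x. indicator A x * f x) I"
proof (rule has_bochner_integral_nn_integral)
  have I': "((\<lambda>x. indicator A x * f x) has_integral I) UNIV"
  proof -
    have "(\<lambda>x. indicator A x * f x) = (\<lambda>x. if x \<in> A then f x else 0)" by (auto simp: indicator_def)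
    then show ?thesis using I by (simp add: has_integral_restrict_UNIV)
  qed
  show "AE x in lborel. 0 \<le> indicator A x * f x" using nn by (auto simp: indicator_def)
  show "0 \<le> I" using has_integral_nonneg[OF I nn] by auto
  show "(\<integral>\<^sup>+ x. ennreal (indicator A x * f x) \<partial>lborel) = ennreal I"
    using nn_integral_has_integral_lborel[OF _ _ I'] nn by (auto simp: indicator_def)
qed (use assms in auto)

lemma gamma_laplace:
  fixes a W :: real
  assumes "a > 0" "W > 0"
  shows "has_bochner_integral lborel (\<lambda>s. exp (W * - s) * (indicator {0<..} s * s powr (a - 1))) (Gamma a * W powr (- a))"
proof -
  have "has_bochner_integral lborel (\<lambda>t::real. indicator {0..} t * (t powr (a - 1) / exp t)) (Gamma a)"
    by (rule has_bochner_integral_of_has_integral) (use Gamma_integral_real[of a] assms in auto)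
  then have "has_bochner_integral lborel (\<lambda>s. indicator {0..} (0 + W * s) * ((0 + W * s) powr (a - 1) / exp (0 + W * s))) (Gamma a /\<^sub>R \<bar>W\<bar>)"
    using assms by (subst (asm) lborel_has_bochner_integral_real_affine_iff[of W _ _ 0]) auto
  then have "has_bochner_integral lborel (\<lambda>s. W powr (1 - a) * (indicator {0..} (0 + W * s) * ((0 + W * s) powr (a - 1) / exp (0 + W * s))))
     (W powr (1 - a) * (Gamma a /\<^sub>R \<bar>W\<bar>))"
    by (rule has_bochner_integral_mult_right)
  also have "W powr (1 - a) * (Gamma a /\<^sub>R \<bar>W\<bar>) = Gamma a * W powr (- a)"
    using assms by (simp add: powr_diff powr_minus field_simps)
  also have "(\<lambda>s. W powr (1 - a) * (indicator {0..} (0 + W * s) * ((0 + W * s) powr (a - 1) / exp (0 + W * s))))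
     = (\<lambda>s. exp (W * - s) * (indicator {0<..} s * s powr (a - 1)))"
  proof
    fix s :: real
    consider "s < 0" | "s = 0" | "s > 0" by linarith
    then show "W powr (1 - a) * (indicator {0..} (0 + W * s) * ((0 + W * s) powr (a - 1) / exp (0 + W * s)))
        = exp (W * - s) * (indicator {0<..} s * s powr (a - 1))"
    proof cases
      case 1
      then have "W * s < 0" using assms by (simp add: mult_pos_neg)
      then show ?thesis using 1 by simp
    next
      case 3
      then show ?thesis using assms 
        by (simp add: powr_mult exp_minus powr_diff field_simps)
    qed simp
  qed
  finally show ?thesis .
qed

text \<open>
  For \<open>W > 0\<close>, \<open>fresnel_tail a W\<close> is the conditionally convergent integral
  \<open>\<integral>\<^sub>W\<^sup>\<infinity> w\<^sup>-\<^sup>a exp(- i w) dw\<close>. Inserting \<open>w\<^sup>-\<^sup>a = 1/Gamma(a) \<integral>\<^sub>0\<^sup>\<infinity> s\<^sup>a\<^sup>-\<^sup>1 exp(- w s) ds\<close> and integrating over \<open>w\<close>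
  first gives the absolutely convergent form below, which also makes sense at \<open>W = 0\<close> for
  \<open>0 < a < 1\<close>.
\<close>

definition fresnel_kernel :: "real \<Rightarrow> real \<Rightarrow> complex" where
  "fresnel_kernel a s = indicator {0<..} s *\<^sub>R (of_real (s powr (a - 1)) / (of_real s + \<i>))"

definition fresnel_tail :: "real \<Rightarrow> real \<Rightarrow> complex" where
  "fresnel_tail a W = cis (- W) * (LINT s|lborel. exp (W * - s) *\<^sub>R fresnel_kernel a s) / of_real (Gamma a)"

lemma fresnel_kernel_measurable [measurable]: "fresnel_kernel a \<in> borel_measurable borel"
  unfolding fresnel_kernel_def by measurable

lemma cmod_add_i_ge: "cmod (of_real s + \<i>) \<ge> 1" "cmod (of_real s + \<i>) \<ge> \<bar>s\<bar>"
  using abs_Im_le_cmod[of "of_real s + \<i>"] abs_Re_le_cmod[of "of_real s + \<i>"] by auto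

lemma norm_fresnel_kernel: "norm (fresnel_kernel a s) = indicator {0<..} s * s powr (a - 1) / cmod (of_real s + \<i>)"
  by (simp add: fresnel_kernel_def norm_divide)

text \<open>
  The exponent \<open>c\<close> interpolates between \<open>\<bar>s + i\<bar> \<ge> 1\<close> and \<open>\<bar>s + i\<bar> \<ge> s\<close>.
\<close>

lemma norm_fresnel_kernel_le:
  assumes c: "0 \<le> c" "c \<le> 1"
  shows "norm (fresnel_kernel a s) \<le> indicator {0<..} s * s powr (a - c - 1)"
proof (cases "s > 0")
  case True
  have "s powr c \<le> cmod (of_real s + \<i>)"
  proof (cases "s \<ge> 1")
    case True
    then have "s powr c \<le> s powr 1" using c by (intro powr_mono) auto
    also have "\<dots> \<le> cmod (of_real s + \<i>)" using cmod_add_i_ge(2)[of s] True by simp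
    finally show ?thesis .
  next
    case False
    then have "s powr c \<le> 1" using \<open>s > 0\<close> c by (intro powr_le1) auto
    then show ?thesis using cmod_add_i_ge(1)[of s] by simp
  qed
  then have "s powr (a - 1) / cmod (of_real s + \<i>) \<le> s powr (a - 1) / s powr c"
    using True by (intro divide_left_mono mult_pos_pos) (auto intro: less_le_trans[OF _ cmod_add_i_ge(1)])
  also have "\<dots> = s powr (a - c - 1)" using True by (simp add: powr_diff[symmetric] algebra_simps)
  finally show ?thesis using True by (simp add: norm_fresnel_kernel)
qed (simp add: fresnel_kernel_def)

lemma fresnel_kernel_laplace_integrable:
  assumes "a > 0" "W > 0"
  shows "integrable lborel (\<lambda>s. exp (W * - s) *\<^sub>R fresnel_kernel a s)"
proof (rule Bochner_Integration.integrable_bound)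
  show "integrable lborel (\<lambda>s. exp (W * - s) * (indicator {0<..} s * s powr (a - 1)))"
    using gamma_laplace[OF assms] by (auto simp: has_bochner_integral_iff)
  show "AE s in lborel. norm (exp (W * - s) *\<^sub>R fresnel_kernel a s) \<le> norm (exp (W * - s) * (indicator {0<..} s * s powr (a - 1)))"
    using norm_fresnel_kernel_le[of 0 a] by (auto simp: abs_mult intro!: mult_left_mono)
qed measurable

lemma fresnel_kernel_integrable:
  assumes "0 < a" "a < 1"
  shows "integrable lborel (fresnel_kernel a)"
proof (rule Bochner_Integration.integrable_bound)
  have "has_bochner_integral lborel (\<lambda>s. indicator {0..1} s * s powr (a - 1)) (1 powr (a - 1 + 1) / (a - 1 + 1))"
    by (rule has_bochner_integral_of_has_integral) (use assms has_integral_powr_from_0[of "a - 1" 1] in auto)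
  moreover have "has_bochner_integral lborel (\<lambda>s. indicator {1..} s * s powr (a - 2)) (- (1 powr (a - 2 + 1)) / (a - 2 + 1))"
    by (rule has_bochner_integral_of_has_integral) (use assms has_integral_powr_to_inf[of "a - 2" 1] in auto)
  ultimately show "integrable lborel (\<lambda>s::real. indicator {0..1} s * s powr (a - 1) + indicator {1..} s * s powr (a - 2))"
    by (auto simp: has_bochner_integral_iff)
  show "AE s in lborel. norm (fresnel_kernel a s) \<le> norm (indicator {0..1} s * s powr (a - 1) + indicator {1..} s * s powr (a - 2))"
  proof (intro AE_I2)
    fix s :: real
    consider "s \<le> 0" | "0 < s" "s < 1" | "s \<ge> 1" by linarith
    then show "norm (fresnel_kernel a s) \<le> norm (indicator {0..1} s * s powr (a - 1) + indicator {1..} s * s powr (a - 2))"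
    proof cases
      case 2 then show ?thesis using norm_fresnel_kernel_le[of 0 a s] by simp
    next
      case 3 
      then have "norm (fresnel_kernel a s) \<le> s powr (a - 2)" using norm_fresnel_kernel_le[of 1 a s] by simp
      also have "\<dots> \<le> norm (indicator {0..1} s * s powr (a - 1) + indicator {1..} s * s powr (a - 2))"
        using 3 by simp
      finally show ?thesis .
    qed (simp add: fresnel_kernel_def)
  qed
qed measurable

text \<open>
  Differentiating the kernel under the integral multiplies it by \<open>- s\<close>, differentiating the prefactor
  multiplies by \<open>- i\<close>; together \<open>- (s + i)\<close> cancels the denominator and Euler's integral is left.
\<close>

lemma fresnel_tail_deriv:
  assumes "a > 0" "W > 0"
  shows "(fresnel_tail a has_vector_derivative - (of_real (W powr (- a)) * cis (- W))) (at W)"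
proof -
  let ?L = "\<lambda>W. LINT s|lborel. exp (W * - s) *\<^sub>R fresnel_kernel a s"
  let ?L' = "LINT s|lborel. exp (W * - s) *\<^sub>R ((- s) *\<^sub>R fresnel_kernel a s)"
  have d: "(?L has_vector_derivative ?L') (at W)"
    by (rule laplace_deriv(2)[where l = 0]) (use assms fresnel_kernel_laplace_integrable in auto)
  have i1: "integrable lborel (\<lambda>s. exp (W * - s) *\<^sub>R ((- s) *\<^sub>R fresnel_kernel a s))"
    by (rule laplace_deriv(1)[where l = 0]) (use assms fresnel_kernel_laplace_integrable in auto)
  have "?L' - \<i> * ?L W = (LINT s|lborel. exp (W * - s) *\<^sub>R ((- s) *\<^sub>R fresnel_kernel a s) - \<i> * (exp (W * - s) *\<^sub>R fresnel_kernel a s))"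
    by (subst Bochner_Integration.integral_diff[OF i1 integrable_mult_right[OF fresnel_kernel_laplace_integrable[OF assms]]])
      (simp only: integral_mult_right_zero)
  also have "\<dots> = (LINT s|lborel. - of_real (exp (W * - s) * (indicator {0<..} s * s powr (a - 1))))"
  proof (rule Bochner_Integration.integral_cong[OF refl])
    fix s :: real
    have "of_real s + \<i> \<noteq> 0" using cmod_add_i_ge(1)[of s] by auto
    then show "exp (W * - s) *\<^sub>R ((- s) *\<^sub>R fresnel_kernel a s) - \<i> * (exp (W * - s) *\<^sub>R fresnel_kernel a s)
        = - of_real (exp (W * - s) * (indicator {0<..} s * s powr (a - 1)))"
      by (auto simp: fresnel_kernel_def scaleR_conv_of_real indicator_def divide_simps) (simp_all add: algebra_simps)
  qed
  also have "\<dots> = - of_real (Gamma a * W powr (- a))"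
    using gamma_laplace[OF assms] by (simp add: has_bochner_integral_iff del: of_real_mult)
  finally have e: "?L' - \<i> * ?L W = - of_real (Gamma a * W powr (- a))" .
  have "Gamma a > 0" using assms by simp
  have "((\<lambda>z. exp (- (\<i> * z))) has_field_derivative exp (- (\<i> * of_real W)) * (- \<i>)) (at (of_real W))"
    by (auto intro!: derivative_eq_intros)
  from has_vector_derivative_real_field[OF this]
  have c: "((\<lambda>W. cis (- W)) has_vector_derivative cis (- W) * (- \<i>)) (at W)"
    by (simp add: cis_conv_exp)
  have "(fresnel_tail a has_vector_derivative ((cis (- W) * (- \<i>)) * ?L W + cis (- W) * ?L') / of_real (Gamma a)) (at W)"
    unfolding fresnel_tail_def[abs_def]
    unfolding divide_inverse
    by (rule has_vector_derivative_mult_left) (use has_vector_derivative_mult[OF c d] in \<open>simp add: add.commute\<close>)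
  also have "((cis (- W) * (- \<i>)) * ?L W + cis (- W) * ?L') / of_real (Gamma a)
     = cis (- W) * (?L' - \<i> * ?L W) / of_real (Gamma a)" by (simp add: algebra_simps)
  also have "\<dots> = - (of_real (W powr (- a)) * cis (- W))"
    unfolding e using \<open>Gamma a > 0\<close> by simp
  finally show ?thesis .
qed

text \<open>
  The choice \<open>c = 0\<close> gives the true decay rate. A small positive \<open>c\<close> gives up some decay for a milder
  singularity at \<open>W = 0\<close>, and this is what makes later remainders integrable.
\<close>

lemma fresnel_tail_bound:
  assumes "a > c" "0 \<le> c" "c \<le> 1" "W > 0"
  shows "norm (fresnel_tail a W) \<le> Gamma (a - c) / Gamma a * W powr (- (a - c))"
proof -
  have G: "Gamma a > 0" using assms by simp
  have "norm (LINT s|lborel. exp (W * - s) *\<^sub>R fresnel_kernel a s) \<le> (LINT s|lborel. norm (exp (W * - s) *\<^sub>R fresnel_kernel a s))"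
    by (rule integral_norm_bound)
  also have "\<dots> \<le> (LINT s|lborel. exp (W * - s) * (indicator {0<..} s * s powr (a - c - 1)))"
  proof (rule integral_mono)
    show "integrable lborel (\<lambda>s. norm (exp (W * - s) *\<^sub>R fresnel_kernel a s))"
      using assms by (intro integrable_norm fresnel_kernel_laplace_integrable) auto
    show "integrable lborel (\<lambda>s. exp (W * - s) * (indicator {0<..} s * s powr (a - c - 1)))"
      using gamma_laplace[of "a - c" W] assms by (simp add: has_bochner_integral_iff)
    show "norm (exp (W * - s) *\<^sub>R fresnel_kernel a s) \<le> exp (W * - s) * (indicator {0<..} s * s powr (a - c - 1))" for s
      using norm_fresnel_kernel_le[of c a s] assms by (simp add: mult_left_mono)
  qed
  also have "\<dots> = Gamma (a - c) * W powr (- (a - c))"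
    using gamma_laplace[of "a - c" W] assms by (simp add: has_bochner_integral_iff)
  finally show ?thesis using G by (simp add: fresnel_tail_def norm_mult norm_divide divide_right_mono)
qed

lemma fresnel_tail_continuous:
  assumes "0 < a" "a < 1"
  shows "continuous_on {0..} (fresnel_tail a)"
  unfolding fresnel_tail_def
proof (intro continuous_intros)
  show "continuous_on {0..} (\<lambda>W. LINT s|lborel. exp (W * - s) *\<^sub>R fresnel_kernel a s)"
    unfolding continuous_on_def
  proof
    fix W0 :: real assume "W0 \<in> {0..}"
    show "((\<lambda>W. LINT s|lborel. exp (W * - s) *\<^sub>R fresnel_kernel a s) \<longlongrightarrow> (LINT s|lborel. exp (W0 * - s) *\<^sub>R fresnel_kernel a s)) (at W0 within {0..})"
    proof (rule dominated_convergence_at[where w = "\<lambda>s. norm (fresnel_kernel a s)"])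
      show "\<forall>\<^sub>F W in at W0 within {0..}. \<forall>s\<in>space lborel. norm (exp (W * - s) *\<^sub>R fresnel_kernel a s) \<le> norm (fresnel_kernel a s)"
        unfolding eventually_at_filter
      proof (intro always_eventually allI impI ballI)
        fix W s :: real assume "W \<in> {0..}"
        then show "norm (exp (W * - s) *\<^sub>R fresnel_kernel a s) \<le> norm (fresnel_kernel a s)"
          by (auto simp: fresnel_kernel_def indicator_def mult_left_le_one_le)
      qed
      show "((\<lambda>W. exp (W * - s) *\<^sub>R fresnel_kernel a s) \<longlongrightarrow> exp (W0 * - s) *\<^sub>R fresnel_kernel a s) (at W0 within {0..})" for s
        by (intro tendsto_intros)
    qed (use fresnel_kernel_integrable[OF assms] in auto)
  qed
qed (use assms in \<open>auto simp: Gamma_eq_zero_iff\<close>)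

text \<open>
  This sign is the reason why the \<open>r\<^sup>-\<^sup>3\<^sup>/\<^sup>4\<close> term does not vanish.
\<close>

lemma Im_fresnel_tail_0_neg:
  assumes "0 < a" "a < 1"
  shows "Im (fresnel_tail a 0) < 0"
proof -
  have Im: "Im (fresnel_kernel a s) = - (indicator {0<..} s * s powr (a - 1) / (s\<^sup>2 + 1))" for s
    by (simp add: fresnel_kernel_def Im_divide)
  have "0 < (LINT s::real|lborel. indicator {1..2} s * (1/10::real))" by simp
  also have "\<dots> \<le> (LINT s|lborel. - Im (fresnel_kernel a s))"
  proof (rule integral_mono)
    show "integrable lborel (\<lambda>s. - Im (fresnel_kernel a s))" using fresnel_kernel_integrable[OF assms] by auto
    show "indicator {1..2} s * (1 / 10) \<le> - Im (fresnel_kernel a s)" for s :: real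
    proof (cases "s \<in> {1..2}")
      case True
      have "1 / 2 \<le> 1 / s" using True by (simp add: field_simps)
      also have "\<dots> = s powr (-1)" using True by (simp add: powr_minus field_simps)
      also have "\<dots> \<le> s powr (a - 1)" using True assms by (intro powr_mono) auto
      finally have "1 / 2 \<le> s powr (a - 1)" .
      moreover have "s\<^sup>2 + 1 \<le> 5" using True power_mono[of s 2 2] by auto
      moreover have "0 < s\<^sup>2 + 1" by (simp add: add_nonneg_pos)
      ultimately have "(1 / 2) / 5 \<le> s powr (a - 1) / (s\<^sup>2 + 1)" by (intro frac_le) auto
      then show ?thesis using True by (simp add: Im)
    next
      case False
      then have "indicator {1..2} s = (0::real)" by (auto simp: indicator_def)
      then show ?thesis by (simp add: Im)
    qed
  qed auto
  also have "\<dots> = - Im (LINT s|lborel. fresnel_kernel a s)" using fresnel_kernel_integrable[OF assms] by simp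
  finally show ?thesis using assms by (simp add: fresnel_tail_def Im_divide_of_real divide_neg_pos)
qed

text \<open>
  The real part (\<open>\<sigma> = -1\<close>) and the negative imaginary part (\<open>\<sigma> = 1\<close>) of the Fresnel integral of
  exponent \<open>1/2\<close>, by the classical primitives of \<open>1 / (1 + x\<^sup>4)\<close> and \<open>x\<^sup>2 / (1 + x\<^sup>4)\<close> with \<open>s = x\<^sup>2\<close>.
\<close>

lemma fresnel_half_component:
  fixes \<sigma> :: real
  assumes \<sigma>: "\<sigma> = 1 \<or> \<sigma> = -1"
  shows "(LINT s|lborel. indicator {0<..} s * (s powr (- \<sigma> / 2) / (s\<^sup>2 + 1))) = pi / sqrt 2"
proof -
  define F where "F s = (1 / sqrt 2) * (arctan (sqrt (2 * s) + 1) + arctan (sqrt (2 * s) - 1))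
      + \<sigma> / (2 * sqrt 2) * (ln (s + sqrt (2 * s) + 1) - ln (s - sqrt (2 * s) + 1))" for s
  have deriv: "(F has_real_derivative s powr (- \<sigma> / 2) / (s\<^sup>2 + 1)) (at s)" if "s > 0" for s
  proof -
    define r where "r = sqrt (2 * s)"
    have r: "r > 0" "s = r\<^sup>2 / 2" using that by (auto simp: r_def)
    have "s + r + 1 > 0" using r(1) that by linarith
    have eq: "s - r + 1 = ((r - 1)\<^sup>2 + 1) / 2" by (simp add: r power2_eq_square field_simps)
    have "s - r + 1 > 0" unfolding eq by (simp add: add_nonneg_pos)
    have q1: "1 + (r + 1)\<^sup>2 = 2 * (s + r + 1)" "1 + (r - 1)\<^sup>2 = 2 * (s - r + 1)" by (simp_all add: r power2_eq_square field_simps)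
    have q2: "s\<^sup>2 + 1 = (s + r + 1) * (s - r + 1)" by (simp add: r power2_eq_square field_simps)
    have dr: "((\<lambda>s. sqrt (2 * s)) has_real_derivative 1 / r) (at s)"
      using that by (auto intro!: derivative_eq_intros simp: r_def field_simps)
    have "(F has_real_derivative (1 / sqrt 2) * ((1 / r) / (2 * (s + r + 1)) + (1 / r) / (2 * (s - r + 1)))
        + \<sigma> / (2 * sqrt 2) * ((1 + 1 / r) / (s + r + 1) - (1 - 1 / r) / (s - r + 1))) (at s)"
    proof -
      have p: "((\<lambda>s. sqrt (2 * s) + 1) has_real_derivative 1 / r) (at s)" "((\<lambda>s. sqrt (2 * s) - 1) has_real_derivative 1 / r) (at s)"
        using DERIV_add[OF dr DERIV_const[of 1]] DERIV_diff[OF dr DERIV_const[of 1]] by simp_all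
      have A: "((\<lambda>s. arctan (sqrt (2 * s) + 1)) has_real_derivative (1 / r) / (2 * (s + r + 1))) (at s)"
              "((\<lambda>s. arctan (sqrt (2 * s) - 1)) has_real_derivative (1 / r) / (2 * (s - r + 1))) (at s)"
        using DERIV_chain2[OF DERIV_arctan p(1)] DERIV_chain2[OF DERIV_arctan p(2)]
        unfolding r_def[symmetric] q1 by (simp_all add: divide_inverse mult_ac)
      have q: "((\<lambda>s. s + sqrt (2 * s) + 1) has_real_derivative 1 + 1 / r) (at s)" "((\<lambda>s. s - sqrt (2 * s) + 1) has_real_derivative 1 - 1 / r) (at s)"
        using DERIV_add[OF DERIV_add[OF DERIV_ident dr] DERIV_const[of 1]] DERIV_add[OF DERIV_diff[OF DERIV_ident dr] DERIV_const[of 1]] by simp_all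
      have L: "((\<lambda>s. ln (s + sqrt (2 * s) + 1)) has_real_derivative (1 + 1 / r) / (s + r + 1)) (at s)"
              "((\<lambda>s. ln (s - sqrt (2 * s) + 1)) has_real_derivative (1 - 1 / r) / (s - r + 1)) (at s)"
        using DERIV_chain2[OF DERIV_ln q(1)] DERIV_chain2[OF DERIV_ln q(2)] \<open>s + r + 1 > 0\<close> \<open>s - r + 1 > 0\<close>
        unfolding r_def[symmetric] by (simp_all add: divide_inverse mult.commute)
      show ?thesis unfolding F_def by (intro DERIV_add DERIV_diff DERIV_cmult A L)
    qed
    also have "(1 / sqrt 2) * ((1 / r) / (2 * (s + r + 1)) + (1 / r) / (2 * (s - r + 1)))
        + \<sigma> / (2 * sqrt 2) * ((1 + 1 / r) / (s + r + 1) - (1 - 1 / r) / (s - r + 1))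
      = ((s + 1) + \<sigma> * (1 - s)) / (sqrt 2 * r) / (s\<^sup>2 + 1)"
    proof -
      have "(1 / r) / (2 * (s + r + 1)) + (1 / r) / (2 * (s - r + 1)) = (s + 1) / r / (s\<^sup>2 + 1)"
        unfolding q2 using r(1) \<open>s + r + 1 > 0\<close> \<open>s - r + 1 > 0\<close> by (simp add: divide_simps) (simp add: algebra_simps)
      moreover have "(1 + 1 / r) / (s + r + 1) - (1 - 1 / r) / (s - r + 1) = 2 * (1 - s) / r / (s\<^sup>2 + 1)"
        unfolding q2 using r(1) \<open>s + r + 1 > 0\<close> \<open>s - r + 1 > 0\<close> 
        by (simp add: divide_simps) (simp add: algebra_simps r(2) power2_eq_square)
      moreover have "(1 / sqrt 2) * ((s + 1) / r / (s\<^sup>2 + 1)) + \<sigma> / (2 * sqrt 2) * (2 * (1 - s) / r / (s\<^sup>2 + 1))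
          = ((s + 1) + \<sigma> * (1 - s)) / (sqrt 2 * r) / (s\<^sup>2 + 1)"
      proof -
        have "s\<^sup>2 + 1 \<noteq> 0" by (simp add: add_nonneg_eq_0_iff)
        then show ?thesis using r(1) by (simp add: divide_simps) (simp add: algebra_simps)
      qed
      ultimately show ?thesis by (simp only:)
    qed
    also have "((s + 1) + \<sigma> * (1 - s)) / (sqrt 2 * r) = s powr (- \<sigma> / 2)"
      using \<sigma> that by (auto simp: r_def real_sqrt_mult powr_minus powr_half_sqrt field_simps)
    finally show ?thesis .
  qed
  have lims: "((F \<circ> real_of_ereal) \<longlongrightarrow> 0) (at_right 0)" "((F \<circ> real_of_ereal) \<longlongrightarrow> pi / sqrt 2) (at_left \<infinity>)"
  proof -
    have "isCont F 0" unfolding F_def by (intro continuous_intros) auto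
    then have "(F \<longlongrightarrow> F 0) (at_right 0)" by (simp add: isCont_def filterlim_at_split)
    moreover have "F 0 = 0" by (simp add: F_def arctan_minus)
    ultimately show "((F \<circ> real_of_ereal) \<longlongrightarrow> 0) (at_right 0)" by (simp add: zero_ereal_def ereal_tendsto_simps)
    have "((\<lambda>s. arctan (sqrt (2 * s) + 1)) \<longlongrightarrow> pi / 2) at_top" "((\<lambda>s. arctan (sqrt (2 * s) - 1)) \<longlongrightarrow> pi / 2) at_top"
      by (rule filterlim_compose[OF tendsto_arctan_at_top]; real_asymp)+
    moreover have "((\<lambda>s::real. ln (s + sqrt (2 * s) + 1) - ln (s - sqrt (2 * s) + 1)) \<longlongrightarrow> 0) at_top" by real_asymp
    ultimately have "(F \<longlongrightarrow> (1 / sqrt 2) * (pi / 2 + pi / 2) + \<sigma> / (2 * sqrt 2) * 0) at_top"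
      unfolding F_def by (intro tendsto_intros)
    then show "((F \<circ> real_of_ereal) \<longlongrightarrow> pi / sqrt 2) (at_left \<infinity>)" by (simp add: ereal_tendsto_simps)
  qed
  have "(LBINT s=0..\<infinity>. s powr (- \<sigma> / 2) / (s\<^sup>2 + 1)) = pi / sqrt 2 - 0"
  proof (rule interval_integral_FTC_nonneg(2)[where F = F])
    show "isCont (\<lambda>s. s powr (- \<sigma> / 2) / (s\<^sup>2 + 1)) s" if "0 < ereal s" for s
      using that by (intro continuous_intros) (auto simp: add_nonneg_eq_0_iff)
  qed (use deriv lims in auto)
  then show ?thesis by (simp add: interval_lebesgue_integral_0_infty set_lebesgue_integral_def)
qed

text \<open>
  The value has to be known exactly here, in contrast to exponent \<open>1/4\<close>: the leading term of the
  stationary phase expansion must cancel against the far field.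
\<close>

lemma fresnel_tail_half_0: "fresnel_tail (1/2) 0 = of_real (sqrt (pi / 2)) * (1 - \<i>)"
proof -
  have Im: "Im (fresnel_kernel (1/2) s) = - (indicator {0<..} s * (s powr (- 1 / 2) / (s\<^sup>2 + 1)))" for s
    by (simp add: fresnel_kernel_def Im_divide)
  have Re: "Re (fresnel_kernel (1/2) s) = indicator {0<..} s * (s powr (- (-1) / 2) / (s\<^sup>2 + 1))" for s
  proof (cases "s > 0")
    case True
    then have "s powr (- 1 / 2) * s = s powr (1 / 2)" using powr_mult_base[of s "- 1 / 2"] by (simp add: mult.commute)
    then show ?thesis using True by (simp add: fresnel_kernel_def Re_divide)
  qed (simp add: fresnel_kernel_def)
  have "(LINT s|lborel. fresnel_kernel (1/2) s) = Complex (LINT s|lborel. Re (fresnel_kernel (1/2) s)) (LINT s|lborel. Im (fresnel_kernel (1/2) s))"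
    using fresnel_kernel_integrable[of "1/2"] by (simp add: complex_eq_iff)
  also have "\<dots> = Complex (pi / sqrt 2) (- (pi / sqrt 2))"
    using fresnel_half_component[of 1] fresnel_half_component[of "-1"] unfolding Im Re by simp
  finally have "fresnel_tail (1/2) 0 = Complex (pi / sqrt 2) (- (pi / sqrt 2)) / of_real (sqrt pi)"
    by (simp add: fresnel_tail_def Gamma_one_half_real)
  also have "\<dots> = of_real (pi / sqrt pi / sqrt 2) * (1 - \<i>)"
    by (simp add: complex_eq_iff Re_divide_of_real Im_divide_of_real)
  also have "pi / sqrt pi / sqrt 2 = sqrt (pi / 2)" by (simp add: real_div_sqrt real_sqrt_divide)
  finally show ?thesis .
qed

section \<open>One-sided stationary phase\<close>

lemma one_minus_cos: "1 - cos u = 2 * (sin (u / 2))\<^sup>2" for u :: real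
  using cos_double_sin[of "u / 2"] by simp

lemma sin_eq_half: "sin u = 2 * sin (u / 2) * cos (u / 2)" for u :: real
  using sin_double[of "u / 2"] by simp

lemma sin_ge_chord:
  assumes "0 \<le> x" "x \<le> pi / 2"
  shows "2 / pi * x \<le> sin (x::real)"
proof -
  have "concave_on {0..pi} sin"
    by (rule f''_le0_imp_concave[where f' = cos and f'' = "\<lambda>x. - sin x"])
      (auto intro!: derivative_eq_intros sin_ge_zero)
  from concave_onD[OF this, of "2 / pi * x" 0 "pi / 2"] show ?thesis
    using assms by (simp add: field_simps)
qed

lemma half_angle_bounds:
  assumes "0 \<le> u" "u \<le> b" "b < (pi::real)"
  shows "sin (u / 2) \<ge> u / pi" "cos (u / 2) \<ge> cos (b / 2)" "cos (b / 2) > 0" "cos (u / 2) > 0"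
proof -
  show "sin (u / 2) \<ge> u / pi" using sin_ge_chord[of "u / 2"] assms by (simp add: field_simps)
  show 1: "cos (u / 2) \<ge> cos (b / 2)" using assms by (intro cos_monotone_0_pi_le) auto
  show 2: "cos (b / 2) > 0" using assms by (intro cos_gt_zero_pi) auto
  show "cos (u / 2) > 0" using 1 2 by linarith
qed

lemma one_minus_cos_pos: "0 < u \<Longrightarrow> u < pi \<Longrightarrow> 0 < 1 - cos u" for u :: real
  using cos_monotone_0_pi[of 0 u] by simp

text \<open>
  Put \<open>X = sqrt (2 sin (u/2))\<close>, so that \<open>1 - cos u = X\<^sup>4 / 2\<close> and \<open>sin u = X\<^sup>2 cos (u/2)\<close>. In the variable
  \<open>x = l (1 - cos u)\<close> the integral of \<open>X\<^sup>2\<^sup>-\<^sup>4\<^sup>a cos (u/2) exp(- i x)\<close> becomes a multiple of the integral of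
  \<open>x\<^sup>-\<^sup>a exp(- i x)\<close>. Thus the amplitudes \<open>cos (u/2)\<close> (\<open>a = 1/2\<close>) and \<open>X cos (u/2)\<close> (\<open>a = 1/4\<close>) have
  oscillatory integrals in closed form. The weight \<open>w\<close> is only prescribed in the open interval because
  the power of \<open>X\<close> is \<open>0\<close>, not \<open>1\<close>, at \<open>u = 0\<close> if \<open>a = 1/2\<close>.
\<close>

lemma fresnel_phase_integral:
  assumes a: "0 < a" "a < 1" and l: "l > 0" and v: "0 \<le> v" "v \<le> b" "b < pi"
    and w: "\<And>u. 0 < u \<Longrightarrow> u < b \<Longrightarrow> w u = sqrt (2 * sin (u / 2)) powr (2 - 4 * a)"
  shows "((\<lambda>u. of_real (w u * cos (u / 2)) * cis (- (l * (1 - cos u)))) has_integral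
     of_real (2 powr (- a) * l powr (a - 1)) * (fresnel_tail a (l * (1 - cos v)) - fresnel_tail a (l * (1 - cos b)))) {v..b}"
proof -
  define k where "k = 2 powr (- a) * l powr (a - 1)"
  define F where "F u = - (of_real k * fresnel_tail a (l * (1 - cos u)))" for u
  have "((\<lambda>u. of_real (w u * cos (u / 2)) * cis (- (l * (1 - cos u)))) has_integral (F b - F v)) {v..b}"
  proof (rule fundamental_theorem_of_calculus_interior_strong[of "{}"])
    show "continuous_on {v..b} F"
      unfolding F_def using l
      by (intro continuous_intros continuous_on_compose2[OF fresnel_tail_continuous[OF a]]) auto
    fix u assume "u \<in> {v<..<b} - {}"
    then have u: "0 < u" "u < b" "u < pi" using v by auto
    define X where "X = sqrt (2 * sin (u / 2))"
    have s: "sin (u / 2) > 0" using u by (intro sin_gt_zero) auto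
    have X: "X > 0" "X\<^sup>2 = 2 * sin (u / 2)" using s by (auto simp: X_def)
    have W: "l * (1 - cos u) > 0" using one_minus_cos_pos[of u] u l by simp
    have "l * (1 - cos u) = l * (X powr 4 / 2)"
    proof -
      have "X powr 4 = (X\<^sup>2)\<^sup>2" using X(1) by (simp add: powr_numeral flip: power_mult)
      then show ?thesis unfolding one_minus_cos X(2) by (simp add: power2_eq_square)
    qed
    then have "(l * (1 - cos u)) powr (- a) = (l * (X powr 4 / 2)) powr (- a)" by (simp only:)
    also have "\<dots> = l powr (- a) * ((X powr 4) powr (- a) / 2 powr (- a))"
      using l X by (subst powr_mult, simp, simp, subst powr_divide) simp_all
    also have "(X powr 4) powr (- a) = X powr (- 4 * a)" by (subst powr_powr) simp
    finally have "(l * (1 - cos u)) powr (- a) = l powr (- a) * X powr (- 4 * a) * 2 powr a"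
      by (simp add: powr_minus divide_inverse)
    then have "k * (l * sin u * (l * (1 - cos u)) powr (- a)) = (2 powr (- a) * 2 powr a) * (l powr (a - 1) * l * l powr (- a)) * (X\<^sup>2 * X powr (- 4 * a)) * cos (u / 2)"
      unfolding k_def sin_eq_half[of u] X(2) by (simp add: mult_ac)
    also have "2 powr (- a) * 2 powr a = (1::real)" by (simp flip: powr_add)
    also have "l powr (a - 1) * l * l powr (- a) = 1" using l by (simp add: powr_mult_base powr_minus field_simps powr_diff)
    also have "X\<^sup>2 * X powr (- 4 * a) = X powr (2 - 4 * a)"
      using X by (simp add: powr_diff powr_minus field_simps powr_numeral)
    finally have eq: "k * (l * sin u * (l * (1 - cos u)) powr (- a)) = w u * cos (u / 2)"
      using w[of u] u by (simp add: X_def)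
    have "((\<lambda>u. l * (1 - cos u)) has_vector_derivative l * sin u) (at u)"
      unfolding has_real_derivative_iff_has_vector_derivative[symmetric] by (auto intro!: derivative_eq_intros)
    from vector_diff_chain_at[OF this fresnel_tail_deriv[OF a(1) W]]
    have "((\<lambda>u. fresnel_tail a (l * (1 - cos u))) has_vector_derivative
       (l * sin u) *\<^sub>R - (of_real ((l * (1 - cos u)) powr (- a)) * cis (- (l * (1 - cos u))))) (at u)"
      by (simp add: comp_def)
    then have "(F has_vector_derivative - (of_real k * ((l * sin u) *\<^sub>R - (of_real ((l * (1 - cos u)) powr (- a)) * cis (- (l * (1 - cos u))))))) (at u)"
      unfolding F_def by (auto intro!: derivative_eq_intros)
    also have "- (of_real k * ((l * sin u) *\<^sub>R - (of_real ((l * (1 - cos u)) powr (- a)) * cis (- (l * (1 - cos u))))))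
       = of_real (k * (l * sin u * (l * (1 - cos u)) powr (- a))) * cis (- (l * (1 - cos u)))"
      by (simp add: scaleR_conv_of_real)
    finally show "(F has_vector_derivative of_real (w u * cos (u / 2)) * cis (- (l * (1 - cos u)))) (at u)"
      unfolding eq .
  qed (use v in auto)
  also have "F b - F v = of_real k * (fresnel_tail a (l * (1 - cos v)) - fresnel_tail a (l * (1 - cos b)))"
    by (simp add: F_def algebra_simps)
  finally show ?thesis by (simp add: k_def)
qed

lemma fresnel_phase_half:
  assumes "l > 0" "0 \<le> v" "v \<le> b" "b < pi"
  shows "((\<lambda>u. of_real (cos (u / 2)) * cis (- (l * (1 - cos u)))) has_integral
     of_real (2 powr (-1/2) * l powr (-1/2)) * (fresnel_tail (1/2) (l * (1 - cos v)) - fresnel_tail (1/2) (l * (1 - cos b)))) {v..b}"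
proof -
  have "(1::real) = sqrt (2 * sin (u / 2)) powr (2 - 4 * (1 / 2))" if "0 < u" "u < b" for u
  proof -
    have "sin (u / 2) > 0" using that assms by (intro sin_gt_zero) auto
    then show ?thesis by simp
  qed
  from fresnel_phase_integral[of "1/2" l v b "\<lambda>_. 1", OF _ _ _ _ _ _ this] show ?thesis using assms by simp
qed

lemma fresnel_phase_quarter:
  assumes "l > 0" "0 \<le> v" "v \<le> b" "b < pi"
  shows "((\<lambda>u. of_real (sqrt (2 * sin (u / 2))) * (of_real (cos (u / 2)) * cis (- (l * (1 - cos u))))) has_integral
     of_real (2 powr (-1/4) * l powr (-3/4)) * (fresnel_tail (1/4) (l * (1 - cos v)) - fresnel_tail (1/4) (l * (1 - cos b)))) {v..b}"
proof -
  have "sqrt (2 * sin (u / 2)) = sqrt (2 * sin (u / 2)) powr (2 - 4 * (1 / 4))" if "0 < u" "u < b" for u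
  proof -
    have "sin (u / 2) > 0" using that assms by (intro sin_gt_zero) auto
    then show ?thesis by simp
  qed
  from fresnel_phase_integral[of "1/4" l v b, OF _ _ _ _ _ _ this] show ?thesis using assms by (simp add: mult.assoc)
qed

lemma fresnel_tail_phase_bound:
  assumes "1/8 < a" "l > 0" "0 < v" "v < pi"
  shows "norm (fresnel_tail a (l * (1 - cos v))) \<le> Gamma (a - 1/8) / Gamma a * (2 / pi\<^sup>2) powr (1/8 - a) * (l powr (1/8 - a) * v powr (1/4 - 2 * a))"
proof -
  have s: "sin (v / 2) \<ge> v / pi" using half_angle_bounds[of v v] assms by simp
  then have "(v / pi)\<^sup>2 \<le> (sin (v / 2))\<^sup>2" using assms by (intro power_mono) auto
  then have ge: "l * (2 / pi\<^sup>2 * v\<^sup>2) \<le> l * (1 - cos v)"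
    unfolding one_minus_cos using assms by (intro mult_left_mono) (auto simp: power_divide)
  have pos: "l * (2 / pi\<^sup>2 * v\<^sup>2) > 0" using assms by simp
  have "norm (fresnel_tail a (l * (1 - cos v))) \<le> Gamma (a - 1/8) / Gamma a * (l * (1 - cos v)) powr (- (a - 1/8))"
    using assms one_minus_cos_pos[of v] by (intro fresnel_tail_bound) auto
  also have "\<dots> \<le> Gamma (a - 1/8) / Gamma a * (l * (2 / pi\<^sup>2 * v\<^sup>2)) powr (- (a - 1/8))"
  proof (rule mult_left_mono)
    show "(l * (1 - cos v)) powr (- (a - 1/8)) \<le> (l * (2 / pi\<^sup>2 * v\<^sup>2)) powr (- (a - 1/8))"
      by (rule powr_mono2') (use ge pos assms in auto)
  qed (use assms in \<open>auto intro!: divide_nonneg_nonneg less_imp_le[OF Gamma_real_pos]\<close>)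
  also have "(l * (2 / pi\<^sup>2 * v\<^sup>2)) powr (- (a - 1/8)) = (2 / pi\<^sup>2) powr (1/8 - a) * (l powr (1/8 - a) * v powr (1/4 - 2 * a))"
  proof -
    have v2: "v\<^sup>2 = v powr 2" using assms by (simp add: powr_numeral)
    have "(l * (2 / pi\<^sup>2 * v\<^sup>2)) powr (- (a - 1/8)) = l powr (- (a - 1/8)) * ((2 / pi\<^sup>2) powr (- (a - 1/8)) * (v powr 2) powr (- (a - 1/8)))"
      unfolding v2 by (simp only: powr_mult)
    also have "(v powr 2) powr (- (a - 1/8)) = v powr (1/4 - 2 * a)" by (subst powr_powr) (simp add: algebra_simps)
    finally show ?thesis by simp
  qed
  finally show ?thesis by (simp only: mult.assoc)
qed

text \<open>
  Integrate by parts against \<open>K(v) = \<integral>\<^sub>v\<^sup>b cos (u/2) exp(- i l (1 - cos u)) du\<close>. Both boundary terms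
  vanish, by \<open>h 0 = 0\<close> and \<open>K b = 0\<close>. The sharp bound \<open>K(v) = O(l\<^sup>-\<^sup>1 v\<^sup>-\<^sup>1)\<close> would require \<open>h' / v\<close> to be
  integrable, which fails for bounded \<open>h'\<close>; the weaker \<open>K(v) = O(l\<^sup>-\<^sup>7\<^sup>/\<^sup>8 v\<^sup>-\<^sup>3\<^sup>/\<^sup>4)\<close> is integrable and still
  beats \<open>l\<^sup>-\<^sup>3\<^sup>/\<^sup>4\<close>. The finite set \<open>P\<close> leaves room for interior points where \<open>h\<close> has an infinite slope.
\<close>

lemma amplitude_remainder_bound:
  fixes h h' :: "real \<Rightarrow> complex"
  assumes b: "0 < b" "b < pi" and P: "finite P"
    and h: "continuous_on {0..b} h" "h 0 = 0"
    and h': "\<And>u. u \<in> {0<..<b} - P \<Longrightarrow> (h has_vector_derivative h' u) (at u)"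
    and D: "\<And>u. u \<in> {0<..<b} - P \<Longrightarrow> norm (h' u) \<le> D u" "\<And>u. D u \<ge> 0"
    and int: "(\<lambda>u. D u * u powr (-3/4)) integrable_on {0..b}"
  shows "\<exists>C. \<forall>l>0. norm (integral {0..b} (\<lambda>u. h u * (of_real (cos (u / 2)) * cis (- (l * (1 - cos u)))))) \<le> C * l powr (-7/8)"
proof -
  define k where "k = Gamma (1/2 - 1/8) / Gamma (1/2) * (2 / pi\<^sup>2) powr (1/8 - 1/2 :: real)"
  have k: "k \<ge> 0" by (auto simp: k_def intro!: divide_nonneg_nonneg mult_nonneg_nonneg less_imp_le[OF Gamma_real_pos])
  define C0 where "C0 = 2 powr (-1/2) * (2 * k)"
  have main: "norm (integral {0..b} (\<lambda>u. h u * (of_real (cos (u / 2)) * cis (- (l * (1 - cos u))))))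
     \<le> C0 * integral {0..b} (\<lambda>u. D u * u powr (-3/4)) * l powr (-7/8)" if l: "l > 0" for l
  proof -
    define g where "g u = of_real (cos (u / 2)) * cis (- (l * (1 - cos u)))" for u
    define K where "K v = of_real (2 powr (-1/2) * l powr (-1/2)) *
        (fresnel_tail (1/2) (l * (1 - cos v)) - fresnel_tail (1/2) (l * (1 - cos b)))" for v
    have K_int: "(g has_integral K v) {v..b}" if "0 \<le> v" "v \<le> b" for v
      unfolding g_def K_def by (rule fresnel_phase_half) (use that b l in auto)
    have g_cont: "continuous_on A g" for A
      unfolding g_def by (intro continuous_intros) auto
    have K_cont: "continuous_on {0..b} K"
      unfolding K_def using l
      by (intro continuous_intros continuous_on_compose2[OF fresnel_tail_continuous[of "1/2"]]) auto
    have K_deriv: "(K has_vector_derivative - g u) (at u)" if u: "u \<in> {0<..<b}" for u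
    proof -
      have "((\<lambda>v. integral {0..v} g) has_vector_derivative g u) (at u within {0..b})"
        using u by (intro integral_has_vector_derivative[OF g_cont]) auto
      then have "((\<lambda>v. K 0 - integral {0..v} g) has_vector_derivative 0 - g u) (at u within {0..b})"
        by (intro derivative_intros)
      then have "((\<lambda>v. K 0 - integral {0..v} g) has_vector_derivative - g u) (at u)"
        using u by (simp add: at_within_Icc_at)
      then show ?thesis
      proof (rule has_vector_derivative_transform_within_open[of _ _ _ "{0<..<b}"])
        fix v assume v: "v \<in> {0<..<b}"
        have "integral {0..v} g + integral {v..b} g = integral {0..b} g"
          using v by (intro Henstock_Kurzweil_Integration.integral_combine integrable_continuous_real g_cont) auto
        moreover have "integral {v..b} g = K v" "integral {0..b} g = K 0"
          using K_int[of 0] K_int[of v] v b by (auto simp: integral_unique)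
        ultimately show "K 0 - integral {0..v} g = K v" by (simp add: algebra_simps)
      qed (use u in auto)
    qed
    have K_b: "K b = 0" by (simp add: K_def)
    have K_bound: "norm (K v) \<le> C0 * l powr (-7/8) * v powr (-3/4)" if v: "0 < v" "v \<le> b" for v
    proof -
      have fb: "norm (fresnel_tail (1/2) (l * (1 - cos w))) \<le> k * (l powr (-3/8) * w powr (-3/4))" if "0 < w" "w \<le> b" for w
        using fresnel_tail_phase_bound[of "1/2" l w] that b l by (simp add: k_def)
      have "b powr (-3/4) \<le> v powr (-3/4)" using v by (intro powr_mono2') auto
      then have "k * (l powr (-3/8) * b powr (-3/4)) \<le> k * (l powr (-3/8) * v powr (-3/4))"
        using k by (intro mult_left_mono) auto
      then have "norm (fresnel_tail (1/2) (l * (1 - cos v)) - fresnel_tail (1/2) (l * (1 - cos b))) \<le> 2 * (k * (l powr (-3/8) * v powr (-3/4)))"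
        using fb[of v] fb[of b] v b norm_triangle_ineq4[of "fresnel_tail (1/2) (l * (1 - cos v))" "fresnel_tail (1/2) (l * (1 - cos b))"] by linarith
      then have "norm (K v) \<le> (2 powr (-1/2) * l powr (-1/2)) * (2 * (k * (l powr (-3/8) * v powr (-3/4))))"
        unfolding K_def by (simp add: norm_mult abs_mult mult_left_mono)
      also have "\<dots> = C0 * (l powr (-1/2) * l powr (-3/8)) * v powr (-3/4)"
        by (simp add: C0_def)
      also have "l powr (-1/2) * l powr (-3/8) = l powr (-7/8)" by (simp flip: powr_add)
      finally show ?thesis .
    qed
    define h0 where "h0 u = (if u \<in> P \<union> {0, b} then 0 else h' u)" for u
    have hg: "(\<lambda>u. h u * g u) integrable_on {0..b}"
      by (intro integrable_continuous_real continuous_intros h g_cont)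
    have "((\<lambda>u. h0 u * K u) has_integral integral {0..b} (\<lambda>u. h u * g u)) {0..b}"
    proof (rule integration_by_parts_interior_strong[OF bounded_bilinear_mult, of "P"])
      show "((\<lambda>u. h u * - g u) has_integral h b * K b - h 0 * K 0 - integral {0..b} (\<lambda>u. h u * g u)) {0..b}"
        using has_integral_neg[OF integrable_integral[OF hg]] by (simp add: h K_b)
      show "(h has_vector_derivative h0 u) (at u)" if "u \<in> {0<..<b} - P" for u
        using h'[OF that] that by (auto simp: h0_def)
    qed (use b P h K_cont K_deriv in auto)
    moreover have "norm (integral {0..b} (\<lambda>u. h0 u * K u)) \<le> integral {0..b} (\<lambda>u. C0 * l powr (-7/8) * (D u * u powr (-3/4)))"
    proof (rule integral_norm_bound_integral)
      show "(\<lambda>u. h0 u * K u) integrable_on {0..b}" using calculation by (auto simp: integrable_on_def)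
      show "(\<lambda>u. C0 * l powr (-7/8) * (D u * u powr (-3/4))) integrable_on {0..b}"
        using int by (rule integrable_on_mult_right)
      fix u assume u: "u \<in> {0..b}"
      have "C0 \<ge> 0" using k by (simp add: C0_def)
      show "norm (h0 u * K u) \<le> C0 * l powr (-7/8) * (D u * u powr (-3/4))"
      proof (cases "u \<in> P \<union> {0, b}")
        case True
        then show ?thesis using D(2)[of u] \<open>C0 \<ge> 0\<close> by (auto simp: h0_def)
      next
        case False
        then have "norm (h' u) * norm (K u) \<le> D u * (C0 * l powr (-7/8) * u powr (-3/4))"
          using u by (intro mult_mono D K_bound) auto
        then show ?thesis using False by (simp add: h0_def norm_mult mult_ac)
      qed
    qed
    ultimately have "norm (integral {0..b} (\<lambda>u. h u * g u)) \<le> integral {0..b} (\<lambda>u. C0 * l powr (-7/8) * (D u * u powr (-3/4)))"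
      by (simp only: integral_unique)
    also have "\<dots> = C0 * l powr (-7/8) * integral {0..b} (\<lambda>u. D u * u powr (-3/4))" by (rule integral_mult_right)
    finally show ?thesis unfolding g_def by (simp only: mult_ac)
  qed
  then show ?thesis by blast
qed

text \<open>
  The model square root: it behaves like \<open>sqrt u\<close> at \<open>0\<close>, and \<open>1 - cos u\<close> is half its fourth power.
\<close>

definition chord_root :: "real \<Rightarrow> real" where
  "chord_root u = sqrt (2 * sin (u / 2))"

text \<open>
  The contributions of an amplitude \<open>a + c sqrt u\<close> at the endpoint \<open>u = 0\<close>, of the orders \<open>l\<^sup>-\<^sup>1\<^sup>/\<^sup>2\<close> and
  \<open>l\<^sup>-\<^sup>3\<^sup>/\<^sup>4\<close>.
\<close>

definition saddle_terms :: "complex \<Rightarrow> complex \<Rightarrow> real \<Rightarrow> complex" where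
  "saddle_terms a c l = a * of_real (2 powr (-1/2) * l powr (-1/2)) * fresnel_tail (1/2) 0
     + c * of_real (2 powr (-1/4) * l powr (-3/4)) * fresnel_tail (1/4) 0"

definition saddle_expansion :: "real \<Rightarrow> (real \<Rightarrow> complex) \<Rightarrow> complex \<Rightarrow> complex \<Rightarrow> bool" where
  "saddle_expansion b F a c \<longleftrightarrow> (\<exists>C. \<forall>l\<ge>1.
     norm (integral {0..b} (\<lambda>u. F u * cis (- (l * (1 - cos u)))) - saddle_terms a c l) \<le> C * l powr (-7/8))"

lemma saddle_terms_add: "saddle_terms a c l + saddle_terms a' c' l = saddle_terms (a + a') (c + c') l"
  by (simp add: saddle_terms_def distrib_right)

lemma saddle_expansion_cong:
  assumes "\<And>u. u \<in> {0..b} \<Longrightarrow> F u = G u" "saddle_expansion b F a c"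
  shows "saddle_expansion b G a c"
proof -
  have "integral {0..b} (\<lambda>u. F u * cis (- (l * (1 - cos u)))) = integral {0..b} (\<lambda>u. G u * cis (- (l * (1 - cos u))))" for l
    by (intro Henstock_Kurzweil_Integration.integral_cong) (simp add: assms(1))
  then show ?thesis using assms(2) by (simp add: saddle_expansion_def)
qed

text \<open>
  Subtracting \<open>H 0 + c * chord_root u\<close> leaves an amplitude that vanishes at \<open>0\<close> and whose derivative is
  the quantity bounded by \<open>D\<close>; the subtracted part is integrated exactly, up to tails that start at
  the fixed distance \<open>b\<close> from the stationary point.
\<close>

lemma stationary_phase_one_sided:
  fixes H H' :: "real \<Rightarrow> complex"
  assumes b: "0 < b" "b < pi" and P: "finite P"
    and H: "continuous_on {0..b} H"
    and H': "\<And>u. u \<in> {0<..<b} - P \<Longrightarrow> (H has_vector_derivative H' u) (at u)"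
    and D: "\<And>u. u \<in> {0<..<b} - P \<Longrightarrow> norm (H' u - c * of_real (cos (u / 2) / (2 * chord_root u))) \<le> D u" "\<And>u. D u \<ge> 0"
    and int: "(\<lambda>u. D u * u powr (-3/4)) integrable_on {0..b}"
  shows "saddle_expansion b (\<lambda>u. H u * of_real (cos (u / 2))) (H 0) c"
proof -
  define h where "h u = H u - H 0 - c * of_real (chord_root u)" for u
  have X_cont: "continuous_on {0..b} chord_root" unfolding chord_root_def by (intro continuous_intros) auto
  have "\<exists>C. \<forall>l>0. norm (integral {0..b} (\<lambda>u. h u * (of_real (cos (u / 2)) * cis (- (l * (1 - cos u)))))) \<le> C * l powr (-7/8)"
  proof (rule amplitude_remainder_bound[OF b P _ _ _ D int])
    show "continuous_on {0..b} h" unfolding h_def by (intro continuous_intros H X_cont)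
    show "h 0 = 0" by (simp add: h_def chord_root_def)
    fix u assume u: "u \<in> {0<..<b} - P"
    have s: "sin (u / 2) > 0" using u b by (intro sin_gt_zero) auto
    have "(chord_root has_real_derivative cos (u / 2) / (2 * chord_root u)) (at u)"
      unfolding chord_root_def using s by (auto intro!: derivative_eq_intros simp: field_simps)
    then have "((\<lambda>u. of_real (chord_root u)) has_vector_derivative complex_of_real (cos (u / 2) / (2 * chord_root u))) (at u)"
      by (intro has_vector_derivative_of_real) (simp add: has_real_derivative_iff_has_vector_derivative)
    then have "(h has_vector_derivative H' u - 0 - c * of_real (cos (u / 2) / (2 * chord_root u))) (at u)"
      unfolding h_def
      by (intro has_vector_derivative_diff has_vector_derivative_mult_right has_vector_derivative_const H'[OF u])
    then show "(h has_vector_derivative H' u - c * of_real (cos (u / 2) / (2 * chord_root u))) (at u)" by simp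
  qed
  then obtain C where C: "\<And>l. l > 0 \<Longrightarrow> norm (integral {0..b} (\<lambda>u. h u * (of_real (cos (u / 2)) * cis (- (l * (1 - cos u)))))) \<le> C * l powr (-7/8)"
    by blast
  define k where "k a = Gamma (a - 1/8) / Gamma a * (2 / pi\<^sup>2) powr (1/8 - a) * b powr (1/4 - 2 * a)" for a :: real
  define M where "M = C + norm (H 0) * (2 powr (-1/2) * k (1/2)) + norm c * (2 powr (-1/4) * k (1/4))"
  have "norm (integral {0..b} (\<lambda>u. H u * of_real (cos (u / 2)) * cis (- (l * (1 - cos u)))) - saddle_terms (H 0) c l) \<le> M * l powr (-7/8)"
    if l: "l \<ge> 1" for l
  proof -
    let ?g = "\<lambda>u. of_real (cos (u / 2)) * cis (- (l * (1 - cos u)))"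
    let ?t = "\<lambda>a. fresnel_tail a (l * (1 - cos b))"
    let ?m1 = "complex_of_real (2 powr (-1/2) * l powr (-1/2))" and ?m2 = "complex_of_real (2 powr (-1/4) * l powr (-3/4))"
    have i1: "(?g has_integral ?m1 * (fresnel_tail (1/2) 0 - ?t (1/2))) {0..b}"
      using fresnel_phase_half[of l 0 b] b l by simp
    have i2: "((\<lambda>u. of_real (chord_root u) * ?g u) has_integral ?m2 * (fresnel_tail (1/4) 0 - ?t (1/4))) {0..b}"
      using fresnel_phase_quarter[of l 0 b] b l by (simp add: chord_root_def)
    have i3: "((\<lambda>u. h u * ?g u) has_integral integral {0..b} (\<lambda>u. h u * ?g u)) {0..b}"
      unfolding h_def by (intro integrable_integral integrable_continuous_real continuous_intros H X_cont) auto
    have "((\<lambda>u. H 0 * ?g u + c * (of_real (chord_root u) * ?g u) + h u * ?g u) has_integral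
       H 0 * (?m1 * (fresnel_tail (1/2) 0 - ?t (1/2))) + c * (?m2 * (fresnel_tail (1/4) 0 - ?t (1/4)))
         + integral {0..b} (\<lambda>u. h u * ?g u)) {0..b}"
      by (intro has_integral_add has_integral_mult_right i1 i2 i3)
    also have "(\<lambda>u. H 0 * ?g u + c * (of_real (chord_root u) * ?g u) + h u * ?g u) = (\<lambda>u. H u * of_real (cos (u / 2)) * cis (- (l * (1 - cos u))))"
      by (simp add: h_def fun_eq_iff algebra_simps)
    finally have eq: "integral {0..b} (\<lambda>u. H u * of_real (cos (u / 2)) * cis (- (l * (1 - cos u)))) - saddle_terms (H 0) c l
      = integral {0..b} (\<lambda>u. h u * ?g u) - H 0 * (?m1 * ?t (1/2)) - c * (?m2 * ?t (1/4))"
      by (simp add: integral_unique saddle_terms_def algebra_simps)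
    have tb: "norm (z * (of_real (x * l powr e) * ?t a)) \<le> norm z * (x * k a) * l powr (-7/8)"
      if "1/8 < a" "e = a - 1" "x \<ge> 0" for z x e a
    proof -
      have "norm (?t a) \<le> k a * l powr (1/8 - a)"
        using fresnel_tail_phase_bound[of a l b] that b l by (simp add: k_def mult_ac)
      then have "norm z * (x * l powr e * norm (?t a)) \<le> norm z * (x * l powr e * (k a * l powr (1/8 - a)))"
        using that by (intro mult_left_mono) auto
      also have "\<dots> = norm z * (x * k a) * (l powr e * l powr (1/8 - a))" by simp
      also have "l powr e * l powr (1/8 - a) = l powr (-7/8)" unfolding that by (simp flip: powr_add)
      finally show ?thesis using that by (simp add: norm_mult abs_mult)
    qed
    have "norm (integral {0..b} (\<lambda>u. h u * ?g u) - H 0 * (?m1 * ?t (1/2)) - c * (?m2 * ?t (1/4)))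
       \<le> norm (integral {0..b} (\<lambda>u. h u * ?g u)) + norm (H 0 * (?m1 * ?t (1/2))) + norm (c * (?m2 * ?t (1/4)))"
      by (rule order_trans[OF norm_triangle_ineq4]) (simp add: norm_triangle_ineq4)
    also have "\<dots> \<le> C * l powr (-7/8) + norm (H 0) * (2 powr (-1/2) * k (1/2)) * l powr (-7/8) + norm c * (2 powr (-1/4) * k (1/4)) * l powr (-7/8)"
      using C[of l] l by (intro add_mono tb) auto
    finally show ?thesis unfolding eq M_def by (simp only: distrib_right)
  qed
  then show ?thesis unfolding saddle_expansion_def by blast
qed

section \<open>The branch square root\<close>

text \<open>
  The boundary value of the square root on the real axis, with \<open>- i\<close> on the negative half-axis. It is
  the function of \<open>z\<^sup>2 - a\<^sup>2\<close> to which \<open>S z a\<close> reduces for real \<open>z\<close>.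
\<close>

definition ssq :: "real \<Rightarrow> complex" where
  "ssq m = of_real (sqrt (max m 0)) - \<i> * of_real (sqrt (max (- m) 0))"

lemma ssq_pos: "m \<ge> 0 \<Longrightarrow> ssq m = of_real (sqrt m)"
  by (auto simp: ssq_def max_def)

lemma ssq_neg: "m \<le> 0 \<Longrightarrow> ssq m = - \<i> * of_real (sqrt (- m))"
  by (auto simp: ssq_def max_def)

lemma ssq_0 [simp]: "ssq 0 = 0" by (simp add: ssq_pos)

lemma ssq_square: "ssq m * ssq m = of_real m"
proof (cases "m \<ge> 0")
  case False
  have "(- \<i> * of_real x) * (- \<i> * of_real x) = - of_real (x * x)" for x :: real
    by (simp add: complex_eq_iff)
  from this[of "sqrt (- m)"] show ?thesis using False by (simp only: ssq_neg) simp
qed (simp add: ssq_pos flip: of_real_mult)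

lemma norm_ssq: "norm (ssq m) = sqrt \<bar>m\<bar>"
  by (cases "m \<ge> 0") (simp_all add: ssq_pos ssq_neg norm_mult)

lemma ssq_eq_0_iff [simp]: "ssq m = 0 \<longleftrightarrow> m = 0"
  using norm_ssq[of m] by (auto simp: ssq_pos)

lemma ssq_scale:
  assumes "x \<ge> 0"
  shows "ssq (x\<^sup>2 * m) = of_real x * ssq m"
proof (cases "m \<ge> 0")
  case True
  then show ?thesis using assms by (simp add: ssq_pos real_sqrt_mult)
next
  case False
  then have "x\<^sup>2 * m \<le> 0" by (simp add: mult_nonneg_nonpos)
  moreover have "- (x\<^sup>2 * m) = x\<^sup>2 * (- m)" by simp
  then have "sqrt (- (x\<^sup>2 * m)) = x * sqrt (- m)" using assms by (simp only: real_sqrt_mult) simp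
  ultimately show ?thesis using False by (simp add: ssq_neg)
qed

lemma continuous_on_ssq [continuous_intros]:
  "continuous_on A f \<Longrightarrow> continuous_on A (\<lambda>x. ssq (f x))"
  unfolding ssq_def
  by (intro continuous_on_diff continuous_on_mult continuous_on_const continuous_on_of_real
      continuous_on_real_sqrt continuous_on_max continuous_on_minus)

lemma ssq_measurable [measurable]: "ssq \<in> borel_measurable borel"
  by (intro borel_measurable_continuous_onI continuous_intros)

text \<open>
  From \<open>(ssq a - ssq b) (ssq a + ssq b) = a - b\<close>: values of \<open>ssq\<close> lie on the positive real and the
  negative imaginary half-axis, so the sum cannot be smaller than either term.
\<close>

lemma norm_ssq_diff_le:
  assumes "b \<noteq> 0"
  shows "norm (ssq a - ssq b) \<le> \<bar>a - b\<bar> / sqrt \<bar>b\<bar>"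
proof -
  have "norm (ssq a + ssq b) \<ge> sqrt \<bar>b\<bar>"
  proof (cases "(a \<ge> 0) = (b \<ge> 0)")
    case True
    then have "norm (ssq a + ssq b) = sqrt \<bar>a\<bar> + sqrt \<bar>b\<bar>"
    proof (cases "a \<ge> 0")
      case True2: True
      then have "ssq a + ssq b = of_real (sqrt a + sqrt b)" using True by (simp add: ssq_pos)
      then show ?thesis using True2 True by (simp only: norm_of_real) simp
    next
      case False2: False
      then have "ssq a + ssq b = - \<i> * of_real (sqrt (- a) + sqrt (- b))" using True by (simp add: ssq_neg algebra_simps)
      then show ?thesis using False2 True by (simp only: norm_of_real norm_mult) simp
    qed
    then show ?thesis by simp
  next
    case False
    then consider "a \<ge> 0" "b < 0" | "a < 0" "b \<ge> 0" by linarith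
    then show ?thesis
    proof cases
      case 1
      then show ?thesis using abs_Im_le_cmod[of "ssq a + ssq b"] by (simp add: ssq_pos ssq_neg)
    next
      case 2
      then show ?thesis using abs_Re_le_cmod[of "ssq a + ssq b"] by (simp add: ssq_pos ssq_neg)
    qed
  qed
  moreover have "norm (ssq a - ssq b) * norm (ssq a + ssq b) = \<bar>a - b\<bar>"
  proof -
    have "(ssq a - ssq b) * (ssq a + ssq b) = of_real (a - b)" by (simp add: algebra_simps ssq_square)
    then show ?thesis by (metis norm_mult norm_of_real)
  qed
  ultimately have "norm (ssq a - ssq b) * sqrt \<bar>b\<bar> \<le> \<bar>a - b\<bar>"
    by (metis mult_left_mono norm_ge_zero)
  then show ?thesis using assms by (simp add: field_simps)
qed

lemma ssq_has_vector_derivative: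
  assumes "m \<noteq> 0"
  shows "(ssq has_vector_derivative 1 / (2 * ssq m)) (at m)"
proof (cases "m > 0")
  case True
  have "(sqrt has_vector_derivative 1 / (2 * sqrt m)) (at m)"
    unfolding has_real_derivative_iff_has_vector_derivative[symmetric]
    using True by (auto intro!: derivative_eq_intros simp: field_simps)
  then have "((\<lambda>x. of_real (sqrt x)) has_vector_derivative complex_of_real (1 / (2 * sqrt m))) (at m)"
    by (intro has_vector_derivative_of_real) (simp add: has_real_derivative_iff_has_vector_derivative)
  then have "(ssq has_vector_derivative complex_of_real (1 / (2 * sqrt m))) (at m)"
    by (rule has_vector_derivative_transform_within_open[of _ _ _ "{0<..}"]) (use True in \<open>auto simp: ssq_pos\<close>)
  then show ?thesis using True by (simp add: ssq_pos)
next
  case False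
  then have m: "m < 0" using assms by simp
  have "((\<lambda>x. sqrt (- x)) has_vector_derivative - (1 / (2 * sqrt (- m)))) (at m)"
    unfolding has_real_derivative_iff_has_vector_derivative[symmetric]
    using m by (auto intro!: derivative_eq_intros simp: field_simps)
  then have "((\<lambda>x. of_real (sqrt (- x))) has_vector_derivative complex_of_real (- (1 / (2 * sqrt (- m))))) (at m)"
    by (intro has_vector_derivative_of_real) (simp add: has_real_derivative_iff_has_vector_derivative)
  then have "((\<lambda>x. - \<i> * of_real (sqrt (- x))) has_vector_derivative - \<i> * complex_of_real (- (1 / (2 * sqrt (- m))))) (at m)"
    by (rule has_vector_derivative_mult_right)
  then have "(ssq has_vector_derivative - \<i> * complex_of_real (- (1 / (2 * sqrt (- m))))) (at m)"
    by (rule has_vector_derivative_transform_within_open[of _ _ _ "{..<0}"]) (use m in \<open>auto simp: ssq_neg\<close>)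
  moreover have "- \<i> * complex_of_real (- (1 / (2 * sqrt (- m)))) = 1 / (2 * ssq m)"
    using m by (subst eq_divide_eq) (simp add: ssq_neg)
  ultimately show ?thesis by (simp only:)
qed

text \<open>
  Hoelder continuity of exponent \<open>1/2\<close> at the endpoint \<open>0\<close> only. It keeps the
  increment of an amplitude, divided by \<open>sqrt u\<close>, bounded, and it survives products and exponentials.
\<close>

definition sqrt_holder :: "real \<Rightarrow> (real \<Rightarrow> complex) \<Rightarrow> bool" where
  "sqrt_holder b f \<longleftrightarrow> (\<exists>C. \<forall>u\<in>{0..b}. norm (f u - f 0) \<le> C * sqrt u)"

lemma sqrt_holder_const: "sqrt_holder b (\<lambda>_. c)"
  unfolding sqrt_holder_def by (intro exI[of _ 0]) auto

lemma sqrt_holder_add: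
  assumes "sqrt_holder b f" "sqrt_holder b g" shows "sqrt_holder b (\<lambda>u. f u + g u)"
proof -
  obtain C1 C2 where C: "\<forall>u\<in>{0..b}. norm (f u - f 0) \<le> C1 * sqrt u" "\<forall>u\<in>{0..b}. norm (g u - g 0) \<le> C2 * sqrt u"
    using assms unfolding sqrt_holder_def by blast
  show ?thesis unfolding sqrt_holder_def
  proof (intro exI ballI)
    fix u assume "u \<in> {0..b}"
    then have "norm ((f u - f 0) + (g u - g 0)) \<le> C1 * sqrt u + C2 * sqrt u"
      using C by (intro order_trans[OF norm_triangle_ineq] add_mono) auto
    then show "norm (f u + g u - (f 0 + g 0)) \<le> (C1 + C2) * sqrt u" by (simp add: algebra_simps)
  qed
qed

lemma sqrt_holder_mult:
  assumes f: "sqrt_holder b f" and g: "sqrt_holder b g"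
  shows "sqrt_holder b (\<lambda>u. f u * g u)"
proof -
  obtain C1 C2 where C: "\<And>u. u\<in>{0..b} \<Longrightarrow> norm (f u - f 0) \<le> C1 * sqrt u" "\<And>u. u\<in>{0..b} \<Longrightarrow> norm (g u - g 0) \<le> C2 * sqrt u"
    using assms unfolding sqrt_holder_def by blast
  define F where "F = norm (f 0) + \<bar>C1\<bar> * sqrt \<bar>b\<bar>"
  show ?thesis unfolding sqrt_holder_def
  proof (intro exI ballI)
    fix u assume u: "u \<in> {0..b}"
    have "norm (f u) \<le> norm (f 0) + norm (f u - f 0)" by (rule norm_triangle_sub)
    also have "norm (f u - f 0) \<le> \<bar>C1\<bar> * sqrt \<bar>b\<bar>"
      using u by (intro order_trans[OF C(1)[OF u]] mult_mono) auto
    finally have F: "norm (f u) \<le> F" by (simp add: F_def)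
    have "norm (f u * g u - f 0 * g 0) = norm (f u * (g u - g 0) + (f u - f 0) * g 0)" by (simp add: algebra_simps)
    also have "\<dots> \<le> F * (C2 * sqrt u) + C1 * sqrt u * norm (g 0)"
      unfolding norm_mult[symmetric] using C[OF u] F order_trans[OF norm_ge_zero C(1)[OF u]] order_trans[OF norm_ge_zero F]
      by (intro order_trans[OF norm_triangle_ineq] add_mono) (auto simp: norm_mult intro!: mult_mono)
    finally show "norm (f u * g u - f 0 * g 0) \<le> (F * C2 + C1 * norm (g 0)) * sqrt u" by (simp add: algebra_simps)
  qed
qed

lemma sqrt_holder_lipschitz:
  assumes "\<And>u. u \<in> {0..b} \<Longrightarrow> norm (f u - f 0) \<le> L * u"
  shows "sqrt_holder b f"
  unfolding sqrt_holder_def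
proof (intro exI ballI)
  fix u assume u: "u \<in> {0..b}"
  have "norm (f u - f 0) \<le> \<bar>L\<bar> * u"
    using u by (intro order_trans[OF assms[OF u]] mult_right_mono) auto
  also have "\<dots> = \<bar>L\<bar> * (sqrt u * sqrt u)" using u by simp
  also have "\<dots> \<le> \<bar>L\<bar> * (sqrt b * sqrt u)" using u by (intro mult_left_mono mult_right_mono) auto
  finally show "norm (f u - f 0) \<le> (\<bar>L\<bar> * sqrt b) * sqrt u" by simp
qed

lemma sqrt_holder_C1:
  fixes f :: "real \<Rightarrow> complex"
  assumes f: "\<And>u. u \<in> {0..b} \<Longrightarrow> (f has_vector_derivative f' u) (at u)" and c: "continuous_on {0..b} f'"
  shows "sqrt_holder b f"
proof (cases "b \<ge> 0")
  case True
  have "bounded (f' ` {0..b})" by (intro compact_imp_bounded compact_continuous_image c) auto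
  then obtain L where L: "\<And>u. u \<in> {0..b} \<Longrightarrow> norm (f' u) \<le> L" unfolding bounded_iff by blast
  show ?thesis
  proof (rule sqrt_holder_lipschitz)
    fix u assume u: "u \<in> {0..b}"
    have "norm (f u - f 0) \<le> L * norm (u - 0)"
    proof (rule differentiable_bound[of "{0..b}" f "\<lambda>x h. h *\<^sub>R f' x"])
      show "(f has_derivative (\<lambda>h. h *\<^sub>R f' x)) (at x within {0..b})" if "x \<in> {0..b}" for x
        using has_vector_derivative_at_within[OF f[OF that]] by (simp add: has_vector_derivative_def)
      show "onorm (\<lambda>h. h *\<^sub>R f' x) \<le> L" if "x \<in> {0..b}" for x
        using L[OF that] by (intro onorm_le) (auto simp: mult.commute[of _ "norm (f' x)"] intro!: mult_right_mono)
    qed (use u True in auto)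
    then show "norm (f u - f 0) \<le> L * u" using u by simp
  qed
qed (auto simp: sqrt_holder_def)

lemma sqrt_holder_exp:
  assumes "sqrt_holder b f"
  shows "sqrt_holder b (\<lambda>u. exp (f u))"
proof -
  obtain C where C: "\<And>u. u\<in>{0..b} \<Longrightarrow> norm (f u - f 0) \<le> C * sqrt u"
    using assms unfolding sqrt_holder_def by blast
  define F where "F = \<bar>C\<bar> * sqrt \<bar>b\<bar>"
  show ?thesis unfolding sqrt_holder_def
  proof (intro exI ballI)
    fix u assume u: "u \<in> {0..b}"
    have F: "norm (f u - f 0) \<le> F"
      unfolding F_def using u by (intro order_trans[OF C(1)[OF u]] mult_mono) auto
    have "norm (exp (f u) - exp (f 0)) = norm (exp (f 0) * (exp (f u - f 0) - 1))" by (simp add: exp_diff algebra_simps)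
    also have "\<dots> \<le> norm (exp (f 0)) * ((C * sqrt u) * exp F)"
    proof -
      have "norm (exp (f u - f 0) - 1) \<le> exp (norm (f u - f 0)) * norm (f u - f 0)"
      proof -
        have "norm (exp (f u - f 0) - exp 0) \<le> exp (norm (f u - f 0)) * norm (f u - f 0 - 0)"
        proof (rule field_differentiable_bound[of "cball 0 (norm (f u - f 0))" exp exp])
          show "(exp has_field_derivative exp z) (at z within cball 0 (norm (f u - f 0)))" for z
            by (rule has_field_derivative_at_within[OF DERIV_exp])
          show "norm (exp z) \<le> exp (norm (f u - f 0))" if "z \<in> cball 0 (norm (f u - f 0))" for z
            using that by (intro order_trans[OF norm_exp]) auto
        qed auto
        then show ?thesis by simp
      qed
      also have "\<dots> \<le> exp F * (C * sqrt u)" using F C[OF u] by (intro mult_mono) auto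
      finally show ?thesis unfolding norm_mult by (intro mult_left_mono) (auto simp: mult_ac)
    qed
    finally show "norm (exp (f u) - exp (f 0)) \<le> (norm (exp (f 0)) * C * exp F) * sqrt u" by (simp add: algebra_simps)
  qed
qed

lemma integrable_inverse_sqrt_dist:
  fixes p b :: real
  assumes "0 \<le> b"
  shows "(\<lambda>u. 1 / sqrt \<bar>u - p\<bar>) integrable_on {0..b}"
proof -
  define F where "F u = (if u \<le> p then - 2 * sqrt (p - u) else 2 * sqrt (u - p))" for u
  have "((\<lambda>u. 1 / sqrt \<bar>u - p\<bar>) has_integral F b - F 0) {0..b}"
  proof (rule fundamental_theorem_of_calculus_interior_strong[of "{p}"])
    have "continuous_on ({..p} \<union> {p..}) F"
      unfolding F_def by (intro continuous_on_If continuous_intros) auto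
    then show "continuous_on {0..b} F" by (rule continuous_on_subset) auto
    fix u assume u: "u \<in> {0<..<b} - {p}"
    show "(F has_vector_derivative 1 / sqrt \<bar>u - p\<bar>) (at u)"
      unfolding has_real_derivative_iff_has_vector_derivative[symmetric]
    proof (cases "u < p")
      case True
      have "((\<lambda>u. - 2 * sqrt (p - u)) has_real_derivative 1 / sqrt \<bar>u - p\<bar>) (at u)"
        using True by (auto intro!: derivative_eq_intros simp: field_simps)
      then show "(F has_real_derivative 1 / sqrt \<bar>u - p\<bar>) (at u)"
        by (rule has_field_derivative_transform_within_open[of _ _ _ "{..<p}"]) (use True in \<open>auto simp: F_def\<close>)
    next
      case False
      then have False: "u > p" using u by auto
      have "((\<lambda>u. 2 * sqrt (u - p)) has_real_derivative 1 / sqrt \<bar>u - p\<bar>) (at u)"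
        using False by (auto intro!: derivative_eq_intros simp: field_simps)
      then show "(F has_real_derivative 1 / sqrt \<bar>u - p\<bar>) (at u)"
        by (rule has_field_derivative_transform_within_open[of _ _ _ "{p<..}"]) (use False in \<open>auto simp: F_def\<close>)
    qed
  qed (use assms in auto)
  then show ?thesis by (auto simp: integrable_on_def)
qed

text \<open>
  The two singularities \<open>0\<close> and \<open>p\<close> are apart, so their product is dominated by their sum.
\<close>

lemma integrable_weighted_singularity:
  fixes p b C :: real
  assumes "0 \<le> b" "0 < p" "C \<ge> 0"
  shows "(\<lambda>u. C * (1 + 1 / sqrt \<bar>u - p\<bar>) * u powr (-3/4)) integrable_on {0..b}"
proof (rule measurable_bounded_by_integrable_imp_integrable)
  define M where "M = C * (1 + 1 / sqrt (p / 2) + (p / 2) powr (-3/4))"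
  show "(\<lambda>u. C * (1 + 1 / sqrt \<bar>u - p\<bar>) * u powr (-3/4)) \<in> borel_measurable (lebesgue_on {0..b})"
    by (rule measurable_restrict_space1, rule measurable_completion) measurable
  show "(\<lambda>u. M * u powr (-3/4) + M * (1 / sqrt \<bar>u - p\<bar>)) integrable_on {0..b}"
    using assms by (intro integrable_add integrable_on_mult_right integrable_on_powr_from_0 integrable_inverse_sqrt_dist) auto
  fix u assume u: "u \<in> {0..b}"
  have "(1 + 1 / sqrt \<bar>u - p\<bar>) * u powr (-3/4) \<le> (1 + 1 / sqrt (p / 2) + (p / 2) powr (-3/4)) * (u powr (-3/4) + 1 / sqrt \<bar>u - p\<bar>)"
  proof (cases "u < p / 2")
    case True
    have "1 / sqrt \<bar>u - p\<bar> \<le> 1 / sqrt (p / 2)"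
      using True assms u by (intro divide_left_mono mult_pos_pos real_sqrt_le_mono) auto
    then have "(1 + 1 / sqrt \<bar>u - p\<bar>) * u powr (-3/4) \<le> (1 + 1 / sqrt (p / 2)) * u powr (-3/4)"
      by (intro mult_right_mono) auto
    also have "\<dots> \<le> (1 + 1 / sqrt (p / 2) + (p / 2) powr (-3/4)) * (u powr (-3/4) + 1 / sqrt \<bar>u - p\<bar>)"
      using assms by (intro mult_mono) auto
    finally show ?thesis .
  next
    case False
    have "u powr (-3/4) \<le> (p / 2) powr (-3/4)" using False assms by (intro powr_mono2') auto
    then have "1 / sqrt \<bar>u - p\<bar> * u powr (-3/4) \<le> 1 / sqrt \<bar>u - p\<bar> * (p / 2) powr (-3/4)"
      by (intro mult_left_mono) auto
    then have "(1 + 1 / sqrt \<bar>u - p\<bar>) * u powr (-3/4) \<le> 1 * u powr (-3/4) + (p / 2) powr (-3/4) * (1 / sqrt \<bar>u - p\<bar>)"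
      by (simp add: algebra_simps)
    also have "\<dots> \<le> (1 + 1 / sqrt (p / 2) + (p / 2) powr (-3/4)) * u powr (-3/4) + (1 + 1 / sqrt (p / 2) + (p / 2) powr (-3/4)) * (1 / sqrt \<bar>u - p\<bar>)"
      using assms by (intro add_mono mult_right_mono) auto
    finally show ?thesis by (simp add: algebra_simps)
  qed
  then have "C * ((1 + 1 / sqrt \<bar>u - p\<bar>) * u powr (-3/4)) \<le> C * ((1 + 1 / sqrt (p / 2) + (p / 2) powr (-3/4)) * (u powr (-3/4) + 1 / sqrt \<bar>u - p\<bar>))"
    by (rule mult_left_mono) (use assms in auto)
  then show "norm (C * (1 + 1 / sqrt \<bar>u - p\<bar>) * u powr (-3/4)) \<le> M * u powr (-3/4) + M * (1 / sqrt \<bar>u - p\<bar>)"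
    using assms by (simp add: M_def algebra_simps)
qed auto

section \<open>Stationary phase with a square root at the stationary point\<close>

lemma abs_sin_ge:
  assumes "\<bar>x\<bar> \<le> \<rho>" "\<rho> < pi"
  shows "\<bar>sin x\<bar> \<ge> 2 / pi * cos (\<rho> / 2) * \<bar>x\<bar>"
proof -
  have b: "sin (\<bar>x\<bar> / 2) \<ge> \<bar>x\<bar> / pi" "cos (\<bar>x\<bar> / 2) \<ge> cos (\<rho> / 2)" "cos (\<rho> / 2) > 0"
    using half_angle_bounds[of "\<bar>x\<bar>" \<rho>] assms by auto
  have "2 / pi * cos (\<rho> / 2) * \<bar>x\<bar> = 2 * ((\<bar>x\<bar> / pi) * cos (\<rho> / 2))" by simp
  also have "\<dots> \<le> 2 * (sin (\<bar>x\<bar> / 2) * cos (\<bar>x\<bar> / 2))"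
  proof -
    have "0 \<le> \<bar>x\<bar> / pi" by simp
    then have "0 \<le> sin (\<bar>x\<bar> / 2)" using b(1) by linarith
    then show ?thesis using b by (intro mult_left_mono mult_mono) auto
  qed
  also have "\<dots> = sin \<bar>x\<bar>" by (simp add: sin_eq_half[of "\<bar>x\<bar>"])
  also have "\<dots> \<le> \<bar>sin x\<bar>" by (cases "x \<ge> 0") auto
  finally show ?thesis .
qed

text \<open>
  The square root factors as \<open>S = X * y\<close> with \<open>X = chord_root\<close> and \<open>y = ssq m\<close>,
  \<open>m u = \<epsilon> cos (u/2) sin (u - p)\<close>, since \<open>sin u = 2 sin (u/2) cos (u/2)\<close>. Near \<open>0\<close> the factor \<open>y\<close> is smooth, and
  the derivative of the amplitude is \<open>X' * (V * y)\<close> plus bounded terms, where \<open>V * y\<close> tends to \<open>c0\<close> with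
  an error \<open>O(sqrt u)\<close>: this is the square-root coefficient of the expansion. At \<open>p\<close> the factor \<open>y\<close> has
  its own branch point, where the derivative is of order \<open>1 / sqrt \<bar>u - p\<bar>\<close> and hence integrable. The sign
  \<open>\<epsilon>\<close> distinguishes the two sides of the stationary point.
\<close>

lemma stationary_phase_square_root:
  fixes \<alpha> \<beta> \<alpha>' \<beta>' S :: "real \<Rightarrow> complex" and \<kappa> :: complex
  assumes b: "0 < b" "b < pi" and p: "0 < p" "p < pi" "b - p < pi" and \<epsilon>: "\<epsilon> = 1 \<or> \<epsilon> = -1"
    and \<alpha>: "\<And>u. u \<in> {0..b} \<Longrightarrow> (\<alpha> has_vector_derivative \<alpha>' u) (at u)" "continuous_on {0..b} \<alpha>'"
    and \<beta>: "\<And>u. u \<in> {0..b} \<Longrightarrow> (\<beta> has_vector_derivative \<beta>' u) (at u)" "continuous_on {0..b} \<beta>'"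
    and S: "\<And>u. u \<in> {0..b} \<Longrightarrow> S u = ssq (\<epsilon> * (sin u * sin (u - p)))"
  shows "saddle_expansion b (\<lambda>u. (\<alpha> u + \<beta> u * S u) * exp (\<kappa> * S u)) (\<alpha> 0) ((\<beta> 0 + \<kappa> * \<alpha> 0) * ssq (- (\<epsilon> * sin p)))"
proof -
  \<comment> \<open>The exact Fresnel integrals carry the factor \<open>cos (u/2)\<close>, which is divided out of the amplitude.\<close>
  define sec where "sec u = 1 / cos (u / 2)" for u :: real
  define sec' where "sec' u = sin (u / 2) / (2 * (cos (u / 2))\<^sup>2)" for u :: real
  have cospos: "cos (u / 2) > 0" if "u \<in> {0..b}" for u
    using half_angle_bounds[of u b] that b by auto
  have sec: "((\<lambda>u. complex_of_real (sec u)) has_vector_derivative of_real (sec' u)) (at u)" if "u \<in> {0..b}" for u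
  proof -
    have "(sec has_real_derivative sec' u) (at u)"
      unfolding sec_def sec'_def using cospos[OF that] by (auto intro!: derivative_eq_intros simp: power2_eq_square)
    then show ?thesis by (simp add: has_vector_derivative_of_real has_real_derivative_iff_has_vector_derivative)
  qed
  have sec_cont: "continuous_on {0..b} (\<lambda>u. complex_of_real (sec u))" "continuous_on {0..b} (\<lambda>u. complex_of_real (sec' u))"
    unfolding sec_def sec'_def using cospos by (auto intro!: continuous_intros simp: less_imp_neq[symmetric])
  have \<alpha>_cont: "continuous_on {0..b} \<alpha>"
    by (intro continuous_at_imp_continuous_on ballI has_vector_derivative_continuous[OF \<alpha>(1)])
  have \<beta>_cont: "continuous_on {0..b} \<beta>"
    by (intro continuous_at_imp_continuous_on ballI has_vector_derivative_continuous[OF \<beta>(1)])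
  define A where "A u = \<alpha> u * of_real (sec u)" for u
  define B where "B u = \<beta> u * of_real (sec u)" for u
  define A' where "A' u = \<alpha> u * of_real (sec' u) + \<alpha>' u * of_real (sec u)" for u
  define B' where "B' u = \<beta> u * of_real (sec' u) + \<beta>' u * of_real (sec u)" for u
  have A: "(A has_vector_derivative A' u) (at u)" if "u \<in> {0..b}" for u
    unfolding A_def A'_def by (rule has_vector_derivative_mult[OF \<alpha>(1)[OF that] sec[OF that]])
  have B: "(B has_vector_derivative B' u) (at u)" if "u \<in> {0..b}" for u
    unfolding B_def B'_def by (rule has_vector_derivative_mult[OF \<beta>(1)[OF that] sec[OF that]])
  have A'_cont: "continuous_on {0..b} A'" and B'_cont: "continuous_on {0..b} B'"
    unfolding A'_def B'_def by (intro continuous_intros \<alpha>_cont \<beta>_cont sec_cont \<alpha> \<beta>)+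
  have A_cont: "continuous_on {0..b} A" and B_cont: "continuous_on {0..b} B"
    unfolding A_def B_def by (intro continuous_intros \<alpha>_cont \<beta>_cont sec_cont \<alpha> \<beta>)+
  define X where "X u = complex_of_real (chord_root u)" for u
  define X' where "X' u = complex_of_real (cos (u / 2) / (2 * chord_root u))" for u
  define m where "m u = \<epsilon> * (cos (u / 2) * sin (u - p))" for u :: real
  define m' where "m' u = \<epsilon> * (cos (u / 2) * cos (u - p) - sin (u / 2) * sin (u - p) / 2)" for u :: real
  define y where "y u = ssq (m u)" for u
  define y' where "y' u = m' u *\<^sub>R (1 / (2 * ssq (m u)))" for u
  define T where "T u = X u * y u" for u
  define T' where "T' u = X u * y' u + X' u * y u" for u
  \<comment> \<open>\<open>V\<close> is the derivative of \<open>(A + B T) exp(\<kappa> T)\<close> with respect to \<open>T\<close>.\<close>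
  define V where "V u = exp (\<kappa> * T u) * (B u + \<kappa> * A u + \<kappa> * B u * T u)" for u
  have ST: "S u = T u" if u: "u \<in> {0..b}" for u
  proof -
    have s: "sin (u / 2) \<ge> 0" using u b by (intro sin_ge_zero) auto
    then have "(chord_root u)\<^sup>2 = 2 * sin (u / 2)" by (simp add: chord_root_def)
    then have "\<epsilon> * (sin u * sin (u - p)) = (chord_root u)\<^sup>2 * m u"
      unfolding sin_eq_half[of u] m_def by simp
    then have "S u = ssq ((chord_root u)\<^sup>2 * m u)" using S[OF u] by simp
    moreover have "chord_root u \<ge> 0" using s by (simp add: chord_root_def)
    ultimately show ?thesis unfolding T_def X_def y_def by (simp only: ssq_scale)
  qed
  have m_der: "(m has_real_derivative m' u) (at u)" for u
    unfolding m_def m'_def by (auto intro!: derivative_eq_intros simp: algebra_simps)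
  have X_cont: "continuous_on {0..b} X" unfolding X_def chord_root_def by (intro continuous_intros) auto
  have y_cont: "continuous_on {0..b} y" unfolding y_def m_def by (intro continuous_intros) auto
  have T_cont: "continuous_on {0..b} T" unfolding T_def by (intro continuous_intros X_cont y_cont)
  have V_cont: "continuous_on {0..b} V" unfolding V_def by (intro continuous_intros T_cont A_cont B_cont)
  define \<rho> where "\<rho> = max p (b - p)"
  have \<rho>: "\<rho> < pi" using p by (simp add: \<rho>_def)
  define c1 where "c1 = cos (b / 2) * (2 / pi * cos (\<rho> / 2))"
  have c1: "c1 > 0" using b p \<rho> half_angle_bounds[of 0 b] half_angle_bounds[of 0 \<rho>] by (auto simp: c1_def \<rho>_def)
  have m_ge: "\<bar>m u\<bar> \<ge> c1 * \<bar>u - p\<bar>" if u: "u \<in> {0..b}" for u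
  proof -
    have "\<bar>m u\<bar> = cos (u / 2) * \<bar>sin (u - p)\<bar>" using \<epsilon> cospos[OF u] by (auto simp: m_def abs_mult)
    also have "\<dots> \<ge> cos (b / 2) * (2 / pi * cos (\<rho> / 2) * \<bar>u - p\<bar>)"
    proof (rule mult_mono)
      show "2 / pi * cos (\<rho> / 2) * \<bar>u - p\<bar> \<le> \<bar>sin (u - p)\<bar>"
        using u by (intro abs_sin_ge \<rho>) (auto simp: \<rho>_def)
      have "cos (\<rho> / 2) > 0" using half_angle_bounds[of 0 \<rho>] \<rho> p by (auto simp: \<rho>_def)
      then show "0 \<le> 2 / pi * cos (\<rho> / 2) * \<bar>u - p\<bar>" by simp
    qed (use half_angle_bounds[of u b] u b in auto)
    finally show ?thesis by (simp add: c1_def)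
  qed
  have sp: "sin p > 0" using p by (intro sin_gt_zero)
  have m0: "m 0 = - (\<epsilon> * sin p)" by (simp add: m_def)
  have m'_bd: "\<bar>m' u\<bar> \<le> 2" for u
  proof -
    have "\<bar>m' u\<bar> = \<bar>cos (u / 2) * cos (u - p) - sin (u / 2) * sin (u - p) / 2\<bar>" using \<epsilon> by (auto simp: m'_def)
    also have "\<dots> \<le> \<bar>cos (u / 2)\<bar> * \<bar>cos (u - p)\<bar> + \<bar>sin (u / 2)\<bar> * \<bar>sin (u - p)\<bar> / 2"
      by (rule order_trans[OF abs_triangle_ineq4]) (simp add: abs_mult)
    also have "\<dots> \<le> 1 * 1 + 1 * 1 / 2" by (intro add_mono mult_mono divide_right_mono) auto
    finally show ?thesis by simp
  qed
  have y_hold: "sqrt_holder b y"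
  proof (rule sqrt_holder_lipschitz)
    fix u assume u: "u \<in> {0..b}"
    have "norm (m u - m 0) \<le> 2 * norm (u - 0)"
      by (rule field_differentiable_bound[of UNIV m m']) (use m_der m'_bd in auto)
    then have "\<bar>m u - m 0\<bar> \<le> 2 * u" using u by simp
    have "norm (y u - y 0) \<le> \<bar>m u - m 0\<bar> / sqrt \<bar>m 0\<bar>"
      unfolding y_def by (rule norm_ssq_diff_le) (use m0 sp \<epsilon> in auto)
    also have "\<dots> \<le> 2 * u / sqrt \<bar>m 0\<bar>" using \<open>\<bar>m u - m 0\<bar> \<le> 2 * u\<close> by (intro divide_right_mono) auto
    finally show "norm (y u - y 0) \<le> (2 / sqrt \<bar>m 0\<bar>) * u" by simp
  qed
  have X_hold: "sqrt_holder b X"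
    unfolding sqrt_holder_def
  proof (intro exI ballI)
    fix u assume u: "u \<in> {0..b}"
    have "2 * sin (u / 2) \<le> u" using sin_x_le_x[of "u / 2"] u by simp
    moreover have "sin (u / 2) \<ge> 0" using u b by (intro sin_ge_zero) auto
    ultimately show "norm (X u - X 0) \<le> 1 * sqrt u" by (simp add: X_def chord_root_def)
  qed
  have A_hold: "sqrt_holder b A" by (rule sqrt_holder_C1[OF A A'_cont])
  have B_hold: "sqrt_holder b B" by (rule sqrt_holder_C1[OF B B'_cont])
  have T_hold: "sqrt_holder b T" unfolding T_def by (intro sqrt_holder_mult X_hold y_hold)
  have "sqrt_holder b (\<lambda>u. V u * y u)"
    unfolding V_def by (intro sqrt_holder_mult sqrt_holder_add sqrt_holder_exp sqrt_holder_const T_hold A_hold B_hold y_hold)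
  then obtain Cw where Cw: "\<And>u. u \<in> {0..b} \<Longrightarrow> norm (V u * y u - V 0 * y 0) \<le> Cw * sqrt u"
    unfolding sqrt_holder_def by blast
  define c0 where "c0 = (\<beta> 0 + \<kappa> * \<alpha> 0) * ssq (- (\<epsilon> * sin p))"
  have Vy0: "V 0 * y 0 = c0" by (simp add: V_def T_def X_def chord_root_def A_def B_def sec_def y_def m0 c0_def)
  have "bounded ((\<lambda>u. (A' u + B' u * T u) * exp (\<kappa> * T u)) ` {0..b})"
    by (intro compact_imp_bounded compact_continuous_image continuous_intros A'_cont B'_cont T_cont) auto
  then obtain M1 where M1: "\<And>u. u \<in> {0..b} \<Longrightarrow> norm ((A' u + B' u * T u) * exp (\<kappa> * T u)) \<le> M1" unfolding bounded_iff by blast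
  have "bounded ((\<lambda>u. X u * V u) ` {0..b})"
    by (intro compact_imp_bounded compact_continuous_image continuous_intros X_cont V_cont) auto
  then obtain M2 where M2: "\<And>u. u \<in> {0..b} \<Longrightarrow> norm (X u * V u) \<le> M2" unfolding bounded_iff by blast
  define H where "H u = (A u + B u * T u) * exp (\<kappa> * T u)" for u
  define H' where "H' u = (A' u + B' u * T u) * exp (\<kappa> * T u) + T' u * V u" for u
  define C where "C = \<bar>M1\<bar> + \<bar>M2\<bar> / sqrt c1 + \<bar>Cw\<bar> * sqrt (pi / 2)"
  have "C \<ge> 0" using c1 by (simp add: C_def)
  have "saddle_expansion b (\<lambda>u. H u * of_real (cos (u / 2))) (H 0) c0"
  proof (rule stationary_phase_one_sided[OF b])
    show "continuous_on {0..b} H" unfolding H_def by (intro continuous_intros A_cont B_cont T_cont)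
    show "(\<lambda>u. C * (1 + 1 / sqrt \<bar>u - p\<bar>) * u powr (-3/4)) integrable_on {0..b}"
      using b p \<open>C \<ge> 0\<close> by (intro integrable_weighted_singularity) auto
    fix u assume u: "u \<in> {0<..<b} - {p}"
    then have u': "u \<in> {0..b}" by auto
    have mu: "m u \<noteq> 0" using m_ge[OF u'] mult_pos_pos[OF c1, of "\<bar>u - p\<bar>"] u by auto
    have s: "sin (u / 2) > 0" using u b by (intro sin_gt_zero) auto
    have "(chord_root has_real_derivative cos (u / 2) / (2 * chord_root u)) (at u)"
      unfolding chord_root_def using s by (auto intro!: derivative_eq_intros simp: field_simps)
    then have X_der: "(X has_vector_derivative X' u) (at u)"
      unfolding X_def X'_def by (intro has_vector_derivative_of_real) (simp add: has_real_derivative_iff_has_vector_derivative)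
    have "(m has_vector_derivative m' u) (at u)" using m_der by (simp add: has_real_derivative_iff_has_vector_derivative)
    from vector_diff_chain_at[OF this ssq_has_vector_derivative[OF mu]]
    have y_der: "(y has_vector_derivative y' u) (at u)" unfolding y_def[abs_def] y'_def by (simp add: comp_def)
    have T_der: "(T has_vector_derivative T' u) (at u)"
      unfolding T_def T'_def by (intro has_vector_derivative_mult X_der y_der)
    have "((\<lambda>u. \<kappa> * T u) has_vector_derivative \<kappa> * T' u) (at u)" by (intro derivative_intros T_der)
    then have E_der: "((\<lambda>u. exp (\<kappa> * T u)) has_vector_derivative \<kappa> * T' u * exp (\<kappa> * T u)) (at u)"
      using field_vector_diff_chain_at[of "\<lambda>u. \<kappa> * T u" _ u exp] DERIV_exp by (auto simp: comp_def)
    have "(H has_vector_derivative (A u + B u * T u) * (\<kappa> * T' u * exp (\<kappa> * T u)) + (A' u + (B u * T' u + B' u * T u)) * exp (\<kappa> * T u)) (at u)"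
      unfolding H_def by (intro has_vector_derivative_mult has_vector_derivative_add E_der T_der A B u')
    then show "(H has_vector_derivative H' u) (at u)" by (simp add: H'_def V_def algebra_simps)
    have eq: "H' u - c0 * of_real (cos (u / 2) / (2 * chord_root u)) =
        (A' u + B' u * T u) * exp (\<kappa> * T u) + (X u * V u) * y' u + X' u * (V u * y u - V 0 * y 0)"
      unfolding Vy0 H'_def T'_def X'_def[of u, symmetric] by (simp add: algebra_simps)
    have t1: "norm ((X u * V u) * y' u) \<le> \<bar>M2\<bar> / sqrt c1 * (1 / sqrt \<bar>u - p\<bar>)"
    proof -
      have up: "c1 * \<bar>u - p\<bar> > 0" using c1 u by auto
      have "norm (y' u) = \<bar>m' u\<bar> / (2 * sqrt \<bar>m u\<bar>)" by (simp add: y'_def norm_divide norm_mult norm_ssq)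
      also have "\<dots> \<le> 2 / (2 * sqrt (c1 * \<bar>u - p\<bar>))"
        using m'_bd[of u] m_ge[OF u'] up by (intro frac_le mult_left_mono real_sqrt_le_mono) auto
      finally have "norm (y' u) \<le> 1 / sqrt c1 * (1 / sqrt \<bar>u - p\<bar>)" by (simp add: real_sqrt_mult)
      then have "norm (X u * V u) * norm (y' u) \<le> \<bar>M2\<bar> * (1 / sqrt c1 * (1 / sqrt \<bar>u - p\<bar>))"
        using M2[OF u'] by (intro mult_mono) auto
      then show ?thesis by (simp add: norm_mult)
    qed
    have t2: "norm (X' u * (V u * y u - V 0 * y 0)) \<le> \<bar>Cw\<bar> * sqrt (pi / 2)"
    proof -
      have "2 * (u / pi) \<le> 2 * sin (u / 2)" using half_angle_bounds[of u b] u b by auto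
      then have X_ge: "sqrt (2 * (u / pi)) \<le> chord_root u" unfolding chord_root_def by (rule real_sqrt_le_mono)
      have up: "sqrt (2 * (u / pi)) > 0" using u by auto
      have "norm (X' u) = \<bar>cos (u / 2)\<bar> / (2 * chord_root u)" 
        using X_ge up unfolding X'_def norm_of_real by (simp add: abs_mult abs_of_nonneg[OF order_trans[OF less_imp_le[OF up] X_ge]])
      also have "\<dots> \<le> 1 / (1 * sqrt (2 * (u / pi)))"
        using X_ge up by (intro frac_le mult_mono) auto
      finally have "norm (X' u) * norm (V u * y u - V 0 * y 0) \<le> (1 / (1 * sqrt (2 * (u / pi)))) * (\<bar>Cw\<bar> * sqrt u)"
      proof (rule mult_mono)
        have "Cw * sqrt u \<le> \<bar>Cw\<bar> * sqrt u" using u' by (intro mult_right_mono) auto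
        then show "norm (V u * y u - V 0 * y 0) \<le> \<bar>Cw\<bar> * sqrt u" using Cw[OF u'] by linarith
      qed (use up in auto)
      also have "\<dots> = \<bar>Cw\<bar> * sqrt (pi / 2)" using u by (simp add: real_sqrt_mult real_sqrt_divide)
      finally show ?thesis by (simp add: norm_mult)
    qed
    have "norm (H' u - c0 * of_real (cos (u / 2) / (2 * chord_root u))) \<le> M1 + \<bar>M2\<bar> / sqrt c1 * (1 / sqrt \<bar>u - p\<bar>) + \<bar>Cw\<bar> * sqrt (pi / 2)"
      unfolding eq by (intro order_trans[OF norm_triangle_ineq] add_mono M1 t1 t2 u')
    also have "\<dots> \<le> C * (1 + 1 / sqrt \<bar>u - p\<bar>)"
    proof -
      have "0 \<le> (\<bar>M1\<bar> + \<bar>Cw\<bar> * sqrt (pi / 2)) * (1 / sqrt \<bar>u - p\<bar>)" "0 \<le> \<bar>M2\<bar> / sqrt c1" using c1 by auto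
      then show ?thesis unfolding C_def distrib_left distrib_right by linarith
    qed
    finally show "norm (H' u - c0 * of_real (cos (u / 2) / (2 * chord_root u))) \<le> C * (1 + 1 / sqrt \<bar>u - p\<bar>)" .
  qed (use \<open>C \<ge> 0\<close> in auto)
  then have "saddle_expansion b (\<lambda>u. (\<alpha> u + \<beta> u * S u) * exp (\<kappa> * S u)) (H 0) c0"
  proof (rule saddle_expansion_cong[rotated])
    fix u assume u: "u \<in> {0..b}"
    have 1: "complex_of_real (sec u) * of_real (cos (u / 2)) = 1" using cospos[OF u] by (simp add: sec_def flip: of_real_mult)
    have "H u * of_real (cos (u / 2)) = (of_real (sec u) * of_real (cos (u / 2))) * (\<alpha> u + \<beta> u * T u) * exp (\<kappa> * T u)"
      unfolding H_def A_def B_def by (simp add: algebra_simps)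
    then show "H u * of_real (cos (u / 2)) = (\<alpha> u + \<beta> u * S u) * exp (\<kappa> * S u)"
      unfolding 1 ST[OF u] by simp
  qed
  moreover have "H 0 = \<alpha> 0" by (simp add: H_def A_def T_def X_def chord_root_def sec_def)
  ultimately show ?thesis by (simp add: c0_def)
qed

lemma integral_split_at:
  fixes f :: "real \<Rightarrow> complex"
  assumes f: "continuous_on {0..b} f" and t: "0 \<le> t" "t \<le> b"
  shows "integral {0..b} f = integral {0..t} (\<lambda>u. f (t - u)) + integral {0..b - t} (\<lambda>u. f (t + u))"
proof -
  have "(f has_integral integral {0..t} f) (cbox 0 t)"
    by (simp, intro integrable_integral integrable_continuous_real continuous_on_subset[OF f]) (use t in auto)
  from has_integral_affinity[OF this, of "-1" t]
  have 1: "((\<lambda>u. f (t - u)) has_integral integral {0..t} f) {0..t}"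
    using t by simp
  have "(f has_integral integral {t..b} f) (cbox t b)"
    by (simp, intro integrable_integral integrable_continuous_real continuous_on_subset[OF f]) (use t in auto)
  from has_integral_affinity[OF this, of "1" t]
  have 2: "((\<lambda>u. f (t + u)) has_integral integral {t..b} f) {0..b - t}"
    using t by (simp add: add.commute)
  have "integral {0..t} f + integral {t..b} f = integral {0..b} f"
    using t by (intro Henstock_Kurzweil_Integration.integral_combine integrable_continuous_real f) auto
  then show ?thesis using 1 2 by (simp add: integral_unique)
qed

lemma integral_reflect_interval:
  fixes f :: "real \<Rightarrow> complex"
  assumes f: "continuous_on {0..b} f" and "0 \<le> b"
  shows "integral {0..b} (\<lambda>u. f (b - u)) = integral {0..b} f"
  using integral_split_at[OF f, of b] assms by simp

text \<open>
  Both halves become one-sided integrals with the same phase \<open>1 - cos u\<close> after factoring out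
  \<open>exp(i l)\<close>.
\<close>

lemma integral_phase_split:
  fixes f :: "real \<Rightarrow> complex"
  assumes f: "continuous_on {0..pi} f" and \<theta>: "0 \<le> \<theta>" "\<theta> \<le> pi"
  shows "integral {0..pi} (\<lambda>\<phi>. f \<phi> * cis (l * cos (\<phi> - \<theta>))) =
    cis l * (integral {0..\<theta>} (\<lambda>u. f (\<theta> - u) * cis (- (l * (1 - cos u))))
      + integral {0..pi - \<theta>} (\<lambda>u. f (\<theta> + u) * cis (- (l * (1 - cos u)))))"
proof -
  have e: "cis (l * cos u) = cis l * cis (- (l * (1 - cos u)))" for u
    by (simp add: cis_mult algebra_simps)
  have "continuous_on {0..pi} (\<lambda>\<phi>. f \<phi> * cis (l * cos (\<phi> - \<theta>)))"
    by (intro continuous_intros f)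
  from integral_split_at[OF this \<theta>]
  have "integral {0..pi} (\<lambda>\<phi>. f \<phi> * cis (l * cos (\<phi> - \<theta>))) = 
     integral {0..\<theta>} (\<lambda>u. cis l * (f (\<theta> - u) * cis (- (l * (1 - cos u))))) + integral {0..pi - \<theta>} (\<lambda>u. cis l * (f (\<theta> + u) * cis (- (l * (1 - cos u)))))"
    by (simp add: e mult_ac)
  then show ?thesis by (simp add: distrib_left)
qed

lemma two_sided_expansion:
  fixes f :: "real \<Rightarrow> complex"
  assumes f: "continuous_on {0..pi} f" and \<theta>: "0 \<le> \<theta>" "\<theta> \<le> pi"
    and left: "saddle_expansion \<theta> (\<lambda>u. f (\<theta> - u)) a c" and right: "saddle_expansion (pi - \<theta>) (\<lambda>u. f (\<theta> + u)) a' c'"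
  obtains C where "\<And>l. l \<ge> 1 \<Longrightarrow>
    norm (integral {0..pi} (\<lambda>\<phi>. f \<phi> * cis (l * cos (\<phi> - \<theta>))) - cis l * saddle_terms (a + a') (c + c') l) \<le> C * l powr (-7/8)"
proof -
  let ?I1 = "\<lambda>l. integral {0..\<theta>} (\<lambda>u. f (\<theta> - u) * cis (- (l * (1 - cos u))))"
  let ?I2 = "\<lambda>l. integral {0..pi - \<theta>} (\<lambda>u. f (\<theta> + u) * cis (- (l * (1 - cos u))))"
  obtain C1 where C1: "\<And>l. l \<ge> 1 \<Longrightarrow> norm (?I1 l - saddle_terms a c l) \<le> C1 * l powr (-7/8)"
    using left unfolding saddle_expansion_def by blast
  obtain C2 where C2: "\<And>l. l \<ge> 1 \<Longrightarrow> norm (?I2 l - saddle_terms a' c' l) \<le> C2 * l powr (-7/8)"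
    using right unfolding saddle_expansion_def by blast
  show thesis
  proof (rule that[of "C1 + C2"])
    fix l :: real assume l: "l \<ge> 1"
    have "integral {0..pi} (\<lambda>\<phi>. f \<phi> * cis (l * cos (\<phi> - \<theta>))) - cis l * saddle_terms (a + a') (c + c') l
      = cis l * ((?I1 l - saddle_terms a c l) + (?I2 l - saddle_terms a' c' l))"
      unfolding integral_phase_split[OF f \<theta>] saddle_terms_add[symmetric] by (simp add: algebra_simps)
    then show "norm (integral {0..pi} (\<lambda>\<phi>. f \<phi> * cis (l * cos (\<phi> - \<theta>))) - cis l * saddle_terms (a + a') (c + c') l) \<le> (C1 + C2) * l powr (-7/8)"
      by (simp only: norm_mult norm_cis mult_1 distrib_right) (intro order_trans[OF norm_triangle_ineq] add_mono C1 C2 l)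
  qed
qed

lemma cos_square_diff: "(cos x)\<^sup>2 - (cos y)\<^sup>2 = sin (y - x) * sin (y + x)" for x y :: real
proof -
  have "sin (y - x) * sin (y + x) = (sin y * cos x)\<^sup>2 - (cos y * sin x)\<^sup>2"
    by (simp add: sin_add sin_diff power2_eq_square algebra_simps)
  also have "\<dots> = (1 - (cos y)\<^sup>2) * (cos x)\<^sup>2 - (cos y)\<^sup>2 * (1 - (cos x)\<^sup>2)"
    by (simp add: power_mult_distrib sin_squared_eq)
  finally show ?thesis by (simp add: algebra_simps)
qed

text \<open>
  By \<open>cos\<^sup>2 \<phi> - cos\<^sup>2 \<theta> = sin (\<theta> - \<phi>) sin (\<theta> + \<phi>)\<close> the argument of the square root is \<open>sin u sin (2\<theta> - u)\<close> to
  the left of \<open>\<theta>\<close>, at \<open>\<phi> = \<theta> - u\<close>, and \<open>- sin u sin (2\<theta> + u)\<close> to the right. It is positive near \<open>\<theta>\<close> on the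
  left and negative on the right, so the square-root coefficients of the two sides are \<open>sqrt (sin 2\<theta>)\<close> and
  \<open>- i sqrt (sin 2\<theta>)\<close>; they do not cancel.
\<close>

lemma stationary_phase_critical:
  fixes A B A' B' :: "real \<Rightarrow> complex" and \<kappa> :: complex
  assumes \<theta>: "0 < \<theta>" "\<theta> < pi / 2"
    and A: "\<And>\<phi>. (A has_vector_derivative A' \<phi>) (at \<phi>)" "continuous_on UNIV A'"
    and B: "\<And>\<phi>. (B has_vector_derivative B' \<phi>) (at \<phi>)" "continuous_on UNIV B'"
  defines "g \<equiv> \<lambda>\<phi>. (A \<phi> + B \<phi> * ssq ((cos \<phi>)\<^sup>2 - (cos \<theta>)\<^sup>2)) * exp (\<kappa> * ssq ((cos \<phi>)\<^sup>2 - (cos \<theta>)\<^sup>2))"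
  obtains C where "\<And>l. l \<ge> 1 \<Longrightarrow> norm (integral {0..pi} (\<lambda>\<phi>. g \<phi> * cis (l * cos (\<phi> - \<theta>)))
     - cis l * saddle_terms (2 * A \<theta>) ((B \<theta> + \<kappa> * A \<theta>) * (of_real (sqrt (sin (2 * \<theta>))) * (1 - \<i>))) l) \<le> C * l powr (-7/8)"
proof -
  define d where "d = B \<theta> + \<kappa> * A \<theta>"
  let ?S = "\<lambda>\<phi>. ssq ((cos \<phi>)\<^sup>2 - (cos \<theta>)\<^sup>2)"
  have cont: "continuous_on UNIV A" "continuous_on UNIV B"
    using A(1) B(1) by (auto intro!: continuous_at_imp_continuous_on has_vector_derivative_continuous)
  have g_cont: "continuous_on {0..pi} g"
    unfolding g_def by (intro continuous_intros continuous_on_subset[OF cont(1)] continuous_on_subset[OF cont(2)]) auto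
  have dplus: "((\<lambda>u. f (\<theta> + u)) has_vector_derivative f' (\<theta> + u)) (at u)"
    if "\<And>\<phi>. (f has_vector_derivative f' \<phi>) (at \<phi>)" for f f' :: "real \<Rightarrow> complex" and u
  proof -
    have "((\<lambda>u. \<theta> + u) has_vector_derivative 1) (at u)" by (auto intro!: derivative_eq_intros)
    from vector_diff_chain_at[OF this that] show ?thesis by (simp add: comp_def)
  qed
  have dminus: "((\<lambda>u. f (\<theta> - u)) has_vector_derivative - f' (\<theta> - u)) (at u)"
    if "\<And>\<phi>. (f has_vector_derivative f' \<phi>) (at \<phi>)" for f f' :: "real \<Rightarrow> complex" and u
  proof -
    have "((\<lambda>u. \<theta> - u) has_vector_derivative -1) (at u)" by (auto intro!: derivative_eq_intros)
    from vector_diff_chain_at[OF this that] show ?thesis by (simp add: comp_def)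
  qed
  have s2: "sin (2 * \<theta>) > 0" using \<theta> by (intro sin_gt_zero) auto
  have "saddle_expansion (pi - \<theta>) (\<lambda>u. (A (\<theta> + u) + B (\<theta> + u) * ?S (\<theta> + u)) * exp (\<kappa> * ?S (\<theta> + u)))
      (A (\<theta> + 0)) ((B (\<theta> + 0) + \<kappa> * A (\<theta> + 0)) * ssq (- (1 * sin (pi - 2 * \<theta>))))"
  proof (rule stationary_phase_square_root[where \<alpha>' = "\<lambda>u. A' (\<theta> + u)" and \<beta>' = "\<lambda>u. B' (\<theta> + u)"])
    show "ssq ((cos (\<theta> + u))\<^sup>2 - (cos \<theta>)\<^sup>2) = ssq (1 * (sin u * sin (u - (pi - 2 * \<theta>))))" for u
    proof -
      have "sin (u - (pi - 2 * \<theta>)) = - sin (u + 2 * \<theta>)" by (simp add: sin_diff sin_add cos_diff algebra_simps)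
      moreover have "\<theta> + (\<theta> + u) = u + 2 * \<theta>" by simp
      ultimately show ?thesis unfolding cos_square_diff by (simp add: add.commute)
    qed
  qed (use \<theta> A B in \<open>auto intro!: dplus continuous_on_compose2[OF A(2)] continuous_on_compose2[OF B(2)] continuous_intros\<close>)
  moreover have "ssq (- (1 * sin (pi - 2 * \<theta>))) = - \<i> * of_real (sqrt (sin (2 * \<theta>)))"
    using s2 by (simp add: ssq_neg)
  ultimately have right: "saddle_expansion (pi - \<theta>) (\<lambda>u. g (\<theta> + u)) (A \<theta>) (d * (- \<i> * of_real (sqrt (sin (2 * \<theta>)))))"
    unfolding g_def d_def by simp
  have "saddle_expansion \<theta> (\<lambda>u. (A (\<theta> - u) + B (\<theta> - u) * ?S (\<theta> - u)) * exp (\<kappa> * ?S (\<theta> - u)))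
      (A (\<theta> - 0)) ((B (\<theta> - 0) + \<kappa> * A (\<theta> - 0)) * ssq (- (- 1 * sin (2 * \<theta>))))"
  proof (rule stationary_phase_square_root[where \<alpha>' = "\<lambda>u. - A' (\<theta> - u)" and \<beta>' = "\<lambda>u. - B' (\<theta> - u)"])
    show "ssq ((cos (\<theta> - u))\<^sup>2 - (cos \<theta>)\<^sup>2) = ssq (- 1 * (sin u * sin (u - 2 * \<theta>)))" for u
    proof -
      have "sin (u - 2 * \<theta>) = - sin (2 * \<theta> - u)" using sin_minus[of "2 * \<theta> - u"] by simp
      moreover have "\<theta> + (\<theta> - u) = 2 * \<theta> - u" by simp
      ultimately show ?thesis unfolding cos_square_diff by simp
    qed
  qed (use \<theta> A B in \<open>auto intro!: dminus continuous_on_compose2[OF A(2)] continuous_on_compose2[OF B(2)] continuous_intros\<close>)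
  moreover have "ssq (- (- 1 * sin (2 * \<theta>))) = of_real (sqrt (sin (2 * \<theta>)))"
    using s2 by (simp add: ssq_pos)
  ultimately have left: "saddle_expansion \<theta> (\<lambda>u. g (\<theta> - u)) (A \<theta>) (d * of_real (sqrt (sin (2 * \<theta>))))"
    unfolding g_def d_def by simp
  have e: "d * of_real (sqrt (sin (2 * \<theta>))) + d * (- \<i> * of_real (sqrt (sin (2 * \<theta>)))) = d * (of_real (sqrt (sin (2 * \<theta>))) * (1 - \<i>))"
    by (simp add: algebra_simps)
  have "0 \<le> \<theta>" "\<theta> \<le> pi" using \<theta> by auto
  from two_sided_expansion[OF g_cont this left right] obtain C where C: "\<And>l. l \<ge> 1 \<Longrightarrow>
      norm (integral {0..pi} (\<lambda>\<phi>. g \<phi> * cis (l * cos (\<phi> - \<theta>)))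
        - cis l * saddle_terms (A \<theta> + A \<theta>) (d * of_real (sqrt (sin (2 * \<theta>))) + d * (- \<i> * of_real (sqrt (sin (2 * \<theta>))))) l) \<le> C * l powr (-7/8)"
    by blast
  show thesis by (rule that[OF C[unfolded e, unfolded d_def mult_2[symmetric]]])
qed

text \<open>
  Directions beyond \<open>\<pi>/2\<close> are obtained by the reflection \<open>\<phi> \<mapsto> \<pi> - \<phi>\<close>.
\<close>

lemma stationary_phase_at_direction:
  fixes A B A' B' :: "real \<Rightarrow> complex" and \<kappa> :: complex
  assumes t: "0 < t" "t < pi" "t \<noteq> pi / 2"
    and A: "\<And>\<phi>. (A has_vector_derivative A' \<phi>) (at \<phi>)" "continuous_on UNIV A'"
    and B: "\<And>\<phi>. (B has_vector_derivative B' \<phi>) (at \<phi>)" "continuous_on UNIV B'"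
  defines "g \<equiv> \<lambda>\<phi>. (A \<phi> + B \<phi> * ssq ((cos \<phi>)\<^sup>2 - (cos t)\<^sup>2)) * exp (\<kappa> * ssq ((cos \<phi>)\<^sup>2 - (cos t)\<^sup>2))"
  obtains C where "\<And>l. l \<ge> 1 \<Longrightarrow> norm (integral {0..pi} (\<lambda>\<phi>. g \<phi> * cis (l * cos (\<phi> - t)))
     - cis l * saddle_terms (2 * A t) ((B t + \<kappa> * A t) * (of_real (sqrt \<bar>sin (2 * t)\<bar>) * (1 - \<i>))) l) \<le> C * l powr (-7/8)"
proof (cases "t < pi / 2")
  case True
  then have "sin (2 * t) \<ge> 0" using t by (intro sin_ge_zero) auto
  then have st: "\<bar>sin (2 * t)\<bar> = sin (2 * t)" by simp
  obtain C where "\<And>l. l \<ge> 1 \<Longrightarrow> norm (integral {0..pi} (\<lambda>\<phi>. g \<phi> * cis (l * cos (\<phi> - t)))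
     - cis l * saddle_terms (2 * A t) ((B t + \<kappa> * A t) * (of_real (sqrt (sin (2 * t))) * (1 - \<i>))) l) \<le> C * l powr (-7/8)"
    using stationary_phase_critical[OF t(1) True A B, of \<kappa>] unfolding g_def by blast
  then show thesis by (rule that[unfolded st])
next
  case False
  define \<theta> where "\<theta> = pi - t"
  have \<theta>: "0 < \<theta>" "\<theta> < pi / 2" using False t by (auto simp: \<theta>_def)
  have dminus: "((\<lambda>u. f (pi - u)) has_vector_derivative - f' (pi - u)) (at u)"
    if "\<And>\<phi>. (f has_vector_derivative f' \<phi>) (at \<phi>)" for f f' :: "real \<Rightarrow> complex" and u
  proof -
    have "((\<lambda>u. pi - u) has_vector_derivative -1) (at u)" by (auto intro!: derivative_eq_intros)
    from vector_diff_chain_at[OF this that] show ?thesis by (simp add: comp_def)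
  qed
  have c: "continuous_on UNIV (\<lambda>u. - A' (pi - u))" "continuous_on UNIV (\<lambda>u. - B' (pi - u))"
    by (intro continuous_intros continuous_on_compose2[OF A(2)] continuous_on_compose2[OF B(2)]; simp)+
  have sc: "sin (2 * \<theta>) = \<bar>sin (2 * t)\<bar>" "(cos \<theta>)\<^sup>2 = (cos t)\<^sup>2"
  proof -
    have "sin (2 * \<theta>) = - sin (2 * t)" by (simp add: \<theta>_def right_diff_distrib sin_diff)
    moreover have "sin (2 * \<theta>) \<ge> 0" using \<theta> by (intro sin_ge_zero) auto
    ultimately show "sin (2 * \<theta>) = \<bar>sin (2 * t)\<bar>" by simp
    show "(cos \<theta>)\<^sup>2 = (cos t)\<^sup>2" by (simp add: \<theta>_def)
  qed
  have Acont: "continuous_on UNIV A" "continuous_on UNIV B"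
    by (intro continuous_at_imp_continuous_on ballI has_vector_derivative_continuous[OF A(1)] has_vector_derivative_continuous[OF B(1)])+
  have g_cont: "continuous_on {0..pi} g"
    unfolding g_def by (intro continuous_intros continuous_on_subset[OF Acont(1)] continuous_on_subset[OF Acont(2)]) auto
  have flip: "integral {0..pi} (\<lambda>\<phi>. g (pi - \<phi>) * cis (l * cos (\<phi> - \<theta>))) = integral {0..pi} (\<lambda>\<phi>. g \<phi> * cis (l * cos (\<phi> - t)))" for l
  proof -
    have "continuous_on {0..pi} (\<lambda>\<phi>. g \<phi> * cis (l * cos (\<phi> - t)))" by (intro continuous_intros g_cont)
    from integral_reflect_interval[OF this]
    have "integral {0..pi} (\<lambda>u. g (pi - u) * cis (l * cos (pi - u - t))) = integral {0..pi} (\<lambda>\<phi>. g \<phi> * cis (l * cos (\<phi> - t)))" by simp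
    moreover have "cos (pi - u - t) = cos (u - \<theta>)" for u
      using cos_minus[of "u - \<theta>"] by (simp add: \<theta>_def algebra_simps)
    ultimately show ?thesis by simp
  qed
  have gf: "g (pi - \<phi>) = (A (pi - \<phi>) + B (pi - \<phi>) * ssq ((cos \<phi>)\<^sup>2 - (cos \<theta>)\<^sup>2)) * exp (\<kappa> * ssq ((cos \<phi>)\<^sup>2 - (cos \<theta>)\<^sup>2))" for \<phi>
    by (simp add: g_def sc(2))
  have "pi - \<theta> = t" by (simp add: \<theta>_def)
  obtain C where C: "\<And>l. l \<ge> 1 \<Longrightarrow> norm (integral {0..pi} (\<lambda>\<phi>. g (pi - \<phi>) * cis (l * cos (\<phi> - \<theta>)))
     - cis l * saddle_terms (2 * A (pi - \<theta>)) ((B (pi - \<theta>) + \<kappa> * A (pi - \<theta>)) * (of_real (sqrt (sin (2 * \<theta>))) * (1 - \<i>))) l) \<le> C * l powr (-7/8)"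
    using stationary_phase_critical[OF \<theta> dminus[OF A(1)] c(1) dminus[OF B(1)] c(2), of \<kappa>] unfolding gf by blast
  show thesis by (rule that[OF C[unfolded flip sc(1) \<open>pi - \<theta> = t\<close>]])
qed

section \<open>Bessel's equation and power series\<close>

text \<open>
  An energy argument: as \<open>f\<close> is bounded near \<open>0\<close>, \<open>(t f')' = - t f\<close> forces \<open>\<bar>f' t\<bar> \<le> t\<close>, so \<open>f\<^sup>2 + f'\<^sup>2\<close> tends to \<open>0\<close> at \<open>0\<close>. Its derivative
  \<open>- 2 f'\<^sup>2 / t\<close> is nonpositive.
\<close>

lemma bessel_ode_unique:
  fixes f f' f'' :: "real \<Rightarrow> real"
  assumes f: "\<And>t. t > 0 \<Longrightarrow> (f has_real_derivative f' t) (at t)"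
    and f': "\<And>t. t > 0 \<Longrightarrow> (f' has_real_derivative f'' t) (at t)"
    and ode: "\<And>t. t > 0 \<Longrightarrow> t * f'' t + f' t + t * f t = 0"
    and lim: "(f \<longlongrightarrow> 0) (at_right 0)" "((\<lambda>t. t * f' t) \<longlongrightarrow> 0) (at_right 0)"
    and t: "t > 0"
  shows "f t = 0"
proof -
  have "\<forall>\<^sub>F t in at_right 0. \<bar>f t\<bar> < 1" using tendstoD[OF lim(1), of 1] by (simp add: dist_real_def)
  then obtain \<delta> where \<delta>: "\<delta> > 0" "\<And>t. 0 < t \<Longrightarrow> t < \<delta> \<Longrightarrow> \<bar>f t\<bar> < 1"
    by (auto simp: eventually_at_right_field)
  have bd: "\<bar>f' t\<bar> \<le> t" if t: "0 < t" "t < \<delta>" for t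
  proof -
    have "\<bar>t * f' t - s * f' s\<bar> \<le> t * t" if s: "0 < s" "s < t" for s
    proof -
      have "\<exists>z. s < z \<and> z < t \<and> t * f' t - s * f' s = (t - s) * (1 * f' z + f'' z * z)"
        using s t f' by (intro MVT2) (auto intro!: derivative_eq_intros)
      then obtain z where z: "s < z" "z < t" "t * f' t - s * f' s = (t - s) * (f' z + z * f'' z)" by (auto simp: mult_ac)
      have "f' z + z * f'' z = - (z * f z)" using ode[of z] s z by simp
      then have "\<bar>t * f' t - s * f' s\<bar> = (t - s) * (z * \<bar>f z\<bar>)" using z s by (simp add: abs_mult)
      also have "\<dots> \<le> t * (t * 1)" using z s \<delta>(2)[of z] t by (intro mult_mono) auto
      finally show ?thesis by simp
    qed
    then have "\<forall>\<^sub>F s in at_right 0. \<bar>t * f' t - s * f' s\<bar> \<le> t * t"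
      using t by (auto simp: eventually_at_right_field)
    moreover have "((\<lambda>s. \<bar>t * f' t - s * f' s\<bar>) \<longlongrightarrow> \<bar>t * f' t - 0\<bar>) (at_right 0)"
      by (intro tendsto_intros lim)
    ultimately have "\<bar>t * f' t - 0\<bar> \<le> t * t"
      by (intro tendsto_upperbound[where F = "at_right 0"]) auto
    then show ?thesis using t by (simp add: abs_mult)
  qed
  have lim': "(f' \<longlongrightarrow> 0) (at_right 0)"
  proof (rule Lim_null_comparison)
    show "\<forall>\<^sub>F t in at_right 0. norm (f' t) \<le> t"
      using bd \<delta>(1) by (auto simp: eventually_at_right_field)
    show "((\<lambda>t. t) \<longlongrightarrow> 0) (at_right (0::real))" by (rule tendsto_ident_at)
  qed
  define e where "e t = (f t)\<^sup>2 + (f' t)\<^sup>2" for t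
  have dec: "e t \<le> e s" if s: "0 < s" "s < t" for s
  proof (rule DERIV_nonpos_imp_nonincreasing[of s t e])
    fix x assume x: "s \<le> x" "x \<le> t"
    then have x0: "x > 0" using s by simp
    have "(e has_real_derivative 2 * f' x * (f x + f'' x)) (at x)"
      unfolding e_def using f[OF x0] f'[OF x0] by (auto intro!: derivative_eq_intros simp: algebra_simps)
    moreover have "x * (f x + f'' x) = - f' x" using ode[OF x0] by (simp add: algebra_simps)
    then have "f x + f'' x = - f' x / x" using x0 by (simp add: field_simps)
    then have "2 * f' x * (f x + f'' x) \<le> 0" using x0 by (simp add: divide_nonneg_pos)
    ultimately show "\<exists>y. (e has_real_derivative y) (at x) \<and> y \<le> 0" by blast
  qed (use s in auto)
  have "(e \<longlongrightarrow> 0\<^sup>2 + 0\<^sup>2) (at_right 0)" unfolding e_def by (intro tendsto_intros lim lim')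
  moreover have "\<forall>\<^sub>F s in at_right 0. e t \<le> e s" using dec t by (auto simp: eventually_at_right_field)
  ultimately have "e t \<le> 0\<^sup>2 + 0\<^sup>2" by (intro tendsto_lowerbound[where F = "at_right 0"]) auto
  then show "f t = 0" by (simp add: e_def sum_power2_le_zero_iff)
qed

text \<open>
  In the variable \<open>z = t\<^sup>2 / 4\<close> Bessel's equation of order \<open>0\<close> reads \<open>z F'' + F' + F = 0\<close>.
\<close>

lemma power_series_bessel_operator:
  fixes c :: "nat \<Rightarrow> real"
  assumes c: "\<And>z. summable (\<lambda>n. c n * z ^ n)"
  defines "F \<equiv> \<lambda>c z. \<Sum>n. c n * z ^ n"
  shows "(F c has_real_derivative F (diffs c) z) (at z)"
    and "(F (diffs c) has_real_derivative F (diffs (diffs c)) z) (at z)"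
    and "z * F (diffs (diffs c)) z + F (diffs c) z + F c z = (\<Sum>n. ((real n + 1)\<^sup>2 * c (Suc n) + c n) * z ^ n)"
proof -
  have c1: "summable (\<lambda>n. diffs c n * z ^ n)" for z by (rule termdiff_converges_all[OF c])
  have c2: "summable (\<lambda>n. diffs (diffs c) n * z ^ n)" for z by (rule termdiff_converges_all[OF c1])
  show "(F c has_real_derivative F (diffs c) z) (at z)" unfolding F_def by (rule termdiffs_strong_converges_everywhere[OF c])
  show "(F (diffs c) has_real_derivative F (diffs (diffs c)) z) (at z)" unfolding F_def by (rule termdiffs_strong_converges_everywhere[OF c1])
  have "(\<lambda>n. z * (diffs (diffs c) n * z ^ n)) sums (z * F (diffs (diffs c)) z)"
    unfolding F_def by (intro sums_mult summable_sums c2)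
  then have "(\<lambda>n. real (Suc n) * diffs c (Suc n) * z ^ Suc n) sums (z * F (diffs (diffs c)) z)"
    by (simp add: diffs_def algebra_simps)
  then have s2: "(\<lambda>n. real n * diffs c n * z ^ n) sums (z * F (diffs (diffs c)) z)"
    by (subst (asm) sums_Suc_iff) simp
  have "(\<lambda>n. real n * diffs c n * z ^ n + diffs c n * z ^ n + c n * z ^ n) sums (z * F (diffs (diffs c)) z + F (diffs c) z + F c z)"
    using s2 summable_sums[OF c1[of z]] summable_sums[OF c[of z]] unfolding F_def by (intro sums_add)
  also have "(\<lambda>n. real n * diffs c n * z ^ n + diffs c n * z ^ n + c n * z ^ n) = (\<lambda>n. ((real n + 1)\<^sup>2 * c (Suc n) + c n) * z ^ n)"
    by (simp add: fun_eq_iff diffs_def power2_eq_square algebra_simps)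
  finally show "z * F (diffs (diffs c)) z + F (diffs c) z + F c z = (\<Sum>n. ((real n + 1)\<^sup>2 * c (Suc n) + c n) * z ^ n)"
    by (rule sums_unique)
qed

definition jcoeff :: "nat \<Rightarrow> real" where "jcoeff n = (- 1) ^ n / (fact n)\<^sup>2"
definition ycoeff :: "nat \<Rightarrow> real" where "ycoeff n = (- 1) ^ (n + 1) * harm n / (fact n)\<^sup>2"
definition powser :: "(nat \<Rightarrow> real) \<Rightarrow> real \<Rightarrow> real" where "powser c z = (\<Sum>n. c n * z ^ n)"

lemma summable_exp_dominated:
  fixes c :: "nat \<Rightarrow> real"
  assumes "\<And>n. \<bar>c n\<bar> \<le> 1 / fact n"
  shows "summable (\<lambda>n. c n * z ^ n)"
proof (rule summable_comparison_test')
  show "summable (\<lambda>n. inverse (fact n) * \<bar>z\<bar> ^ n)" by (rule summable_exp)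
  show "norm (c n * z ^ n) \<le> inverse (fact n) * \<bar>z\<bar> ^ n" for n
    using mult_right_mono[OF assms[of n], of "\<bar>z\<bar> ^ n"] by (simp add: abs_mult power_abs divide_inverse)
qed

lemma summable_jcoeff: "summable (\<lambda>n. jcoeff n * z ^ n)"
proof (rule summable_exp_dominated)
  show "\<bar>jcoeff n\<bar> \<le> 1 / fact n" for n
    using fact_ge_1[of n, where 'a = real]
    by (auto simp: jcoeff_def power_abs power2_eq_square intro!: divide_left_mono)
qed

lemma summable_ycoeff: "summable (\<lambda>n. ycoeff n * z ^ n)"
proof (rule summable_exp_dominated)
  fix n
  have "harm n \<le> (fact n :: real)"
  proof (induction n)
    case (Suc n)
    show ?case
    proof (cases "n = 0")
      case False
      have "harm (Suc n) \<le> (fact n :: real) + 1"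
      proof -
        have "inverse (real (Suc n)) \<le> 1" by (simp add: inverse_le_1_iff)
        then show ?thesis using Suc unfolding harm_Suc by linarith
      qed
      also have "\<dots> \<le> fact n + fact n" using fact_ge_1[of n, where 'a = real] by simp
      also have "\<dots> \<le> fact (Suc n)"
        using False mult_right_mono[of 2 "1 + real n" "fact n"] by simp
      finally show ?thesis .
    qed (simp add: harm_expand)
  qed (simp add: harm_expand)
  moreover have "harm n \<ge> (0::real)" by (rule harm_nonneg)
  ultimately have "\<bar>ycoeff n\<bar> \<le> fact n / (fact n)\<^sup>2"
    by (simp add: ycoeff_def abs_mult power_abs divide_right_mono)
  then show "\<bar>ycoeff n\<bar> \<le> 1 / fact n" by (simp add: power2_eq_square)
qed

lemma jcoeff_recurrence: "(real n + 1)\<^sup>2 * jcoeff (Suc n) + jcoeff n = 0"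
  by (simp add: jcoeff_def power_mult_distrib divide_simps)

text \<open>
  The logarithm in the second solution, \<open>ln t * J\<^sub>0\<close>, leaves \<open>2 J\<^sub>0'\<close> in Bessel's equation; the harmonic
  numbers are the coefficients that compensate it.
\<close>

lemma ycoeff_recurrence: "(real n + 1)\<^sup>2 * ycoeff (Suc n) + ycoeff n = - diffs jcoeff n"
proof -
  have "(real n + 1)\<^sup>2 * ycoeff (Suc n) = (- 1) ^ n * harm (Suc n) / (fact n)\<^sup>2"
    by (simp add: ycoeff_def power_mult_distrib divide_simps)
  moreover have "ycoeff n = - ((- 1) ^ n * harm n / (fact n)\<^sup>2)" by (simp add: ycoeff_def)
  moreover have "diffs jcoeff n = - ((- 1) ^ n * inverse (real (Suc n)) / (fact n)\<^sup>2)"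
    by (simp add: diffs_def jcoeff_def power_mult_distrib power2_eq_square divide_simps)
  ultimately show ?thesis by (simp add: harm_Suc diff_divide_distrib[symmetric] right_diff_distrib[symmetric])
qed

lemma powser_j_ode: "z * powser (diffs (diffs jcoeff)) z + powser (diffs jcoeff) z + powser jcoeff z = 0"
  using power_series_bessel_operator(3)[OF summable_jcoeff, of z] by (simp add: powser_def jcoeff_recurrence)

lemma powser_y_ode: "z * powser (diffs (diffs ycoeff)) z + powser (diffs ycoeff) z + powser ycoeff z = - powser (diffs jcoeff) z"
  using power_series_bessel_operator(3)[OF summable_ycoeff, of z] termdiff_converges_all[OF summable_jcoeff]
  by (simp add: powser_def ycoeff_recurrence suminf_minus)

lemma powser_derivs:
  "(powser jcoeff has_real_derivative powser (diffs jcoeff) z) (at z)"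
  "(powser (diffs jcoeff) has_real_derivative powser (diffs (diffs jcoeff)) z) (at z)"
  "(powser ycoeff has_real_derivative powser (diffs ycoeff) z) (at z)"
  "(powser (diffs ycoeff) has_real_derivative powser (diffs (diffs ycoeff)) z) (at z)"
  using power_series_bessel_operator(1,2)[OF summable_jcoeff, of z] power_series_bessel_operator(1,2)[OF summable_ycoeff, of z]
  by (simp_all add: powser_def[abs_def])

lemma powser_0: "powser jcoeff 0 = 1" "powser ycoeff 0 = 0"
  using powser_zero[of jcoeff] powser_zero[of ycoeff] by (simp_all add: powser_def jcoeff_def ycoeff_def harm_expand)

lemma bessel_J0_powser: "bessel_J0 t = powser jcoeff (t\<^sup>2 / 4)"
  by (simp add: bessel_J0_def powser_def jcoeff_def)

lemma bessel_Y0_powser: "bessel_Y0 t = 2 / pi * ((ln (t / 2) + euler_mascheroni) * powser jcoeff (t\<^sup>2 / 4) + powser ycoeff (t\<^sup>2 / 4))"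
  unfolding bessel_Y0_def bessel_J0_powser by (simp add: powser_def ycoeff_def algebra_simps)

lemma powser_lift_deriv:
  assumes "\<And>z. (F has_real_derivative F1 z) (at z)" "\<And>z. (F1 has_real_derivative F2 z) (at z)"
  shows "((\<lambda>t. F (t\<^sup>2 / 4)) has_real_derivative t / 2 * F1 (t\<^sup>2 / 4)) (at t)"
    and "((\<lambda>t. t / 2 * F1 (t\<^sup>2 / 4)) has_real_derivative F1 (t\<^sup>2 / 4) / 2 + t\<^sup>2 / 4 * F2 (t\<^sup>2 / 4)) (at t)"
proof -
  have z: "((\<lambda>t. t\<^sup>2 / 4) has_real_derivative t / 2) (at t)" for t :: real
    by (auto intro!: derivative_eq_intros)
  show "((\<lambda>t. F (t\<^sup>2 / 4)) has_real_derivative t / 2 * F1 (t\<^sup>2 / 4)) (at t)"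
    using DERIV_chain2[OF assms(1) z] by (simp add: mult.commute)
  have "((\<lambda>t. F1 (t\<^sup>2 / 4)) has_real_derivative F2 (t\<^sup>2 / 4) * (t / 2)) (at t)"
    by (rule DERIV_chain2[OF assms(2) z])
  then show "((\<lambda>t. t / 2 * F1 (t\<^sup>2 / 4)) has_real_derivative F1 (t\<^sup>2 / 4) / 2 + t\<^sup>2 / 4 * F2 (t\<^sup>2 / 4)) (at t)"
    by (auto intro!: derivative_eq_intros simp: power2_eq_square)
qed

text \<open>
  The cases of interest are \<open>a = 0\<close>, where this is \<open>pi\<close> times the Bessel function \<open>J\<^sub>0\<close>, and \<open>a = - pi/2\<close>,
  where it is \<open>pi\<close> times the Struve function \<open>H\<^sub>0\<close>. The names ending in \<open>1\<close> and \<open>2\<close> denote the first two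
  derivatives.
\<close>

definition angular_integral :: "real \<Rightarrow> real \<Rightarrow> real" where
  "angular_integral a t = integral {0..pi} (\<lambda>\<phi>. cos (t * sin \<phi> + a))"

definition angular_integral1 :: "real \<Rightarrow> real \<Rightarrow> real" where
  "angular_integral1 a t = - integral {0..pi} (\<lambda>\<phi>. sin \<phi> * sin (t * sin \<phi> + a))"

definition angular_integral2 :: "real \<Rightarrow> real \<Rightarrow> real" where
  "angular_integral2 a t = - integral {0..pi} (\<lambda>\<phi>. (sin \<phi>)\<^sup>2 * cos (t * sin \<phi> + a))"

lemma angular_integral_deriv:
  "(angular_integral a has_real_derivative angular_integral1 a t) (at t)"
  "(angular_integral1 a has_real_derivative angular_integral2 a t) (at t)"
proof -
  have "((\<lambda>t. integral (cbox 0 pi) (\<lambda>\<phi>. cos (t * sin \<phi> + a))) has_real_derivative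
      integral (cbox 0 pi) (\<lambda>\<phi>. - (sin \<phi> * sin (t * sin \<phi> + a)))) (at t within UNIV)"
    by (rule leibniz_rule_field_derivative)
      (auto intro!: derivative_eq_intros integrable_continuous_real continuous_intros simp: split_beta)
  then show "(angular_integral a has_real_derivative angular_integral1 a t) (at t)"
    by (simp add: angular_integral_def[abs_def] angular_integral1_def)
  have "((\<lambda>t. integral (cbox 0 pi) (\<lambda>\<phi>. - (sin \<phi> * sin (t * sin \<phi> + a)))) has_real_derivative
      integral (cbox 0 pi) (\<lambda>\<phi>. - ((sin \<phi>)\<^sup>2 * cos (t * sin \<phi> + a)))) (at t within UNIV)"
    by (rule leibniz_rule_field_derivative)
      (auto intro!: derivative_eq_intros integrable_continuous_real continuous_intros simp: split_beta power2_eq_square)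
  then show "(angular_integral1 a has_real_derivative angular_integral2 a t) (at t)"
    by (simp add: angular_integral1_def[abs_def] angular_integral2_def)
qed

text \<open>
  The integrand of the left-hand side is the derivative of \<open>cos \<phi> sin (t sin \<phi> + a)\<close>.
\<close>

lemma angular_integral_ode:
  "t * angular_integral2 a t
    + angular_integral1 a t + t * angular_integral a t = - 2 * sin a"
proof -
  have i: "(\<lambda>\<phi>. (sin \<phi>)\<^sup>2 * cos (t * sin \<phi> + a)) integrable_on {0..pi}"
     "(\<lambda>\<phi>. sin \<phi> * sin (t * sin \<phi> + a)) integrable_on {0..pi}" "(\<lambda>\<phi>. cos (t * sin \<phi> + a)) integrable_on {0..pi}"
    by (intro integrable_continuous_real continuous_intros)+
  have "((\<lambda>\<phi>. t * - ((sin \<phi>)\<^sup>2 * cos (t * sin \<phi> + a)) + - (sin \<phi> * sin (t * sin \<phi> + a)) + t * cos (t * sin \<phi> + a)) has_integral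
     (t * angular_integral2 a t
    + angular_integral1 a t + t * angular_integral a t)) {0..pi}"
    unfolding angular_integral_def angular_integral1_def angular_integral2_def
    by (intro has_integral_add has_integral_mult_right has_integral_neg integrable_integral i)
  moreover have "((\<lambda>\<phi>. t * - ((sin \<phi>)\<^sup>2 * cos (t * sin \<phi> + a)) + - (sin \<phi> * sin (t * sin \<phi> + a)) + t * cos (t * sin \<phi> + a)) has_integral
     (cos pi * sin (t * sin pi + a) - cos 0 * sin (t * sin 0 + a))) {0..pi}"
  proof (rule fundamental_theorem_of_calculus)
    fix \<phi> :: real
    have "((\<lambda>\<phi>. cos \<phi> * sin (t * sin \<phi> + a)) has_real_derivative
        - sin \<phi> * sin (t * sin \<phi> + a) + cos \<phi> * (cos (t * sin \<phi> + a) * (t * cos \<phi>))) (at \<phi> within {0..pi})"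
      by (auto intro!: derivative_eq_intros)
    also have "- sin \<phi> * sin (t * sin \<phi> + a) + cos \<phi> * (cos (t * sin \<phi> + a) * (t * cos \<phi>))
       = t * - ((sin \<phi>)\<^sup>2 * cos (t * sin \<phi> + a)) + - (sin \<phi> * sin (t * sin \<phi> + a)) + t * cos (t * sin \<phi> + a)"
    proof -
      have "cos \<phi> * (cos (t * sin \<phi> + a) * (t * cos \<phi>)) = t * (cos \<phi>)\<^sup>2 * cos (t * sin \<phi> + a)" by (simp add: power2_eq_square)
      then show ?thesis unfolding cos_squared_eq by (simp add: algebra_simps)
    qed
    finally show "((\<lambda>\<phi>. cos \<phi> * sin (t * sin \<phi> + a)) has_vector_derivative
        t * - ((sin \<phi>)\<^sup>2 * cos (t * sin \<phi> + a)) + - (sin \<phi> * sin (t * sin \<phi> + a)) + t * cos (t * sin \<phi> + a)) (at \<phi> within {0..pi})"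
      by (simp add: has_real_derivative_iff_has_vector_derivative)
  qed auto
  ultimately show ?thesis by (auto dest: has_integral_unique)
qed

lemma angular_integral_bounds: "isCont (angular_integral a) t" "\<bar>angular_integral1 a t\<bar> \<le> pi"
proof -
  show "isCont (angular_integral a) t" using angular_integral_deriv(1) by (rule DERIV_isCont)
  have "norm (integral {0..pi} (\<lambda>\<phi>. sin \<phi> * sin (t * sin \<phi> + a))) \<le> 1 * (pi - 0)"
    by (rule integral_bound) (auto intro!: continuous_intros simp: abs_mult intro: mult_le_one)
  then show "\<bar>angular_integral1 a t\<bar> \<le> pi" by (simp add: angular_integral1_def)
qed

section \<open>The Laplace integral of 1 / sqrt (1 + s^2)\<close>

text \<open>
  \<open>2/pi\<close> times \<open>struve_laplace\<close> is the difference of the Struve function \<open>H\<^sub>0\<close> and the Neumann function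
  \<open>Y\<^sub>0\<close>; the names ending in \<open>1\<close> and \<open>2\<close> denote the first two derivatives.
\<close>

definition struve_kernel :: "real \<Rightarrow> real" where
  "struve_kernel s = indicat_real {0<..} s / sqrt (1 + s\<^sup>2)"

definition struve_laplace :: "real \<Rightarrow> real" where
  "struve_laplace t = (LINT s|lborel. exp (t * - s) *\<^sub>R struve_kernel s)"

definition struve_laplace1 :: "real \<Rightarrow> real" where
  "struve_laplace1 t = (LINT s|lborel. exp (t * - s) *\<^sub>R (- s *\<^sub>R struve_kernel s))"

definition struve_laplace2 :: "real \<Rightarrow> real" where
  "struve_laplace2 t = (LINT s|lborel. exp (t * - s) *\<^sub>R (- s *\<^sub>R (- s *\<^sub>R struve_kernel s)))"

lemma struve_kernel_measurable [measurable]: "struve_kernel \<in> borel_measurable borel"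
  unfolding struve_kernel_def by measurable

lemma exp_integrable_Ioi:
  fixes W :: real
  assumes "W > 0"
  shows "has_bochner_integral lborel (\<lambda>s. exp (W * - s) * indicat_real {0<..} s) (1 / W)"
proof -
  have "(\<lambda>s. exp (W * - s) * (indicat_real {0<..} s * s powr (1 - 1))) = (\<lambda>s. exp (W * - s) * indicat_real {0<..} s)"
    by (auto simp: indicator_def fun_eq_iff)
  then show ?thesis using gamma_laplace[of 1 W] assms by (simp add: powr_minus divide_inverse)
qed

lemma struve_kernel_bounds: "0 \<le> struve_kernel s" "struve_kernel s \<le> indicat_real {0<..} s"
  by (auto simp: struve_kernel_def indicator_def divide_le_eq add_pos_nonneg)

lemma struve_laplace_integrable: "t > 0 \<Longrightarrow> integrable lborel (\<lambda>s. exp (t * - s) *\<^sub>R struve_kernel s)"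
  by (rule Bochner_Integration.integrable_bound[of lborel "\<lambda>s. exp (t * - s) * indicat_real {0<..} s"])
    (use exp_integrable_Ioi[of t] struve_kernel_bounds in \<open>auto simp: has_bochner_integral_iff abs_mult intro!: mult_left_mono\<close>)

lemma struve_laplace_derivs:
  assumes t: "t > 0"
  shows "integrable lborel (\<lambda>s. exp (t * - s) *\<^sub>R (- s *\<^sub>R struve_kernel s))"
    and "(struve_laplace has_real_derivative struve_laplace1 t) (at t)"
    and "integrable lborel (\<lambda>s. exp (t * - s) *\<^sub>R (- s *\<^sub>R (- s *\<^sub>R struve_kernel s)))"
    and "(struve_laplace1 has_real_derivative struve_laplace2 t) (at t)"
proof -
  have i1: "integrable lborel (\<lambda>s. exp (t * - s) *\<^sub>R (- s *\<^sub>R struve_kernel s))" if "t > 0" for t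
    using laplace_deriv(1)[of uminus lborel struve_kernel 0 t] that struve_laplace_integrable by auto
  then show "integrable lborel (\<lambda>s. exp (t * - s) *\<^sub>R (- s *\<^sub>R struve_kernel s))" using t by blast
  show "(struve_laplace has_real_derivative struve_laplace1 t) (at t)"
    using laplace_deriv(2)[of uminus lborel struve_kernel 0 t] t struve_laplace_integrable
    by (auto simp: struve_laplace_def[abs_def] struve_laplace1_def has_real_derivative_iff_has_vector_derivative)
  show "integrable lborel (\<lambda>s. exp (t * - s) *\<^sub>R (- s *\<^sub>R (- s *\<^sub>R struve_kernel s)))"
    using laplace_deriv(1)[of uminus lborel "\<lambda>s. - s *\<^sub>R struve_kernel s" 0 t] t i1 by auto
  show "(struve_laplace1 has_real_derivative struve_laplace2 t) (at t)"
    using laplace_deriv(2)[of uminus lborel "\<lambda>s. - s *\<^sub>R struve_kernel s" 0 t] t i1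
    by (auto simp: struve_laplace1_def[abs_def] struve_laplace2_def has_real_derivative_iff_has_vector_derivative)
qed

lemma integral_Ioi_FTC:
  fixes F f :: "real \<Rightarrow> real"
  assumes F: "\<And>x. x > 0 \<Longrightarrow> (F has_real_derivative f x) (at x)"
    and f: "\<And>x. x > 0 \<Longrightarrow> isCont f x"
    and int: "integrable lborel (\<lambda>x. indicat_real {0<..} x * f x)"
    and lim: "(F \<longlongrightarrow> A) (at_right 0)" "(F \<longlongrightarrow> B) at_top"
  shows "(LINT x|lborel. indicat_real {0<..} x * f x) = B - A"
proof -
  have "(LBINT x=0..\<infinity>. f x) = B - A"
  proof (rule interval_integral_FTC_integrable[where F = F])
    show "set_integrable lborel (einterval 0 \<infinity>) f"
      using int by (simp add: set_integrable_def einterval_def greaterThan_def zero_ereal_def)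
    show "((F \<circ> real_of_ereal) \<longlongrightarrow> A) (at_right 0)" using lim(1) by (simp add: zero_ereal_def ereal_tendsto_simps)
    show "((F \<circ> real_of_ereal) \<longlongrightarrow> B) (at_left \<infinity>)" using lim(2) by (simp add: ereal_tendsto_simps)
  qed (use F f in \<open>auto simp: has_real_derivative_iff_has_vector_derivative\<close>)
  then show ?thesis by (simp add: interval_lebesgue_integral_0_infty set_lebesgue_integral_def)
qed

text \<open>
  The integrand of the left-hand side is the derivative of \<open>- sqrt (1 + s\<^sup>2) exp(- t s)\<close>, whose boundary
  value at \<open>0\<close> provides the right-hand side.
\<close>

lemma struve_laplace_ode:
  assumes t: "t > 0"
  shows "t * struve_laplace2 t + struve_laplace1 t + t * struve_laplace t = 1"
proof -
  define f where "f s = exp (t * - s) * (t * sqrt (1 + s\<^sup>2) - s / sqrt (1 + s\<^sup>2))" for s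
  have pos: "1 + s\<^sup>2 > 0" for s :: real by (simp add: add_pos_nonneg)
  have eq: "t * (exp (t * - s) *\<^sub>R (- s *\<^sub>R (- s *\<^sub>R struve_kernel s))) + exp (t * - s) *\<^sub>R (- s *\<^sub>R struve_kernel s) + t * (exp (t * - s) *\<^sub>R struve_kernel s)
      = indicat_real {0<..} s * f s" for s
  proof -
    have "1 / sqrt (1 + s\<^sup>2) * (1 + s\<^sup>2) = sqrt (1 + s\<^sup>2)"
      using real_div_sqrt[of "1 + s\<^sup>2"] pos[of s] by simp
    then have "sqrt (1 + s\<^sup>2) = 1 / sqrt (1 + s\<^sup>2) + s\<^sup>2 * (1 / sqrt (1 + s\<^sup>2))" by (simp add: algebra_simps add_divide_distrib)
    then have "f s = exp (t * - s) * (t * (1 / sqrt (1 + s\<^sup>2) + s\<^sup>2 * (1 / sqrt (1 + s\<^sup>2))) - s * (1 / sqrt (1 + s\<^sup>2)))"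
      unfolding f_def by simp
    then show ?thesis by (cases "s > 0") (simp_all add: struve_kernel_def power2_eq_square algebra_simps)
  qed
  have ints: "integrable lborel (\<lambda>s. t * (exp (t * - s) *\<^sub>R (- s *\<^sub>R (- s *\<^sub>R struve_kernel s))))"
      "integrable lborel (\<lambda>s. exp (t * - s) *\<^sub>R (- s *\<^sub>R struve_kernel s))" "integrable lborel (\<lambda>s. t * (exp (t * - s) *\<^sub>R struve_kernel s))"
    by (rule integrable_mult_right[OF struve_laplace_derivs(3)[OF t]] struve_laplace_derivs(1)[OF t] integrable_mult_right[OF struve_laplace_integrable[OF t]])+
  have "t * struve_laplace2 t + struve_laplace1 t + t * struve_laplace t = (LINT s|lborel. t * (exp (t * - s) *\<^sub>R (- s *\<^sub>R (- s *\<^sub>R struve_kernel s))) + exp (t * - s) *\<^sub>R (- s *\<^sub>R struve_kernel s) + t * (exp (t * - s) *\<^sub>R struve_kernel s))"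
    unfolding struve_laplace2_def struve_laplace1_def struve_laplace_def
    by (subst Bochner_Integration.integral_add[OF Bochner_Integration.integrable_add[OF ints(1,2)] ints(3)],
        subst Bochner_Integration.integral_add[OF ints(1,2)], subst integral_mult_right_zero, subst integral_mult_right_zero) simp
  also have "\<dots> = (LINT s|lborel. indicat_real {0<..} s * f s)" unfolding eq ..
  also have "\<dots> = 0 - (-1)"
  proof (rule integral_Ioi_FTC[where F = "\<lambda>s. - sqrt (1 + s\<^sup>2) * exp (t * - s)"])
    fix s :: real assume "s > 0"
    show "((\<lambda>s. - sqrt (1 + s\<^sup>2) * exp (t * - s)) has_real_derivative f s) (at s)"
      unfolding f_def using pos[of s] by (auto intro!: derivative_eq_intros simp: divide_simps) (auto simp: algebra_simps)
    show "isCont f s" unfolding f_def using pos[of s] by (auto intro!: continuous_intros)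
  next
    show "integrable lborel (\<lambda>s. indicat_real {0<..} s * f s)"
      unfolding eq[symmetric] by (intro Bochner_Integration.integrable_add ints)
    have "isCont (\<lambda>s. - sqrt (1 + s\<^sup>2) * exp (t * - s)) 0" by (intro continuous_intros)
    then show "((\<lambda>s. - sqrt (1 + s\<^sup>2) * exp (t * - s)) \<longlongrightarrow> -1) (at_right 0)"
      by (simp add: isCont_def filterlim_at_split)
    show "((\<lambda>s. - sqrt (1 + s\<^sup>2) * exp (t * - s)) \<longlongrightarrow> 0) at_top" using t by real_asymp
  qed
  finally show ?thesis by simp
qed

lemma struve_laplace_bound:
  assumes "t > 0" shows "\<bar>struve_laplace t\<bar> \<le> 1 / t"
proof -
  have "0 \<le> struve_laplace t" unfolding struve_laplace_def using struve_kernel_bounds by (intro integral_nonneg_AE) auto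
  moreover have "struve_laplace t \<le> (LINT s|lborel. exp (t * - s) * indicat_real {0<..} s)"
    unfolding struve_laplace_def using struve_laplace_integrable[OF assms] exp_integrable_Ioi[OF assms] struve_kernel_bounds
    by (intro integral_mono) (auto simp: has_bochner_integral_iff)
  moreover have "(LINT s|lborel. exp (t * - s) * indicat_real {0<..} s) = 1 / t"
    using exp_integrable_Ioi[OF assms] by (simp add: has_bochner_integral_iff)
  ultimately show ?thesis by simp
qed

text \<open>
  This is the derivative of \<open>Gamma\<close> at \<open>1\<close>, where Euler's constant enters the Neumann function.
\<close>

lemma integral_exp_ln:
  "integrable lborel (\<lambda>x. indicat_real {0<..} x * (exp (- x) * ln x))"
  "(LINT x|lborel. indicat_real {0<..} x * (exp (- x) * ln x)) = - euler_mascheroni"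
proof -
  define q where "q x = indicat_real {0<..} x * (exp (- x) / x)" for x :: real
  have q: "exp (t * ln x) *\<^sub>R q x = exp (1 * - x) * (indicat_real {0<..} x * x powr (t - 1))" for t x
    by (cases "x > 0") (auto simp: q_def powr_def exp_diff left_diff_distrib)
  have m: "q \<in> borel_measurable lborel" unfolding q_def by measurable
  have int: "integrable lborel (\<lambda>x. exp (t * ln x) *\<^sub>R q x)" if "0 < t" for t
    unfolding q using gamma_laplace[of t 1] that by (simp add: has_bochner_integral_iff)
  have val: "(LINT x|lborel. exp (t * ln x) *\<^sub>R q x) = Gamma t" if "0 < t" for t
    unfolding q using gamma_laplace[of t 1] that by (simp add: has_bochner_integral_iff)
  have e: "exp (1 * ln x) *\<^sub>R (ln x *\<^sub>R q x) = indicat_real {0<..} x * (exp (- x) * ln x)" for x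
    by (cases "x > 0") (auto simp: q_def)
  show "integrable lborel (\<lambda>x. indicat_real {0<..} x * (exp (- x) * ln x))"
    using laplace_deriv(1)[of ln lborel q 0 1] m int unfolding e by auto
  have "((\<lambda>t. LINT x|lborel. exp (t * ln x) *\<^sub>R q x) has_real_derivative (LINT x|lborel. indicat_real {0<..} x * (exp (- x) * ln x))) (at 1)"
    using laplace_deriv(2)[of ln lborel q 0 1] m int unfolding e by (auto simp: has_real_derivative_iff_has_vector_derivative)
  then have "(Gamma has_real_derivative (LINT x|lborel. indicat_real {0<..} x * (exp (- x) * ln x))) (at 1)"
    by (rule has_field_derivative_transform_within_open[of _ _ _ "{0<..}"]) (auto simp: val[unfolded real_scaleR_def])
  moreover have "(Gamma has_real_derivative Gamma 1 * Digamma 1) (at (1::real))"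
    by (intro has_field_derivative_Gamma) auto
  ultimately show "(LINT x|lborel. indicat_real {0<..} x * (exp (- x) * ln x)) = - euler_mascheroni"
    by (auto dest: DERIV_unique)
qed

text \<open>
  The substitution \<open>x = t s\<close>, after which \<open>t\<close> can tend to \<open>0\<close> under the integral.
\<close>

lemma struve_laplace_rescale:
  assumes t: "t > 0"
  shows "struve_laplace t = (LINT x|lborel. indicat_real {0<..} x * (exp (- x) / sqrt (t\<^sup>2 + x\<^sup>2)))"
    and "integrable lborel (\<lambda>x. indicat_real {0<..} x * (exp (- x) / sqrt (t\<^sup>2 + x\<^sup>2)))"
    and "t * struve_laplace1 t = - (LINT x|lborel. indicat_real {0<..} x * (exp (- x) * (x / sqrt (t\<^sup>2 + x\<^sup>2))))"
proof -
  have pt: "1 / t * (exp (t * - (x / t)) *\<^sub>R struve_kernel (x / t)) = indicat_real {0<..} x * (exp (- x) / sqrt (t\<^sup>2 + x\<^sup>2))" for x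
  proof (cases "x > 0")
    case True
    have "t * sqrt (1 + (x / t)\<^sup>2) = sqrt (t\<^sup>2 * (1 + (x / t)\<^sup>2))" using t by (simp add: real_sqrt_mult)
    also have "t\<^sup>2 * (1 + (x / t)\<^sup>2) = t\<^sup>2 + x\<^sup>2" using t by (simp add: field_simps)
    finally show ?thesis using True t by (simp add: struve_kernel_def)
  qed (use t in \<open>simp add: struve_kernel_def indicator_def zero_less_divide_iff\<close>)
  have pt1: "1 / t * (exp (t * - (x / t)) *\<^sub>R (- (x / t) *\<^sub>R struve_kernel (x / t))) = - (1 / t * (indicat_real {0<..} x * (exp (- x) * (x / sqrt (t\<^sup>2 + x\<^sup>2)))))" for x
    using arg_cong[OF pt[of x], of "\<lambda>r. - (x / t) * r"] t by (simp add: mult_ac)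
  have "struve_laplace t = \<bar>1 / t\<bar> *\<^sub>R (LINT x|lborel. exp (t * - (0 + 1 / t * x)) *\<^sub>R struve_kernel (0 + 1 / t * x))"
    unfolding struve_laplace_def using t by (intro lborel_integral_real_affine) auto
  also have "\<dots> = (LINT x|lborel. 1 / t * (exp (t * - (x / t)) *\<^sub>R struve_kernel (x / t)))" using t by simp
  finally show "struve_laplace t = (LINT x|lborel. indicat_real {0<..} x * (exp (- x) / sqrt (t\<^sup>2 + x\<^sup>2)))" unfolding pt .
  have "integrable lborel (\<lambda>x. exp (t * - (0 + 1 / t * x)) *\<^sub>R struve_kernel (0 + 1 / t * x))"
    using t by (intro lborel_integrable_real_affine struve_laplace_integrable) auto
  then have "integrable lborel (\<lambda>x. 1 / t * (exp (t * - (x / t)) *\<^sub>R struve_kernel (x / t)))" 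
    by (intro integrable_mult_right) simp
  then show "integrable lborel (\<lambda>x. indicat_real {0<..} x * (exp (- x) / sqrt (t\<^sup>2 + x\<^sup>2)))" unfolding pt .
  have "struve_laplace1 t = \<bar>1 / t\<bar> *\<^sub>R (LINT x|lborel. exp (t * - (0 + 1 / t * x)) *\<^sub>R (- (0 + 1 / t * x) *\<^sub>R struve_kernel (0 + 1 / t * x)))"
    unfolding struve_laplace1_def using t by (intro lborel_integral_real_affine) auto
  also have "\<dots> = (LINT x|lborel. 1 / t * (exp (t * - (x / t)) *\<^sub>R (- (x / t) *\<^sub>R struve_kernel (x / t))))" using t by simp
  also have "\<dots> = - (1 / t * (LINT x|lborel. indicat_real {0<..} x * (exp (- x) * (x / sqrt (t\<^sup>2 + x\<^sup>2)))))"
    unfolding pt1 by (simp only: Bochner_Integration.integral_minus integral_mult_right_zero)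
  finally show "t * struve_laplace1 t = - (LINT x|lborel. indicat_real {0<..} x * (exp (- x) * (x / sqrt (t\<^sup>2 + x\<^sup>2))))"
    using t by simp
qed

lemma struve_laplace1_limit: "((\<lambda>t. t * struve_laplace1 t) \<longlongrightarrow> -1) (at_right 0)"
proof -
  have "((\<lambda>t. LINT x|lborel. indicat_real {0<..} x * (exp (- x) * (x / sqrt (t\<^sup>2 + x\<^sup>2)))) \<longlongrightarrow> (LINT x|lborel. indicat_real {0<..} x * exp (- x))) (at_right 0)"
  proof (rule dominated_convergence_at[where w = "\<lambda>x. indicat_real {0<..} x * exp (- x)"])
    show "integrable lborel (\<lambda>x::real. indicat_real {0<..} x * exp (- x))"
      using exp_integrable_Ioi[of 1] by (simp add: has_bochner_integral_iff mult.commute)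
    fix x :: real
    show "((\<lambda>t. indicat_real {0<..} x * (exp (- x) * (x / sqrt (t\<^sup>2 + x\<^sup>2)))) \<longlongrightarrow> indicat_real {0<..} x * exp (- x)) (at_right 0)"
    proof (cases "x > 0")
      case True
      have "((\<lambda>t. indicat_real {0<..} x * (exp (- x) * (x / sqrt (t\<^sup>2 + x\<^sup>2)))) \<longlongrightarrow> indicat_real {0<..} x * (exp (- x) * (x / sqrt (0\<^sup>2 + x\<^sup>2)))) (at_right 0)"
        using True by (intro tendsto_intros) auto
      then show ?thesis using True by simp
    qed simp
  next
    show "\<forall>\<^sub>F t in at_right 0. \<forall>x\<in>space lborel. norm (indicat_real {0<..} x * (exp (- x) * (x / sqrt (t\<^sup>2 + x\<^sup>2)))) \<le> indicat_real {0<..} x * exp (- x)"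
    proof (intro always_eventually allI ballI)
      fix t x :: real
      show "norm (indicat_real {0<..} x * (exp (- x) * (x / sqrt (t\<^sup>2 + x\<^sup>2)))) \<le> indicat_real {0<..} x * exp (- x)"
      proof (cases "x > 0")
        case True
        have "sqrt (x\<^sup>2) \<le> sqrt (t\<^sup>2 + x\<^sup>2)" by (rule real_sqrt_le_mono) simp
        moreover have "sqrt (t\<^sup>2 + x\<^sup>2) > 0" using True by (simp add: add_nonneg_pos)
        ultimately have "\<bar>x / sqrt (t\<^sup>2 + x\<^sup>2)\<bar> \<le> 1" using True by (simp add: divide_le_eq)
        from mult_left_mono[OF this, of "exp (- x)"] show ?thesis using True by (simp add: abs_mult)
      qed simp
    qed
  qed auto
  moreover have "(LINT x|lborel. indicat_real {0<..} x * exp (- x)) = (1::real)"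
    using exp_integrable_Ioi[of 1] by (simp add: has_bochner_integral_iff mult.commute)
  ultimately have "((\<lambda>t. - (LINT x|lborel. indicat_real {0<..} x * (exp (- x) * (x / sqrt (t\<^sup>2 + x\<^sup>2))))) \<longlongrightarrow> - 1) (at_right 0)"
    by (intro tendsto_minus) simp
  then show ?thesis
    by (rule Lim_transform_eventually) (auto simp: eventually_at_right_field struve_laplace_rescale(3) intro!: exI[of _ 1])
qed

text \<open>
  Integrating by parts with \<open>G t x = ln (x + sqrt (t\<^sup>2 + x\<^sup>2))\<close>, a primitive of \<open>1 / sqrt (t\<^sup>2 + x\<^sup>2)\<close>, splits off
  the logarithm as the boundary term \<open>G t 0 = ln t\<close>. What remains converges to \<open>\<integral>\<^sub>0\<^sup>\<infinity> exp(- x) ln (2 x) dx\<close>.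
\<close>

lemma struve_laplace_limit: "((\<lambda>t. struve_laplace t + ln t) \<longlongrightarrow> ln 2 - euler_mascheroni) (at_right 0)"
proof -
  define G where "G t x = ln (x + sqrt (t\<^sup>2 + x\<^sup>2))" for t x :: real
  define w where "w x = indicat_real {0<..} x * (exp (- x) * \<bar>ln x\<bar>) + 2 * (exp (1 * - x) * (indicat_real {0<..} x * x powr (2 - 1)))" for x :: real
  have w: "integrable lborel w"
    unfolding w_def
  proof (intro Bochner_Integration.integrable_add integrable_mult_right)
    show "integrable lborel (\<lambda>x. indicat_real {0<..} x * (exp (- x) * \<bar>ln x\<bar>))"
      using integrable_norm[OF integral_exp_ln(1)] by (simp add: abs_mult)
    show "integrable lborel (\<lambda>x. exp (1 * - x) * (indicat_real {0<..} x * x powr (2 - 1)))"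
      using gamma_laplace[of 2 1] by (simp add: has_bochner_integral_iff)
  qed
  have bnd: "norm (indicat_real {0<..} x * (exp (- x) * G t x)) \<le> w x" if t: "0 \<le> t" "t \<le> 1" for t x
  proof (cases "x > 0")
    case True
    have "sqrt (x\<^sup>2) \<le> sqrt (t\<^sup>2 + x\<^sup>2)" by (rule real_sqrt_le_mono) simp
    then have "x \<le> x + sqrt (t\<^sup>2 + x\<^sup>2)" using True by simp
    then have l: "ln x \<le> G t x" unfolding G_def using True by (subst ln_le_cancel_iff) (auto simp: add_pos_nonneg)
    have "sqrt (t\<^sup>2 + x\<^sup>2) \<le> sqrt ((1 + x)\<^sup>2)" using t True power_mono[of t 1 2] by (intro real_sqrt_le_mono) (simp add: power2_eq_square algebra_simps)
    then have "x + sqrt (t\<^sup>2 + x\<^sup>2) \<le> 1 + 2 * x" using True by simp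
    then have "G t x \<le> ln (1 + 2 * x)" unfolding G_def using True by (subst ln_le_cancel_iff) (auto simp: add_pos_nonneg)
    also have "\<dots> \<le> 2 * x" using True by (intro ln_add_one_self_le_self) auto
    finally have "\<bar>G t x\<bar> \<le> \<bar>ln x\<bar> + 2 * x" using l True by linarith
    then have "exp (- x) * \<bar>G t x\<bar> \<le> exp (- x) * (\<bar>ln x\<bar> + 2 * x)" by (intro mult_left_mono) auto
    then show ?thesis using True by (simp add: w_def abs_mult algebra_simps)
  qed (simp add: w_def)
  have G_meas [measurable]: "(\<lambda>x. indicat_real {0<..} x * (exp (- x) * G t x)) \<in> borel_measurable borel" for t
    unfolding G_def by measurable
  have G_int: "integrable lborel (\<lambda>x. indicat_real {0<..} x * (exp (- x) * G t x))" if t: "0 \<le> t" "t \<le> 1" for t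
    by (rule Bochner_Integration.integrable_bound[OF w]) (use bnd[OF t] in \<open>auto intro!: AE_I2 order_trans[OF _ abs_ge_self] simp del: norm_mult\<close>)
  have parts: "struve_laplace t + ln t = (LINT x|lborel. indicat_real {0<..} x * (exp (- x) * G t x))" if t: "0 < t" "t < 1" for t
  proof -
    have tx: "t\<^sup>2 + x\<^sup>2 > 0" for x using t by (simp add: add_pos_nonneg)
    have g: "x + sqrt (t\<^sup>2 + x\<^sup>2) > 0" if "x \<ge> 0" for x using tx[of x] that by (simp add: add_nonneg_pos)
    have i: "integrable lborel (\<lambda>x. indicat_real {0<..} x * (exp (- x) * G t x))" using G_int[of t] t by simp
    have "(LINT x|lborel. indicat_real {0<..} x * (exp (- x) / sqrt (t\<^sup>2 + x\<^sup>2) - exp (- x) * G t x)) = 0 - ln t"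
    proof (rule integral_Ioi_FTC[where F = "\<lambda>x. exp (- x) * G t x"])
      fix x :: real assume x: "x > 0"
      have "(G t has_real_derivative (1 + x / sqrt (t\<^sup>2 + x\<^sup>2)) / (x + sqrt (t\<^sup>2 + x\<^sup>2))) (at x)"
        unfolding G_def using tx[of x] g[of x] x t by (auto intro!: derivative_eq_intros simp: divide_simps)
      also have "(1 + x / sqrt (t\<^sup>2 + x\<^sup>2)) / (x + sqrt (t\<^sup>2 + x\<^sup>2)) = 1 / sqrt (t\<^sup>2 + x\<^sup>2)"
      proof -
        have "1 + x / sqrt (t\<^sup>2 + x\<^sup>2) = (x + sqrt (t\<^sup>2 + x\<^sup>2)) / sqrt (t\<^sup>2 + x\<^sup>2)" using tx[of x] using t by (simp add: add_divide_distrib)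
        then show ?thesis using g[of x] x by simp
      qed
      finally have "(G t has_real_derivative 1 / sqrt (t\<^sup>2 + x\<^sup>2)) (at x)" .
      then show "((\<lambda>x. exp (- x) * G t x) has_real_derivative exp (- x) / sqrt (t\<^sup>2 + x\<^sup>2) - exp (- x) * G t x) (at x)"
        by (auto intro!: derivative_eq_intros)
      show "isCont (\<lambda>x. exp (- x) / sqrt (t\<^sup>2 + x\<^sup>2) - exp (- x) * G t x) x"
        unfolding G_def using tx[of x] g[of x] x by (intro continuous_intros) auto
    next
      show "integrable lborel (\<lambda>x. indicat_real {0<..} x * (exp (- x) / sqrt (t\<^sup>2 + x\<^sup>2) - exp (- x) * G t x))"
        using i struve_laplace_rescale(2)[OF t(1)] by (simp add: right_diff_distrib)
      have "isCont (\<lambda>x. exp (- x) * G t x) 0" unfolding G_def using g[of 0] by (intro continuous_intros) auto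
      then show "((\<lambda>x. exp (- x) * G t x) \<longlongrightarrow> ln t) (at_right 0)" using t by (simp add: isCont_def filterlim_at_split G_def)
      show "((\<lambda>x. exp (- x) * G t x) \<longlongrightarrow> 0) at_top" unfolding G_def by real_asymp
    qed
    moreover have "(LINT x|lborel. indicat_real {0<..} x * (exp (- x) / sqrt (t\<^sup>2 + x\<^sup>2) - exp (- x) * G t x))
       = struve_laplace t - (LINT x|lborel. indicat_real {0<..} x * (exp (- x) * G t x))"
      unfolding struve_laplace_rescale(1)[OF t(1)] right_diff_distrib
      using i struve_laplace_rescale(2)[OF t(1)] by (rule Bochner_Integration.integral_diff[rotated])
    ultimately show ?thesis by simp
  qed
  have "((\<lambda>t. LINT x|lborel. indicat_real {0<..} x * (exp (- x) * G t x)) \<longlongrightarrow> (LINT x|lborel. indicat_real {0<..} x * (exp (- x) * (ln 2 + ln x)))) (at_right 0)"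
  proof (rule dominated_convergence_at[OF _ _ w])
    fix x :: real
    show "((\<lambda>t. indicat_real {0<..} x * (exp (- x) * G t x)) \<longlongrightarrow> indicat_real {0<..} x * (exp (- x) * (ln 2 + ln x))) (at_right 0)"
    proof (cases "x > 0")
      case True
      have "((\<lambda>t. indicat_real {0<..} x * (exp (- x) * G t x)) \<longlongrightarrow> indicat_real {0<..} x * (exp (- x) * ln (x + sqrt (0\<^sup>2 + x\<^sup>2)))) (at_right 0)"
        unfolding G_def using True by (intro tendsto_intros) auto
      also have "ln (x + sqrt (0\<^sup>2 + x\<^sup>2)) = ln 2 + ln x" using True by (simp add: ln_mult)
      finally show ?thesis .
    qed simp
  next
    show "\<forall>\<^sub>F t in at_right 0. \<forall>x\<in>space lborel. norm (indicat_real {0<..} x * (exp (- x) * G t x)) \<le> w x"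
      using bnd by (auto simp: eventually_at_right_field simp del: norm_mult intro!: exI[of _ 1])
  qed auto
  also have "(LINT x|lborel. indicat_real {0<..} x * (exp (- x) * (ln 2 + ln x))) = (LINT x|lborel. ln 2 * (exp (1 * - x) * indicat_real {0<..} x) + indicat_real {0<..} x * (exp (- x) * ln x))"
    by (intro Bochner_Integration.integral_cong) (auto simp: algebra_simps)
  also have "\<dots> = ln 2 * (1 / 1) + - euler_mascheroni"
    using exp_integrable_Ioi[of 1] integral_exp_ln by (subst Bochner_Integration.integral_add) (auto simp: has_bochner_integral_iff)
  finally have "((\<lambda>t. LINT x|lborel. indicat_real {0<..} x * (exp (- x) * G t x)) \<longlongrightarrow> ln 2 - euler_mascheroni) (at_right 0)" by simp
  then show ?thesis
    by (rule Lim_transform_eventually) (auto simp: eventually_at_right_field parts intro!: exI[of _ 1])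
qed

section \<open>The Hankel function\<close>

lemma angular_integral_limits:
  "(angular_integral a \<longlongrightarrow> angular_integral a 0) (at_right 0)" "((\<lambda>t. t * angular_integral1 a t) \<longlongrightarrow> 0) (at_right 0)"
proof -
  show "(angular_integral a \<longlongrightarrow> angular_integral a 0) (at_right 0)"
    using angular_integral_bounds(1)[where a = a and t = 0] by (simp add: isCont_def filterlim_at_split)
  show "((\<lambda>t. t * angular_integral1 a t) \<longlongrightarrow> 0) (at_right 0)"
  proof (rule Lim_null_comparison)
    show "\<forall>\<^sub>F t in at_right 0. norm (t * angular_integral1 a t) \<le> t * pi"
      unfolding eventually_at_right_field
    proof (intro exI[of _ 1] conjI allI impI)
      fix t :: real assume "t > 0"
      then show "norm (t * angular_integral1 a t) \<le> t * pi"
        unfolding norm_mult using angular_integral_bounds(2)[where a = a and t = t] by (intro mult_mono) auto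
    qed auto
    show "((\<lambda>t. t * pi) \<longlongrightarrow> 0) (at_right (0::real))" by (auto intro!: tendsto_eq_intros)
  qed
qed

context
  fixes F F1 F2 :: "real \<Rightarrow> real"
  assumes F: "\<And>z. (F has_real_derivative F1 z) (at z)" "\<And>z. (F1 has_real_derivative F2 z) (at z)"
begin

lemma powser_lift_limits:
  "((\<lambda>t. F (t\<^sup>2 / 4)) \<longlongrightarrow> F 0) (at_right 0)"
  "((\<lambda>t. t * (t / 2 * F1 (t\<^sup>2 / 4))) \<longlongrightarrow> 0) (at_right 0)"
  "((\<lambda>t. (F (t\<^sup>2 / 4) - F 0) / t) \<longlongrightarrow> 0) (at_right 0)"
  "((\<lambda>t. F1 (t\<^sup>2 / 4)) \<longlongrightarrow> F1 0) (at_right 0)"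
proof -
  note d = powser_lift_deriv[OF F]
  have "isCont (\<lambda>t. F (t\<^sup>2 / 4)) 0" by (rule DERIV_isCont[OF d(1)])
  then show "((\<lambda>t. F (t\<^sup>2 / 4)) \<longlongrightarrow> F 0) (at_right 0)" by (simp add: isCont_def filterlim_at_split)
  have "isCont (\<lambda>t. t * (t / 2 * F1 (t\<^sup>2 / 4))) 0" by (intro isCont_mult continuous_ident DERIV_isCont[OF d(2)])
  then show "((\<lambda>t. t * (t / 2 * F1 (t\<^sup>2 / 4))) \<longlongrightarrow> 0) (at_right 0)" by (simp add: isCont_def filterlim_at_split)
  have "((\<lambda>h. (F (h\<^sup>2 / 4) - F 0) / h) \<longlongrightarrow> 0) (at 0)" using d(1)[of 0] by (simp add: DERIV_def)
  then show "((\<lambda>t. (F (t\<^sup>2 / 4) - F 0) / t) \<longlongrightarrow> 0) (at_right 0)" by (simp add: filterlim_at_split)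
  have "isCont (\<lambda>t. F1 (t\<^sup>2 / 4)) 0"
    by (rule isCont_o2[of _ _ F1]) (auto intro!: continuous_intros DERIV_isCont[OF F(2)])
  then show "((\<lambda>t. F1 (t\<^sup>2 / 4)) \<longlongrightarrow> F1 0) (at_right 0)" by (simp add: isCont_def filterlim_at_split)
qed

end

lemma bessel_substitution:
  fixes t :: real
  shows "t * (F1 / 2 + t\<^sup>2 / 4 * F2) + t / 2 * F1 + t * F = t * (t\<^sup>2 / 4 * F2 + F1 + F)"
  by (simp add: algebra_simps)

lemma bessel_J0_integral:
  assumes "t > 0"
  shows "bessel_J0 t = angular_integral 0 t / pi"
proof -
  define f where "f t = powser jcoeff (t\<^sup>2 / 4) - angular_integral 0 t / pi" for t
  define f1 where "f1 t = t / 2 * powser (diffs jcoeff) (t\<^sup>2 / 4) - angular_integral1 0 t / pi" for t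
  define f2 where "f2 t = (powser (diffs jcoeff) (t\<^sup>2 / 4) / 2 + t\<^sup>2 / 4 * powser (diffs (diffs jcoeff)) (t\<^sup>2 / 4)) - angular_integral2 0 t / pi" for t
  note dJ = powser_lift_deriv[OF powser_derivs(1,2)] and lJ = powser_lift_limits[OF powser_derivs(1,2)]
  have b0: "angular_integral 0 0 = pi" by (simp add: angular_integral_def)
  have "f t = 0"
  proof (rule bessel_ode_unique[of f f1 f2])
    fix t :: real assume t: "t > 0"
    show "(f has_real_derivative f1 t) (at t)"
      unfolding f_def f1_def by (intro DERIV_diff DERIV_cdivide dJ angular_integral_deriv)
    show "(f1 has_real_derivative f2 t) (at t)"
      unfolding f1_def f2_def by (intro DERIV_diff DERIV_cdivide dJ angular_integral_deriv)
    have "t * f2 t + f1 t + t * f t = t * (t\<^sup>2 / 4 * powser (diffs (diffs jcoeff)) (t\<^sup>2 / 4) + powser (diffs jcoeff) (t\<^sup>2 / 4) + powser jcoeff (t\<^sup>2 / 4))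
       - (t * angular_integral2 0 t + angular_integral1 0 t + t * angular_integral 0 t) / pi"
    proof -
      have alg: "t * (a2 - b2 / c) + (a1 - b1 / c) + t * (a - b / c) = (t * a2 + a1 + t * a) - (t * b2 + b1 + t * b) / c"
        for a a1 a2 b b1 b2 c :: real
        by (simp add: right_diff_distrib add_divide_distrib)
      show ?thesis unfolding f_def f1_def f2_def alg bessel_substitution ..
    qed
    then show "t * f2 t + f1 t + t * f t = 0"
      unfolding powser_j_ode angular_integral_ode by simp
  next
    have "(f \<longlongrightarrow> powser jcoeff 0 - angular_integral 0 0 / pi) (at_right 0)"
      unfolding f_def by (intro tendsto_intros lJ angular_integral_limits) auto
    then show "(f \<longlongrightarrow> 0) (at_right 0)" by (simp add: powser_0 b0)
    have "((\<lambda>t. t * (t / 2 * powser (diffs jcoeff) (t\<^sup>2 / 4)) - t * angular_integral1 0 t / pi) \<longlongrightarrow> 0 - 0 / pi) (at_right 0)"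
      by (intro tendsto_diff tendsto_divide tendsto_const lJ angular_integral_limits) auto
    then show "((\<lambda>t. t * f1 t) \<longlongrightarrow> 0) (at_right 0)" by (simp add: f1_def right_diff_distrib)
  qed (rule assms)
  then show ?thesis by (simp add: f_def bessel_J0_powser)
qed

text \<open>
  With \<open>L\<close> the logarithmic factor, \<open>L J + Q\<close> (half of \<open>pi Y\<^sub>0\<close>) solves the homogeneous equation, while
  the trigonometric integral has right-hand side \<open>2\<close> and the Laplace integral \<open>1\<close>. Hence \<open>f\<close> below is a
  homogeneous solution. It vanishes at \<open>0\<close> because the logarithms of \<open>L\<close> and of the Laplace integral cancel
  together with their constants.
\<close>

lemma bessel_Y0_integral:
  assumes "t > 0"
  shows "bessel_Y0 t = angular_integral (- (pi / 2)) t / pi - 2 / pi * struve_laplace t"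
proof -
  define a where "a = - (pi / 2)"
  define L where "L t = ln (t / 2) + euler_mascheroni" for t :: real
  define J where "J t = powser jcoeff (t\<^sup>2 / 4)" for t
  define J1 where "J1 t = t / 2 * powser (diffs jcoeff) (t\<^sup>2 / 4)" for t
  define J2 where "J2 t = powser (diffs jcoeff) (t\<^sup>2 / 4) / 2 + t\<^sup>2 / 4 * powser (diffs (diffs jcoeff)) (t\<^sup>2 / 4)" for t
  define Q where "Q t = powser ycoeff (t\<^sup>2 / 4)" for t
  define Q1 where "Q1 t = t / 2 * powser (diffs ycoeff) (t\<^sup>2 / 4)" for t
  define Q2 where "Q2 t = powser (diffs ycoeff) (t\<^sup>2 / 4) / 2 + t\<^sup>2 / 4 * powser (diffs (diffs ycoeff)) (t\<^sup>2 / 4)" for t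
  have dJ: "(J has_real_derivative J1 t) (at t)" "(J1 has_real_derivative J2 t) (at t)" for t
    unfolding J_def J1_def J2_def by (rule powser_lift_deriv[OF powser_derivs(1,2)])+
  have dQ: "(Q has_real_derivative Q1 t) (at t)" "(Q1 has_real_derivative Q2 t) (at t)" for t
    unfolding Q_def Q1_def Q2_def by (rule powser_lift_deriv[OF powser_derivs(3,4)])+
  have oJ: "t * J2 t + J1 t + t * J t = 0" for t
    unfolding J_def J1_def J2_def bessel_substitution powser_j_ode by simp
  have oQ: "t * Q2 t + Q1 t + t * Q t = - 2 * J1 t" for t
    unfolding Q_def Q1_def Q2_def bessel_substitution powser_y_ode J1_def by simp
  have oB: "t * angular_integral2 a t + angular_integral1 a t + t * angular_integral a t = 2" for t
    unfolding angular_integral_ode by (simp add: a_def)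
  have dL: "(L has_real_derivative 1 / t) (at t)" if "t > 0" for t
    unfolding L_def using that by (auto intro!: derivative_eq_intros)
  define f where "f t = L t * J t + Q t - angular_integral a t / 2 + struve_laplace t" for t
  define f1 where "f1 t = (1 / t * J t + J1 t * L t) + Q1 t - angular_integral1 a t / 2 + struve_laplace1 t" for t
  define f2 where "f2 t = ((- (1 / t\<^sup>2) * J t + J1 t * (1 / t)) + (J2 t * L t + 1 / t * J1 t)) + Q2 t - angular_integral2 a t / 2 + struve_laplace2 t" for t
  have "f t = 0"
  proof (rule bessel_ode_unique[of f f1 f2])
    fix t :: real assume t: "t > 0"
    show "(f has_real_derivative f1 t) (at t)"
      unfolding f_def f1_def by (intro DERIV_add DERIV_diff DERIV_cdivide DERIV_mult dJ dQ dL angular_integral_deriv struve_laplace_derivs t)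
    have "((\<lambda>t. 1 / t) has_real_derivative - (1 / t\<^sup>2)) (at t)"
      using t by (auto intro!: derivative_eq_intros simp: power2_eq_square)
    then show "(f1 has_real_derivative f2 t) (at t)"
      unfolding f1_def f2_def by (intro DERIV_add DERIV_diff DERIV_cdivide DERIV_mult dJ dQ dL angular_integral_deriv struve_laplace_derivs t)
    have "t * f2 t + f1 t + t * f t = 2 * J1 t + L t * (t * J2 t + J1 t + t * J t) + (t * Q2 t + Q1 t + t * Q t)
       - (t * angular_integral2 a t + angular_integral1 a t + t * angular_integral a t) / 2 + (t * struve_laplace2 t + struve_laplace1 t + t * struve_laplace t)"
    proof -
      have alg: "t * (((- (r * r) * j + j1 * r) + (j2 * l + r * j1)) + q2 - b2 + s2) + ((r * j + j1 * l) + q1 - b1 + s1) + t * (l * j + q - b + s)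
         = 2 * j1 + l * (t * j2 + j1 + t * j) + (t * q2 + q1 + t * q) - (t * b2 + b1 + t * b) + (t * s2 + s1 + t * s)"
        if "t * r = 1" for r j j1 j2 l q q1 q2 b b1 b2 s s1 s2 :: real
        using that by algebra
      have "1 / t\<^sup>2 = 1 / t * (1 / t)" "t * (1 / t) = 1" using t by (simp_all add: power2_eq_square)
      note e = alg[OF this(2), of "J t" "J1 t" "J2 t" "L t" "Q2 t" "angular_integral2 a t / 2" "struve_laplace2 t" "Q1 t" "angular_integral1 a t / 2" "struve_laplace1 t" "Q t" "angular_integral a t / 2" "struve_laplace t", folded this(1)]
      have h: "(t * x2 + x1 + t * x) / 2 = t * (x2 / 2) + x1 / 2 + t * (x / 2)" for x x1 x2 :: real
        by (simp add: add_divide_distrib)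
      show ?thesis unfolding f_def f1_def f2_def h by (rule e)
    qed
    then show "t * f2 t + f1 t + t * f t = 0"
      unfolding oJ oQ oB struve_laplace_ode[OF t] by simp
  next
    have lJ: "(J \<longlongrightarrow> 1) (at_right 0)" "((\<lambda>t. (J t - 1) / t) \<longlongrightarrow> 0) (at_right 0)"
      using powser_lift_limits[OF powser_derivs(1,2)] by (simp_all add: J_def[abs_def] powser_0)
    have lQ: "(Q \<longlongrightarrow> 0) (at_right 0)" "((\<lambda>t. t * Q1 t) \<longlongrightarrow> 0) (at_right 0)"
      using powser_lift_limits[OF powser_derivs(3,4)] by (simp_all add: Q_def[abs_def] Q1_def powser_0)
    have "((\<lambda>t. (t * L t) * ((J t - 1) / t) + Q t - angular_integral a t / 2 + ((struve_laplace t + ln t) - (ln 2 - euler_mascheroni)))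
        \<longlongrightarrow> 0 * 0 + 0 - angular_integral a 0 / 2 + ((ln 2 - euler_mascheroni) - (ln 2 - euler_mascheroni))) (at_right 0)"
    proof (intro tendsto_intros lJ lQ angular_integral_limits struve_laplace_limit)
      show "((\<lambda>t. t * L t) \<longlongrightarrow> 0) (at_right 0)" unfolding L_def by real_asymp
    qed auto
    moreover have "angular_integral a 0 = 0" by (simp add: angular_integral_def a_def)
    ultimately have "((\<lambda>t. (t * L t) * ((J t - 1) / t) + Q t - angular_integral a t / 2 + ((struve_laplace t + ln t) - (ln 2 - euler_mascheroni))) \<longlongrightarrow> 0) (at_right 0)" by simp
    then show "(f \<longlongrightarrow> 0) (at_right 0)"
    proof (rule Lim_transform_eventually)
      show "\<forall>\<^sub>F t in at_right 0. (t * L t) * ((J t - 1) / t) + Q t - angular_integral a t / 2 + ((struve_laplace t + ln t) - (ln 2 - euler_mascheroni)) = f t"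
        unfolding eventually_at_right_field
      proof (intro exI[of _ 1] conjI allI impI)
        fix t :: real assume "t > 0"
        show "(t * L t) * ((J t - 1) / t) + Q t - angular_integral a t / 2 + ((struve_laplace t + ln t) - (ln 2 - euler_mascheroni)) = f t"
        proof -
          have "(t * L t) * ((J t - 1) / t) = L t * J t - L t" using \<open>t > 0\<close> by (simp add: field_simps)
          moreover have "L t = ln t - ln 2 + euler_mascheroni" using \<open>t > 0\<close> by (simp add: L_def ln_div)
          ultimately show ?thesis by (simp add: f_def)
        qed
      qed auto
    qed
    have "((\<lambda>t. J t + (t * L t) * (t / 2) * powser (diffs jcoeff) (t\<^sup>2 / 4) + t * Q1 t - t * angular_integral1 a t / 2 + t * struve_laplace1 t)
       \<longlongrightarrow> 1 + 0 * powser (diffs jcoeff) 0 + 0 - 0 / 2 + -1) (at_right 0)"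
    proof (intro tendsto_add tendsto_diff tendsto_divide tendsto_const lJ lQ angular_integral_limits struve_laplace1_limit)
      show "((\<lambda>t. (t * L t) * (t / 2) * powser (diffs jcoeff) (t\<^sup>2 / 4)) \<longlongrightarrow> 0 * powser (diffs jcoeff) 0) (at_right 0)"
      proof (rule tendsto_mult[OF _ powser_lift_limits(4)[OF powser_derivs(1,2)]])
        show "((\<lambda>t. (t * L t) * (t / 2)) \<longlongrightarrow> 0) (at_right 0)" unfolding L_def by real_asymp
      qed
    qed auto
    then have "((\<lambda>t. J t + (t * L t) * (t / 2) * powser (diffs jcoeff) (t\<^sup>2 / 4) + t * Q1 t - t * angular_integral1 a t / 2 + t * struve_laplace1 t) \<longlongrightarrow> 0) (at_right 0)" by simp
    then show "((\<lambda>t. t * f1 t) \<longlongrightarrow> 0) (at_right 0)"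
    proof (rule Lim_transform_eventually)
      show "\<forall>\<^sub>F t in at_right 0. J t + (t * L t) * (t / 2) * powser (diffs jcoeff) (t\<^sup>2 / 4) + t * Q1 t - t * angular_integral1 a t / 2 + t * struve_laplace1 t = t * f1 t"
        unfolding eventually_at_right_field
      proof (intro exI[of _ 1] conjI allI impI)
        fix t :: real assume "t > 0"
        then show "J t + (t * L t) * (t / 2) * powser (diffs jcoeff) (t\<^sup>2 / 4) + t * Q1 t - t * angular_integral1 a t / 2 + t * struve_laplace1 t = t * f1 t"
          by (simp add: f1_def J1_def algebra_simps)
      qed auto
    qed
  qed (rule assms)
  then have "L t * J t + Q t = angular_integral a t / 2 - struve_laplace t" by (simp add: f_def)
  moreover have "bessel_Y0 t = 2 / pi * (L t * J t + Q t)"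
    unfolding bessel_Y0_powser L_def J_def Q_def by simp
  ultimately have "bessel_Y0 t = 2 / pi * (angular_integral a t / 2 - struve_laplace t)" by (simp only:)
  then show ?thesis unfolding a_def by (simp add: right_diff_distrib)
qed

lemma hankel1_0_integral:
  assumes "t > 0"
  shows "hankel1_0 t = (integral {0..pi} (\<lambda>\<phi>. cis (t * sin \<phi>)) - 2 * \<i> * of_real (struve_laplace t)) / of_real pi"
proof -
  have i: "(\<lambda>\<phi>. cis (t * sin \<phi>)) integrable_on {0..pi}" by (intro integrable_continuous_real continuous_intros)
  have "Re (integral {0..pi} (\<lambda>\<phi>. cis (t * sin \<phi>))) = angular_integral 0 t"
    unfolding angular_integral_def using integral_linear[OF i bounded_linear_Re] by (simp add: comp_def)
  moreover have "Im (integral {0..pi} (\<lambda>\<phi>. cis (t * sin \<phi>))) = angular_integral (- (pi / 2)) t"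
    unfolding angular_integral_def using integral_linear[OF i bounded_linear_Im] by (simp add: comp_def cos_diff)
  ultimately have "integral {0..pi} (\<lambda>\<phi>. cis (t * sin \<phi>)) = of_real (angular_integral 0 t) + \<i> * of_real (angular_integral (- (pi / 2)) t)"
    by (simp add: complex_eq_iff)
  then show ?thesis
    unfolding hankel1_0_def bessel_J0_integral[OF assms] bessel_Y0_integral[OF assms]
    by (simp add: complex_eq_iff Re_divide_of_real Im_divide_of_real diff_divide_distrib)
qed

lemma saddle_terms_0: "saddle_terms a 0 l = a * (1 - \<i>) * of_real (sqrt pi / 2 * l powr (-1/2))"
proof -
  have "(2::real) powr (-1/2) * sqrt (pi / 2) = sqrt pi / 2"
    by (simp add: powr_minus powr_half_sqrt real_sqrt_divide field_simps)
  moreover have "a * of_real (x * z) * (of_real y * (1 - \<i>)) = a * (1 - \<i>) * of_real (x * y * z)" for x y z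
    by simp
  ultimately show ?thesis by (simp only: saddle_terms_def fresnel_tail_half_0 mult_zero_left add_0_right)
qed

text \<open>
  In \<open>hankel1_0_integral\<close> the Laplace integral is at most \<open>1/t\<close>, and the other term has its only
  stationary point at \<open>\<pi>/2\<close>.
\<close>

lemma hankel1_0_asymptotics:
  obtains C where "\<And>t. t \<ge> 1 \<Longrightarrow> norm (hankel1_0 t - cis t * (1 - \<i>) * of_real (1 / sqrt pi * t powr (-1/2))) \<le> C * t powr (-7/8)"
proof -
  have "saddle_expansion (pi / 2) (\<lambda>u. (1 + 0 * ssq (1 * (sin u * sin (u - 1)))) * exp (0 * ssq (1 * (sin u * sin (u - 1)))))
      1 ((0 + 0 * 1) * ssq (- (1 * sin 1)))"
    \<comment> \<open>A constant amplitude: with \<open>\<beta> = 0\<close> and \<open>\<kappa> = 0\<close> the square root is switched off, and its position \<open>p = 1\<close> is arbitrary.\<close>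
    by (rule stationary_phase_square_root[where \<alpha>' = "\<lambda>_. 0" and \<beta>' = "\<lambda>_. 0"])
      (use pi_gt3 in \<open>auto\<close>)
  then have e: "saddle_expansion (pi / 2) (\<lambda>u. 1) 1 0" "saddle_expansion (pi - pi / 2) (\<lambda>u. 1) 1 0" by simp_all
  obtain C where C: "\<And>l. l \<ge> 1 \<Longrightarrow>
      norm (integral {0..pi} (\<lambda>\<phi>. 1 * cis (l * cos (\<phi> - pi / 2))) - cis l * saddle_terms (1 + 1) (0 + 0) l) \<le> C * l powr (-7/8)"
    using two_sided_expansion[of "\<lambda>_. 1" "pi / 2" 1 0 1 0] e by auto
  show thesis
  proof (rule that[of "1 / pi * C + 2 / pi"])
    fix t :: real assume t: "t \<ge> 1"
    define I where "I = integral {0..pi} (\<lambda>\<phi>. cis (t * sin \<phi>))"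
    have I: "norm (I - cis t * ((1 - \<i>) * of_real (sqrt pi * t powr (-1/2)))) \<le> C * t powr (-7/8)"
    proof -
      have "saddle_terms (1 + 1) (0 + 0) t = (1 - \<i>) * of_real (sqrt pi * t powr (-1/2))"
        by (simp add: saddle_terms_0 complex_eq_iff)
      moreover have "(\<lambda>\<phi>. 1 * cis (t * cos (\<phi> - pi / 2))) = (\<lambda>\<phi>. cis (t * sin \<phi>))" by (simp add: cos_diff)
      ultimately show ?thesis using C[OF t] by (simp only: I_def)
    qed
    have m: "sqrt pi * t powr (-1/2) = pi * (1 / sqrt pi * t powr (-1/2))"
    proof -
      have "pi * (1 / sqrt pi * x) = (pi / sqrt pi) * x" for x by simp
      then show ?thesis by (simp only: real_div_sqrt pi_ge_zero)
    qed
    have eq: "hankel1_0 t - cis t * (1 - \<i>) * of_real (1 / sqrt pi * t powr (-1/2))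
       = of_real (1 / pi) * (I - cis t * ((1 - \<i>) * of_real (sqrt pi * t powr (-1/2)))) - \<i> * of_real (2 / pi * struve_laplace t)"
    proof -
      have "(I - 2 * \<i> * s) / of_real pi - c * z * x
          = of_real (1 / pi) * (I - c * (z * (of_real pi * x))) - \<i> * (of_real (2 / pi) * s)" for c z s x :: complex
        by (simp add: field_simps)
      then show ?thesis using t unfolding m of_real_mult[of pi] of_real_mult[of "2 / pi" "struve_laplace t"]
        by (subst hankel1_0_integral) (simp_all only: I_def)
    qed
    have "norm (of_real (1 / pi) * z) = 1 / pi * norm z" for z :: complex by (simp add: norm_mult norm_divide)
    then have "norm (of_real (1 / pi) * (I - cis t * ((1 - \<i>) * of_real (sqrt pi * t powr (-1/2))))) \<le> 1 / pi * (C * t powr (-7/8))"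
      using mult_left_mono[OF I, of "1 / pi"] by simp
    moreover have "norm (\<i> * of_real (2 / pi * struve_laplace t)) \<le> 2 / pi * t powr (-7/8)"
    proof -
      have "\<bar>struve_laplace t\<bar> \<le> t powr (-1)" using struve_laplace_bound[of t] t by (simp add: powr_minus divide_inverse)
      also have "\<dots> \<le> t powr (-7/8)" using t by (intro powr_mono) auto
      finally have "2 / pi * \<bar>struve_laplace t\<bar> \<le> 2 / pi * t powr (-7/8)" by (intro mult_left_mono) auto
      then show ?thesis unfolding norm_mult norm_of_real by (simp add: abs_mult)
    qed
    ultimately show "norm (hankel1_0 t - cis t * (1 - \<i>) * of_real (1 / sqrt pi * t powr (-1/2))) \<le> (1 / pi * C + 2 / pi) * t powr (-7/8)"
      unfolding eq distrib_right by (intro order_trans[OF norm_triangle_ineq4] add_mono) auto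
  qed
qed

section \<open>Evanescent and propagating waves\<close>

lemma integrable_lebesgue_imp_lborel:
  fixes f :: "real \<Rightarrow> 'a::euclidean_space"
  assumes [measurable]: "f \<in> borel_measurable borel" "A \<in> sets borel" and f: "f absolutely_integrable_on A"
  shows "set_integrable lborel A f"
proof -
  have "integrable (completion lborel) (\<lambda>x. indicator A x *\<^sub>R f x)"
    using f by (simp add: set_integrable_def)
  then show ?thesis
    unfolding set_integrable_def by (subst (asm) integrable_completion) auto
qed

text \<open>
  With the additional factor \<open>\<xi> / k \<ge> 1\<close> the evanescent integrand has an elementary primitive.
\<close>

lemma evanescent_integral:
  assumes k: "k > 0" and X: "X > 0"
  shows "has_bochner_integral lborel (\<lambda>\<xi>. indicator {k<..} \<xi> * (exp (- (sqrt (\<xi>\<^sup>2 - k\<^sup>2) * X)) * \<xi> / (k * sqrt (\<xi>\<^sup>2 - k\<^sup>2)))) (1 / (k * X))"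
proof -
  define f where "f \<xi> = exp (- (sqrt (\<xi>\<^sup>2 - k\<^sup>2) * X)) * \<xi> / (k * sqrt (\<xi>\<^sup>2 - k\<^sup>2))" for \<xi>
  define F where "F \<xi> = - (exp (- (sqrt (\<xi>\<^sup>2 - k\<^sup>2) * X)) / (k * X))" for \<xi>
  have pos: "\<xi>\<^sup>2 - k\<^sup>2 > 0" if "\<xi> > k" for \<xi>
    using that k by (simp add: power_strict_mono)
  have F_deriv: "(F has_real_derivative f \<xi>) (at \<xi>)" if "\<xi> > k" for \<xi>
    unfolding F_def f_def using pos[OF that] k X by (auto intro!: derivative_eq_intros simp: field_simps)
  have fc: "isCont f \<xi>" if "ereal k < ereal \<xi>" for \<xi>
    unfolding f_def using that pos[of \<xi>] k by (intro continuous_intros) auto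
  have f0: "AE x in lborel. ereal k < ereal x \<longrightarrow> ereal x < \<infinity> \<longrightarrow> 0 \<le> f x"
    using k pos by (auto simp: f_def intro!: AE_I2 divide_nonneg_pos mult_nonneg_nonneg)
  have "isCont F k" unfolding F_def using k X by (intro continuous_intros) auto
  then have "(F \<longlongrightarrow> F k) (at_right k)" by (simp add: isCont_def filterlim_at_split)
  then have l1: "((F \<circ> real_of_ereal) \<longlongrightarrow> - (1 / (k * X))) (at_right (ereal k))"
    by (simp add: ereal_tendsto_simps F_def)
  have "(F \<longlongrightarrow> 0) at_top" unfolding F_def using k X by real_asymp
  then have l2: "((F \<circ> real_of_ereal) \<longlongrightarrow> 0) (at_left \<infinity>)" by (simp add: ereal_tendsto_simps)
  have "set_integrable lborel (einterval k \<infinity>) f"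
    by (rule interval_integral_FTC_nonneg(1)[of k \<infinity> F f, OF _ _ _ f0 l1 l2]) (use F_deriv fc in auto)
  moreover have "(LBINT x=k..\<infinity>. f x) = 0 - (- (1 / (k * X)))"
    by (rule interval_integral_FTC_nonneg(2)[of k \<infinity> F f, OF _ _ _ f0 l1 l2]) (use F_deriv fc in auto)
  moreover have "einterval (ereal k) \<infinity> = {k<..}" by (auto simp: einterval_def)
  ultimately show ?thesis
    by (simp add: has_bochner_integral_iff set_integrable_def interval_lebesgue_integral_def set_lebesgue_integral_def f_def)
qed

text \<open>
  The Jacobian \<open>k sin \<phi>\<close> of \<open>\<xi> = k cos \<phi>\<close> cancels the singularity of \<open>f\<close> at \<open>\<bar>\<xi>\<bar> = k\<close>, so \<open>g\<close> is continuous up to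
  the endpoints; the change of variables also yields the integrability of \<open>f\<close>.
\<close>

lemma propagating_integral:
  fixes f g :: "real \<Rightarrow> complex"
  assumes k: "k > 0" and [measurable]: "f \<in> borel_measurable borel"
    and g: "continuous_on {0..pi} g"
    and fg: "\<And>\<phi>. 0 < \<phi> \<Longrightarrow> \<phi> < pi \<Longrightarrow> of_real (k * sin \<phi>) * f (k * cos \<phi>) = g \<phi>"
  shows "set_integrable lborel {-k<..<k} f" "(LINT \<xi>:{-k<..<k}|lborel. f \<xi>) = integral {0..pi} g"
proof -
  define c where "c \<phi> = k * cos \<phi>" for \<phi>
  have img: "c ` {0<..<pi} = {-k<..<k}"
  proof (intro equalityI subsetI)
    fix \<xi> assume "\<xi> \<in> c ` {0<..<pi}"
    then obtain \<phi> where p: "0 < \<phi>" "\<phi> < pi" "\<xi> = k * cos \<phi>" by (auto simp: c_def)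
    have "- 1 < cos \<phi>" "cos \<phi> < 1" using p cos_monotone_0_pi[of 0 \<phi>] cos_monotone_0_pi[of \<phi> pi] by auto
    then have "k * (- 1) < k * cos \<phi>" "k * cos \<phi> < k * 1" using k by (simp_all only: mult_strict_left_mono)
    then show "\<xi> \<in> {-k<..<k}" using p by simp
  next
    fix \<xi> assume "\<xi> \<in> {-k<..<k}"
    then have b: "- 1 < \<xi> / k" "\<xi> / k < 1" using k by (auto simp: field_simps)
    then have "0 < arccos (\<xi> / k)" "arccos (\<xi> / k) < pi" using arccos_lt_bounded by auto
    moreover have "\<xi> = c (arccos (\<xi> / k))" using b k by (simp add: c_def)
    ultimately show "\<xi> \<in> c ` {0<..<pi}" by auto
  qed
  have inj: "inj_on c {0<..<pi}"
    using k cos_inj_pi by (auto simp: inj_on_def c_def)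
  have der: "(c has_field_derivative - (k * sin \<phi>)) (at \<phi> within {0<..<pi})" for \<phi>
    unfolding c_def by (auto intro!: derivative_eq_intros)
  \<comment> \<open>The change of variables theorem is real-valued; it is applied to \<open>Re\<close> and \<open>Im\<close>.\<close>
  have cov: "(\<lambda>\<xi>. p (f \<xi>)) absolutely_integrable_on {-k<..<k} \<and> integral {-k<..<k} (\<lambda>\<xi>. p (f \<xi>)) = integral {0..pi} (\<lambda>\<phi>. p (g \<phi>))"
    if p: "bounded_linear p" for p :: "complex \<Rightarrow> real"
  proof -
    have gc: "continuous_on {0..pi} (\<lambda>\<phi>. p (g \<phi>))"
      using continuous_on_compose2[OF linear_continuous_on[OF p] g] by auto
    have ai: "(\<lambda>\<phi>. p (g \<phi>)) absolutely_integrable_on {0<..<pi}"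
      by (rule set_integrable_subset[OF absolutely_integrable_continuous_real[OF gc]]) auto
    have eq: "\<bar>- (k * sin \<phi>)\<bar> * p (f (c \<phi>)) = p (g \<phi>)" if "\<phi> \<in> {0<..<pi}" for \<phi>
    proof -
      have s: "sin \<phi> > 0" using that by (intro sin_gt_zero) auto
      have "p (g \<phi>) = p ((k * sin \<phi>) *\<^sub>R f (k * cos \<phi>))" using fg[of \<phi>] that by (simp add: scaleR_conv_of_real)
      also have "\<dots> = (k * sin \<phi>) * p (f (k * cos \<phi>))" using linear_simps(5)[OF p] by simp
      finally show ?thesis using s k by (simp add: c_def abs_mult)
    qed
    have "(\<lambda>\<phi>. \<bar>- (k * sin \<phi>)\<bar> * p (f (c \<phi>))) absolutely_integrable_on {0<..<pi}"
      using ai by (rule absolutely_integrable_spike[of _ _ "{}"]) (use eq in auto)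
    moreover have "integral {0<..<pi} (\<lambda>\<phi>. \<bar>- (k * sin \<phi>)\<bar> * p (f (c \<phi>))) = integral {0..pi} (\<lambda>\<phi>. p (g \<phi>))"
    proof -
      have "integral {0<..<pi} (\<lambda>\<phi>. \<bar>- (k * sin \<phi>)\<bar> * p (f (c \<phi>))) = integral {0<..<pi} (\<lambda>\<phi>. p (g \<phi>))"
        using eq by (intro Henstock_Kurzweil_Integration.integral_cong) auto
      then show ?thesis by (simp add: integral_open_interval_real)
    qed
    ultimately show ?thesis
      using has_absolute_integral_change_of_variables_1'[of "{0<..<pi}" c "\<lambda>\<phi>. - (k * sin \<phi>)" "\<lambda>\<xi>. p (f \<xi>)" "integral {0..pi} (\<lambda>\<phi>. p (g \<phi>))"] der inj
      unfolding img by auto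
  qed
  have ai: "f absolutely_integrable_on {-k<..<k}"
    using cov[OF bounded_linear_Re] cov[OF bounded_linear_Im]
    by (subst absolutely_integrable_componentwise_iff) (simp add: Basis_complex_def inner_complex_def)
  then show si: "set_integrable lborel {-k<..<k} f" by (intro integrable_lebesgue_imp_lborel) auto
  have fi: "f integrable_on {-k<..<k}" using ai by (rule set_lebesgue_integral_eq_integral(1))
  have gi: "g integrable_on {0..pi}" using g by (rule integrable_continuous_real)
  have "Re (integral {-k<..<k} f) = Re (integral {0..pi} g)"
    using cov[OF bounded_linear_Re] integral_linear[OF fi bounded_linear_Re] integral_linear[OF gi bounded_linear_Re] by (simp add: comp_def)
  moreover have "Im (integral {-k<..<k} f) = Im (integral {0..pi} g)"
    using cov[OF bounded_linear_Im] integral_linear[OF fi bounded_linear_Im] integral_linear[OF gi bounded_linear_Im] by (simp add: comp_def)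
  ultimately show "(LINT \<xi>:{-k<..<k}|lborel. f \<xi>) = integral {0..pi} g"
    using set_borel_integral_eq_integral(2)[OF si] by (simp add: complex_eq_iff)
qed

text \<open>
  With \<open>X\<close> of the order of \<open>r\<close>, this discards the evanescent waves at the cost of \<open>O(1/r)\<close>.
\<close>

lemma spectral_integral_split:
  fixes f g :: "real \<Rightarrow> complex"
  assumes k: "k > 0" and X: "X > 0" and f [measurable]: "f \<in> borel_measurable borel"
    and out: "\<And>\<xi>. \<bar>\<xi>\<bar> > k \<Longrightarrow> norm (f \<xi>) \<le> exp (- (sqrt (\<xi>\<^sup>2 - k\<^sup>2) * X)) / sqrt (\<xi>\<^sup>2 - k\<^sup>2)"
    and g: "continuous_on {0..pi} g"
    and fg: "\<And>\<phi>. 0 < \<phi> \<Longrightarrow> \<phi> < pi \<Longrightarrow> of_real (k * sin \<phi>) * f (k * cos \<phi>) = g \<phi>"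
  shows "norm ((LINT \<xi>|lborel. f \<xi>) - integral {0..pi} g) \<le> 2 / (k * X)"
proof -
  define w where "w \<xi> = indicator {k<..} \<xi> * (exp (- (sqrt (\<xi>\<^sup>2 - k\<^sup>2) * X)) * \<xi> / (k * sqrt (\<xi>\<^sup>2 - k\<^sup>2)))" for \<xi> :: real
  have w: "has_bochner_integral lborel w (1 / (k * X))" unfolding w_def by (rule evanescent_integral[OF k X])
  have w': "has_bochner_integral lborel (\<lambda>\<xi>. w (- \<xi>)) (1 / (k * X))"
    using lborel_has_bochner_integral_real_affine_iff[of "-1" w "1 / (k * X)" 0] w by simp
  have W: "has_bochner_integral lborel (\<lambda>\<xi>. w \<xi> + w (- \<xi>)) (1 / (k * X) + 1 / (k * X))"
    by (rule has_bochner_integral_add[OF w w'])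
  define fo where "fo \<xi> = indicator {\<xi>. \<bar>\<xi>\<bar> > k} \<xi> *\<^sub>R f \<xi>" for \<xi>
  define fi where "fi \<xi> = indicator {-k<..<k} \<xi> *\<^sub>R f \<xi>" for \<xi>
  have bound: "norm (fo \<xi>) \<le> w \<xi> + w (- \<xi>)" for \<xi>
  proof (cases "\<bar>\<xi>\<bar> > k")
    case True
    have pos: "\<xi>\<^sup>2 - k\<^sup>2 > 0" using True k power_strict_mono[of k "\<bar>\<xi>\<bar>" 2] by simp
    have "norm (f \<xi>) \<le> exp (- (sqrt (\<xi>\<^sup>2 - k\<^sup>2) * X)) / sqrt (\<xi>\<^sup>2 - k\<^sup>2) * 1" using out[OF True] by simp
    also have "\<dots> \<le> exp (- (sqrt (\<xi>\<^sup>2 - k\<^sup>2) * X)) / sqrt (\<xi>\<^sup>2 - k\<^sup>2) * (\<bar>\<xi>\<bar> / k)"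
      using True k pos by (intro mult_left_mono) auto
    also have "\<dots> = w \<bar>\<xi>\<bar>" using True by (simp add: w_def)
    also have "\<dots> \<le> w \<xi> + w (- \<xi>)" using True k by (cases "\<xi> > 0") (auto simp: w_def)
    finally show ?thesis using True by (simp add: fo_def)
  next
    case False
    then show ?thesis using k by (auto simp: fo_def w_def indicator_def)
  qed
  have fo_int: "integrable lborel fo"
  proof (rule Bochner_Integration.integrable_bound)
    show "integrable lborel (\<lambda>\<xi>. w \<xi> + w (- \<xi>))" using W by (simp add: has_bochner_integral_iff)
    show "AE \<xi> in lborel. norm (fo \<xi>) \<le> norm (w \<xi> + w (- \<xi>))"
      using bound by (auto intro!: AE_I2 order_trans[OF _ abs_ge_self])
    show "fo \<in> borel_measurable lborel" unfolding fo_def by measurable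
  qed
  have fi_int: "integrable lborel fi" and fi_val: "(LINT \<xi>|lborel. fi \<xi>) = integral {0..pi} g"
    using propagating_integral[OF k f g fg] unfolding set_integrable_def set_lebesgue_integral_def fi_def by auto
  have "AE \<xi> in lborel. f \<xi> = fi \<xi> + fo \<xi>"
  proof -
    have "AE \<xi> in lborel. \<xi> \<noteq> k \<and> \<xi> \<noteq> - k" using AE_lborel_singleton[of k] AE_lborel_singleton[of "- k"] by auto
    then show ?thesis by eventually_elim (auto simp: fi_def fo_def indicator_def abs_if)
  qed
  then have "(LINT \<xi>|lborel. f \<xi>) = (LINT \<xi>|lborel. fi \<xi> + fo \<xi>)"
    by (intro integral_cong_AE) (auto simp: fi_def fo_def)
  also have "\<dots> = integral {0..pi} g + (LINT \<xi>|lborel. fo \<xi>)"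
    using fi_int fo_int fi_val by simp
  finally have "(LINT \<xi>|lborel. f \<xi>) - integral {0..pi} g = (LINT \<xi>|lborel. fo \<xi>)" by simp
  moreover have "norm (LINT \<xi>|lborel. fo \<xi>) \<le> (LINT \<xi>|lborel. w \<xi> + w (- \<xi>))"
    using W fo_int bound
    by (intro order_trans[OF integral_norm_bound integral_mono]) (auto simp: has_bochner_integral_iff)
  moreover have "(LINT \<xi>|lborel. w \<xi> + w (- \<xi>)) = 2 / (k * X)"
    using W by (simp add: has_bochner_integral_iff)
  ultimately show ?thesis by simp
qed

lemma S_eq_ssq: "a > 0 \<Longrightarrow> S (of_real z) a = ssq (z\<^sup>2 - a\<^sup>2)"
proof -
  assume a: "a > 0"
  have "\<bar>z\<bar> \<ge> a \<longleftrightarrow> z\<^sup>2 - a\<^sup>2 \<ge> 0" using a abs_le_square_iff[of a z] by simp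
  then show ?thesis using S_of_real[OF a, of z] by (auto simp: ssq_pos ssq_neg)
qed

section \<open>From stationary phase to the far field\<close>

lemma powr_minus_half: "x > 0 \<Longrightarrow> x powr (-1/2) = 1 / sqrt x" for x :: real
  using powr_minus[of x "1/2"] powr_half_sqrt[of x] by (simp add: inverse_eq_divide)

definition far_const :: "real \<Rightarrow> complex" where
  "far_const k = exp (\<i> * of_real (pi / 4)) / of_real (sqrt (8 * pi * k))"

lemma far_const_eq:
  assumes "k > 0"
  shows "far_const k = (1 + \<i>) * of_real (1 / (4 * sqrt pi) * k powr (-1/2))"
proof -
  have "exp (\<i> * of_real (pi / 4)) = of_real (1 / sqrt 2) * (1 + \<i>)"
    unfolding cis_conv_exp[symmetric] by (simp add: complex_eq_iff cos_45 sin_45 real_div_sqrt divide_simps)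
  moreover have "1 / sqrt 2 / sqrt (8 * pi * k) = 1 / (4 * sqrt pi) * k powr (-1/2)"
  proof -
    have "sqrt 2 * sqrt (8 * pi * k) = sqrt (16 * (pi * k))" by (simp flip: real_sqrt_mult)
    also have "\<dots> = 4 * sqrt pi * sqrt k" by (simp add: real_sqrt_mult)
    finally have "sqrt 2 * sqrt (8 * pi * k) = 4 * sqrt pi * sqrt k" .
    moreover have "1 / sqrt 2 / sqrt (8 * pi * k) = 1 / (sqrt 2 * sqrt (8 * pi * k))" by simp
    moreover have "k powr (-1/2) = 1 / sqrt k"
      using assms by (rule powr_minus_half)
    ultimately show ?thesis by (simp only:) simp
  qed
  moreover have "of_real x * (1 + \<i>) / of_real y = (1 + \<i>) * of_real (x / y)" for x y
    by simp
  ultimately show ?thesis unfolding far_const_def by (simp only:)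
qed

text \<open>
  The leading saddle term is exactly the far-field amplitude, so that it disappears from the residual
  and leaves no error of order \<open>r\<^sup>-\<^sup>1\<^sup>/\<^sup>2\<close>.
\<close>

lemma far_const_phase:
  assumes "k > 0" "r > 0"
  shows "\<i> / (4 * of_real pi) * saddle_terms (2 * a) 0 (k * r) = a * far_const k / of_real (sqrt r)"
proof -
  have "\<i> / (4 * of_real pi) * (2 * a * (1 - \<i>) * of_real (sqrt pi / 2 * (x * y))) = a * ((1 + \<i>) * of_real (sqrt pi / (4 * pi) * x)) * of_real y" for x y
    by (simp add: field_simps)
  moreover have "sqrt pi / (4 * pi) = 1 / (4 * sqrt pi)"
    using real_div_sqrt[of pi] by (simp add: field_simps)
  ultimately show ?thesis
    unfolding saddle_terms_0 powr_mult far_const_eq[OF assms(1)] powr_minus_half[OF assms(2)] by (simp only:) simp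
qed

lemma saddle_terms_split:
  "saddle_terms a c l = saddle_terms a 0 l + c * (of_real (2 powr (-1/4)) * fresnel_tail (1/4) 0) * of_real (l powr (-3/4))"
  by (simp add: saddle_terms_def)

text \<open>
  The common scheme for both positions of the source. \<open>W\<close> is the residual; \<open>R\<close> collects what the source
  wave contributes beyond its own far field; \<open>f\<close> is the Fourier integrand at distance \<open>r\<close>, with evanescent
  decay over the height \<open>r sin t + h\<close>; \<open>far_const k * A t\<close> is the part of the far field that belongs to the Fourier
  integral. Removing the evanescent waves and the leading saddle term leaves the saddle term of order
  \<open>(k r)\<^sup>-\<^sup>3\<^sup>/\<^sup>4\<close> with a coefficient \<open>M\<close>, and \<open>M \<noteq> 0\<close> by \<open>nz\<close>.
\<close>

lemma critical_residual_limit: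
  fixes A B A' B' W R :: "real \<Rightarrow> complex" and f :: "real \<Rightarrow> real \<Rightarrow> complex" and \<kappa> c0 q :: complex
    and err :: "real \<Rightarrow> real" and h :: real
  assumes t: "0 < t" "t < pi" "t \<noteq> pi / 2" and k: "k > 0" and h: "h \<ge> 0"
    and A: "\<And>\<phi>. (A has_vector_derivative A' \<phi>) (at \<phi>)" "continuous_on UNIV A'"
    and B: "\<And>\<phi>. (B has_vector_derivative B' \<phi>) (at \<phi>)" "continuous_on UNIV B'"
    and nz: "B t + \<kappa> * A t \<noteq> 0"
  defines "g \<equiv> \<lambda>\<phi>. (A \<phi> + B \<phi> * ssq ((cos \<phi>)\<^sup>2 - (cos t)\<^sup>2)) * exp (\<kappa> * ssq ((cos \<phi>)\<^sup>2 - (cos t)\<^sup>2))"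
  assumes W: "\<And>r. r > 0 \<Longrightarrow> W r = R r + c0 * (LINT \<xi>|lborel. f r \<xi>) - cis (k * r) / of_real (sqrt r) * (far_const k * A t)"
    and R: "\<forall>\<^sub>F r in at_top. norm (R r) \<le> err r" and err: "((\<lambda>r. err r * r powr (3/4)) \<longlongrightarrow> 0) at_top"
    and meas: "\<And>r. f r \<in> borel_measurable borel"
    and out: "\<And>r \<xi>. r > 0 \<Longrightarrow> \<bar>\<xi>\<bar> > k \<Longrightarrow> norm (f r \<xi>) \<le> exp (- (sqrt (\<xi>\<^sup>2 - k\<^sup>2) * (r * sin t + h))) / sqrt (\<xi>\<^sup>2 - k\<^sup>2)"
    and fg: "\<And>r \<phi>. r > 0 \<Longrightarrow> 0 < \<phi> \<Longrightarrow> \<phi> < pi \<Longrightarrow> of_real (k * sin \<phi>) * f r (k * cos \<phi>) = q * (g \<phi> * cis (k * r * cos (\<phi> - t)))"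
    and c0q: "c0 * q = \<i> / (4 * of_real pi)"
  shows "\<exists>L::real. L \<noteq> 0 \<and> ((\<lambda>r. norm (W r) * r powr (3/4)) \<longlongrightarrow> L) at_top"
proof -
  let ?I = "\<lambda>r. integral {0..pi} (\<lambda>\<phi>. g \<phi> * cis (k * r * cos (\<phi> - t)))"
  define c where "c = (B t + \<kappa> * A t) * (of_real (sqrt \<bar>sin (2 * t)\<bar>) * (1 - \<i>))"
  define M where "M = \<i> / (4 * of_real pi) * (c * (of_real (2 powr (-1/4)) * fresnel_tail (1/4) 0))"
  define L where "L = norm M * k powr (-3/4)"
  obtain C where C: "\<And>l. l \<ge> 1 \<Longrightarrow> norm (integral {0..pi} (\<lambda>\<phi>. g \<phi> * cis (l * cos (\<phi> - t))) - cis l * saddle_terms (2 * A t) c l) \<le> C * l powr (-7/8)"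
    using stationary_phase_at_direction[OF t A B, of \<kappa>] unfolding g_def c_def by blast
  have st: "sin t > 0" using t by (intro sin_gt_zero)
  have s2: "sin (2 * t) \<noteq> 0"
  proof (cases "t < pi / 2")
    case True
    then show ?thesis using t sin_gt_zero[of "2 * t"] by auto
  next
    case False
    then have "0 < sin (2 * t - pi)" using t by (intro sin_gt_zero) auto
    then show ?thesis by (simp add: sin_diff)
  qed
  have "fresnel_tail (1/4) 0 \<noteq> 0" using Im_fresnel_tail_0_neg[of "1/4"] by auto
  moreover have "1 - \<i> \<noteq> 0" by (simp add: complex_eq_iff)
  ultimately have "M \<noteq> 0" using nz s2 by (simp add: M_def c_def)
  then have "L \<noteq> 0" using k by (simp add: L_def)
  have "continuous_on UNIV A" "continuous_on UNIV B"
    by (intro continuous_at_imp_continuous_on ballI has_vector_derivative_continuous[OF A(1)] has_vector_derivative_continuous[OF B(1)])+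
  then have g_cont: "continuous_on {0..pi} g"
    unfolding g_def by (intro continuous_intros) (auto intro: continuous_on_subset)
  define E where "E r = err r + norm c0 * (2 / (k * (r * sin t + h))) + 1 / (4 * pi) * (C * (k * r) powr (-7/8))" for r
  have main: "norm (W r - cis (k * r) * (M * of_real ((k * r) powr (-3/4)))) \<le> E r" if r: "norm (R r) \<le> err r" "1 / k \<le> r" "r > 0" for r
  proof -
    have kr: "k * r \<ge> 1" using r k by (simp add: field_simps)
    have X: "r * sin t + h > 0" using r st h by (simp add: add_pos_nonneg)
    have split: "norm ((LINT \<xi>|lborel. f r \<xi>) - q * ?I r) \<le> 2 / (k * (r * sin t + h))"
    proof -
      have "norm ((LINT \<xi>|lborel. f r \<xi>) - integral {0..pi} (\<lambda>\<phi>. q * (g \<phi> * cis (k * r * cos (\<phi> - t))))) \<le> 2 / (k * (r * sin t + h))"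
        by (rule spectral_integral_split[OF k X meas out _ fg]) (use r in \<open>auto intro!: continuous_intros g_cont\<close>)
      then show ?thesis by simp
    qed
    have lead: "\<i> / (4 * of_real pi) * (cis (k * r) * saddle_terms (2 * A t) 0 (k * r)) = cis (k * r) / of_real (sqrt r) * (far_const k * A t)"
      using arg_cong[OF far_const_phase[OF k r(3), of "A t"], of "\<lambda>z. cis (k * r) * z"] by (simp add: mult_ac)
    have "R' + c0 * z - F - cis' * (\<i> / (4 * of_real pi) * m * x) = R' + c0 * (z - q * y) + \<i> / (4 * of_real pi) * (y - cis' * (s + m * x))"
      if "\<i> / (4 * of_real pi) * (cis' * s) = F" for R' z F cis' m x y s :: complex
    proof -
      have "c0 * (q * y) = \<i> / (4 * of_real pi) * y" using c0q by (simp flip: mult.assoc)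
      then show ?thesis unfolding that[symmetric] right_diff_distrib distrib_left by simp
    qed
    from this[OF lead] have eq: "W r - cis (k * r) * (M * of_real ((k * r) powr (-3/4)))
      = R r + c0 * ((LINT \<xi>|lborel. f r \<xi>) - q * ?I r) + \<i> / (4 * of_real pi) * (?I r - cis (k * r) * saddle_terms (2 * A t) c (k * r))"
      unfolding W[OF r(3)] M_def saddle_terms_split[of "2 * A t" c] .
    have "norm (\<i> / (4 * of_real pi) * z) = 1 / (4 * pi) * norm z" for z by (simp add: norm_mult norm_divide)
    then have "norm (\<i> / (4 * of_real pi) * (?I r - cis (k * r) * saddle_terms (2 * A t) c (k * r))) \<le> 1 / (4 * pi) * (C * (k * r) powr (-7/8))"
      using mult_left_mono[OF C[OF kr], of "1 / (4 * pi)"] by simp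
    moreover have "norm (c0 * ((LINT \<xi>|lborel. f r \<xi>) - q * ?I r)) \<le> norm c0 * (2 / (k * (r * sin t + h)))"
      unfolding norm_mult by (intro mult_left_mono split) auto
    ultimately show ?thesis unfolding eq E_def by (intro order_trans[OF norm_triangle_ineq] add_mono r(1))
  qed
  have "((\<lambda>r. norm (W r) * r powr (3/4)) \<longlongrightarrow> L) at_top"
  proof (rule LIM_zero_cancel, rule Lim_null_comparison)
    have l: "((\<lambda>r. 2 / (k * (r * sin t + h)) * r powr (3/4)) \<longlongrightarrow> 0) at_top" "((\<lambda>r. r powr (-1/8)) \<longlongrightarrow> (0::real)) at_top"
      using k st by real_asymp+
    have "((\<lambda>r. err r * r powr (3/4) + norm c0 * (2 / (k * (r * sin t + h)) * r powr (3/4)) + 1 / (4 * pi) * C * k powr (-7/8) * r powr (-1/8))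
        \<longlongrightarrow> 0 + norm c0 * 0 + 1 / (4 * pi) * C * k powr (-7/8) * 0) at_top"
      by (intro tendsto_intros err l)
    then show "((\<lambda>r. err r * r powr (3/4) + norm c0 * (2 / (k * (r * sin t + h)) * r powr (3/4)) + 1 / (4 * pi) * C * k powr (-7/8) * r powr (-1/8)) \<longlongrightarrow> 0) at_top" by simp
    show "\<forall>\<^sub>F r in at_top. norm (norm (W r) * r powr (3/4) - L)
        \<le> err r * r powr (3/4) + norm c0 * (2 / (k * (r * sin t + h)) * r powr (3/4)) + 1 / (4 * pi) * C * k powr (-7/8) * r powr (-1/8)"
      using R eventually_ge_at_top[of "1 / k"] eventually_gt_at_top[of 0]
    proof eventually_elim
      fix r :: real
      assume r: "norm (R r) \<le> err r" "1 / k \<le> r" "0 < r"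
      have p: "r powr (-3/4) * r powr (3/4) = 1" "r powr (-7/8) * r powr (3/4) = r powr (-1/8)" using r by (simp_all flip: powr_add)
      have "norm (cis (k * r) * (M * of_real ((k * r) powr (-3/4)))) = L * r powr (-3/4)"
        by (simp add: L_def norm_mult powr_mult)
      then have "\<bar>norm (W r) - L * r powr (-3/4)\<bar> \<le> E r"
        using norm_triangle_ineq3[of "W r" "cis (k * r) * (M * of_real ((k * r) powr (-3/4)))"] main[OF r] by linarith
      then have "\<bar>norm (W r) - L * r powr (-3/4)\<bar> * r powr (3/4) \<le> E r * r powr (3/4)" by (intro mult_right_mono) auto
      moreover have "\<bar>norm (W r) - L * r powr (-3/4)\<bar> * r powr (3/4) = \<bar>norm (W r) * r powr (3/4) - L * (r powr (-3/4) * r powr (3/4))\<bar>"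
      proof -
        have "\<bar>x\<bar> * r powr (3/4) = \<bar>x * r powr (3/4)\<bar>" for x by (simp add: abs_mult)
        then show ?thesis by (simp only: left_diff_distrib mult.assoc)
      qed
      moreover have "E r * r powr (3/4) = err r * r powr (3/4) + norm c0 * (2 / (k * (r * sin t + h)) * r powr (3/4)) + 1 / (4 * pi) * C * k powr (-7/8) * (r powr (-7/8) * r powr (3/4))"
        by (simp add: E_def powr_mult distrib_right)
      ultimately show "norm (norm (W r) * r powr (3/4) - L)
        \<le> err r * r powr (3/4) + norm c0 * (2 / (k * (r * sin t + h)) * r powr (3/4)) + 1 / (4 * pi) * C * k powr (-7/8) * r powr (-1/8)"
        unfolding p by simp
    qed
  qed
  with \<open>L \<noteq> 0\<close> show ?thesis by blast
qed

lemma norm_cis_diff_le: "norm (cis a - cis b) \<le> \<bar>a - b\<bar>"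
proof -
  have "cis a - cis b = cis b * (cis (a - b) - 1)" by (simp add: right_diff_distrib cis_mult)
  then have "norm (cis a - cis b) = norm (cis (a - b) - 1)" by (simp add: norm_mult)
  also have "\<dots> = 2 * \<bar>sin ((a - b) / 2)\<bar>"
    using dist_exp_i_1[of "a - b"] by (simp add: dist_norm cis_conv_exp)
  also have "\<dots> \<le> 2 * \<bar>(a - b) / 2\<bar>" using abs_sin_x_le_abs_x[of "(a - b) / 2"] by simp
  finally show ?thesis by simp
qed

text \<open>
  Here \<open>\<rho> r\<close> is the distance from the point at distance \<open>r\<close> in the direction of observation to a source
  with \<open>\<bar>y\<bar>\<^sup>2 = q\<close> whose component in that direction is \<open>\<delta>\<close>. As \<open>\<rho> r = r - \<delta> + O(1/r)\<close>, the phase error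
  is of lower order, and the error is dominated by that of the Hankel asymptotics, \<open>O(r\<^sup>-\<^sup>7\<^sup>/\<^sup>8)\<close>.
\<close>

lemma free_space_far_field:
  fixes \<delta> q k :: real
  assumes k: "k > 0"
  defines "\<rho> \<equiv> \<lambda>r. sqrt (r\<^sup>2 - 2 * r * \<delta> + q)"
  obtains err where "\<forall>\<^sub>F r in at_top. norm (\<i> / 4 * hankel1_0 (k * \<rho> r) - cis (k * r) / of_real (sqrt r) * (far_const k * cis (- (k * \<delta>)))) \<le> err r"
    "((\<lambda>r. err r * r powr (3/4)) \<longlongrightarrow> 0) at_top"
proof -
  obtain C where C: "\<And>t. t \<ge> 1 \<Longrightarrow> norm (hankel1_0 t - cis t * (1 - \<i>) * of_real (1 / sqrt pi * t powr (-1/2))) \<le> C * t powr (-7/8)"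
    using hankel1_0_asymptotics by blast
  define err where "err r = 1 / 4 * (C * (k * \<rho> r) powr (-7/8)) + norm (far_const k) * (\<bar>1 / sqrt (\<rho> r) - 1 / sqrt r\<bar> + k * \<bar>\<rho> r - (r - \<delta>)\<bar> * (1 / sqrt r))" for r
  have l1: "((\<lambda>r. \<rho> r powr (-7/8) * r powr (3/4)) \<longlongrightarrow> 0) at_top" unfolding \<rho>_def by real_asymp
  have l2: "((\<lambda>r. (1 / sqrt (\<rho> r) - 1 / sqrt r) * r powr (3/4)) \<longlongrightarrow> 0) at_top" unfolding \<rho>_def by real_asymp
  have l3: "((\<lambda>r. \<rho> r - (r - \<delta>)) \<longlongrightarrow> 0) at_top" unfolding \<rho>_def by real_asymp
  have l4: "((\<lambda>r. (\<rho> r - (r - \<delta>)) * ((1 / sqrt r) * r powr (3/4))) \<longlongrightarrow> 0) at_top" unfolding \<rho>_def by real_asymp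
  have "((\<lambda>r. 1 / 4 * C * k powr (-7/8) * (\<rho> r powr (-7/8) * r powr (3/4)) + norm (far_const k) * (\<bar>(1 / sqrt (\<rho> r) - 1 / sqrt r) * r powr (3/4)\<bar> + k * \<bar>(\<rho> r - (r - \<delta>)) * ((1 / sqrt r) * r powr (3/4))\<bar>))
     \<longlongrightarrow> 1 / 4 * C * k powr (-7/8) * 0 + norm (far_const k) * (\<bar>0\<bar> + k * \<bar>0\<bar>)) at_top"
    by (intro tendsto_intros l1 l2 l4)
  then have "((\<lambda>r. 1 / 4 * C * k powr (-7/8) * (\<rho> r powr (-7/8) * r powr (3/4)) + norm (far_const k) * (\<bar>(1 / sqrt (\<rho> r) - 1 / sqrt r) * r powr (3/4)\<bar> + k * \<bar>(\<rho> r - (r - \<delta>)) * ((1 / sqrt r) * r powr (3/4))\<bar>)) \<longlongrightarrow> 0) at_top"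
    by simp
  then have lim: "((\<lambda>r. err r * r powr (3/4)) \<longlongrightarrow> 0) at_top"
  proof (rule Lim_transform_eventually)
    show "\<forall>\<^sub>F r in at_top. 1 / 4 * C * k powr (-7/8) * (\<rho> r powr (-7/8) * r powr (3/4)) + norm (far_const k) * (\<bar>(1 / sqrt (\<rho> r) - 1 / sqrt r) * r powr (3/4)\<bar> + k * \<bar>(\<rho> r - (r - \<delta>)) * ((1 / sqrt r) * r powr (3/4))\<bar>) = err r * r powr (3/4)"
      using eventually_gt_at_top[of 0]
    proof eventually_elim
      fix r :: real assume "r > 0"
      have e: "\<bar>x * r powr (3/4)\<bar> = \<bar>x\<bar> * r powr (3/4)" "\<bar>x * ((1 / sqrt r) * r powr (3/4))\<bar> = \<bar>x\<bar> * ((1 / sqrt r) * r powr (3/4))" for x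
        using \<open>r > 0\<close> by (simp_all add: abs_mult)
      show "1 / 4 * C * k powr (-7/8) * (\<rho> r powr (-7/8) * r powr (3/4)) + norm (far_const k) * (\<bar>(1 / sqrt (\<rho> r) - 1 / sqrt r) * r powr (3/4)\<bar> + k * \<bar>(\<rho> r - (r - \<delta>)) * ((1 / sqrt r) * r powr (3/4))\<bar>) = err r * r powr (3/4)"
        unfolding e err_def powr_mult by (simp only: distrib_left distrib_right mult_ac)
    qed
  qed
  have "filterlim (\<lambda>r. k * \<rho> r) at_top at_top" unfolding \<rho>_def using k by real_asymp
  then have "\<forall>\<^sub>F r in at_top. k * \<rho> r \<ge> 1" by (simp add: filterlim_at_top)
  then have "\<forall>\<^sub>F r in at_top. norm (\<i> / 4 * hankel1_0 (k * \<rho> r) - cis (k * r) / of_real (sqrt r) * (far_const k * cis (- (k * \<delta>)))) \<le> err r"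
    using eventually_gt_at_top[of 0]
  proof eventually_elim
    fix r assume kr: "k * \<rho> r \<ge> 1" and r: "(r::real) > 0"
    have \<rho>: "\<rho> r > 0" using kr k zero_less_mult_pos[of k "\<rho> r"] by simp
    have c: "\<i> / 4 * (cis (k * \<rho> r) * (1 - \<i>) * of_real (1 / sqrt pi * (k * \<rho> r) powr (-1/2))) = far_const k * (cis (k * \<rho> r) * of_real (1 / sqrt (\<rho> r)))"
    proof -
      have "\<i> / 4 * (1 - \<i>) = of_real (1 / 4) * (1 + \<i>)" by (simp add: complex_eq_iff)
      moreover have "(k * \<rho> r) powr (-1/2) = k powr (-1/2) * (1 / sqrt (\<rho> r))"
        unfolding powr_mult powr_minus_half[OF \<rho>] ..
      moreover have "\<i> / 4 * (z * (1 - \<i>) * of_real (x * (y * w))) = (\<i> / 4 * (1 - \<i>)) * of_real (x * y) * (z * of_real w)" for z x y w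
        by simp
      moreover have "of_real (1 / 4) * (1 + \<i>) * of_real (1 / sqrt pi * y) * z = (1 + \<i>) * of_real (1 / (4 * sqrt pi) * y) * z" for y z
        by simp
      ultimately show ?thesis unfolding far_const_eq[OF k] by (simp only:)
    qed
    define u where "u = cis (k * \<rho> r) * of_real (1 / sqrt (\<rho> r)) - cis (k * (r - \<delta>)) * of_real (1 / sqrt r)"
    have "cis (k * r) / of_real (sqrt r) * (far_const k * cis (- (k * \<delta>))) = far_const k * ((cis (k * r) * cis (- (k * \<delta>))) * of_real (1 / sqrt r))"
      by simp
    also have "cis (k * r) * cis (- (k * \<delta>)) = cis (k * (r - \<delta>))" by (simp add: cis_mult right_diff_distrib)
    finally have f: "cis (k * r) / of_real (sqrt r) * (far_const k * cis (- (k * \<delta>))) = far_const k * (cis (k * (r - \<delta>)) * of_real (1 / sqrt r))" .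
    have "\<i> / 4 * hankel1_0 (k * \<rho> r) - cis (k * r) / of_real (sqrt r) * (far_const k * cis (- (k * \<delta>)))
       = \<i> / 4 * (hankel1_0 (k * \<rho> r) - cis (k * \<rho> r) * (1 - \<i>) * of_real (1 / sqrt pi * (k * \<rho> r) powr (-1/2))) + far_const k * u"
    proof -
      have "\<i> / 4 * h - F * w = \<i> / 4 * (h - a) + F * (v - w)" if "\<i> / 4 * a = F * v" for h F w a v
        using that by (simp add: right_diff_distrib)
      from this[OF c] show ?thesis unfolding f u_def .
    qed
    then have "norm (\<i> / 4 * hankel1_0 (k * \<rho> r) - cis (k * r) / of_real (sqrt r) * (far_const k * cis (- (k * \<delta>))))
       \<le> norm (\<i> / 4 * (hankel1_0 (k * \<rho> r) - cis (k * \<rho> r) * (1 - \<i>) * of_real (1 / sqrt pi * (k * \<rho> r) powr (-1/2)))) + norm (far_const k * u)"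
      by (simp only: norm_triangle_ineq)
    moreover have "norm (\<i> / 4 * (hankel1_0 (k * \<rho> r) - cis (k * \<rho> r) * (1 - \<i>) * of_real (1 / sqrt pi * (k * \<rho> r) powr (-1/2)))) \<le> 1 / 4 * (C * (k * \<rho> r) powr (-7/8))"
    proof -
      have "norm (\<i> / 4 * z) = 1 / 4 * norm z" for z by (simp add: norm_mult norm_divide)
      then show ?thesis using mult_left_mono[OF C[OF kr], of "1/4"] by (simp only:)
    qed
    moreover have "norm u \<le> \<bar>1 / sqrt (\<rho> r) - 1 / sqrt r\<bar> + k * \<bar>\<rho> r - (r - \<delta>)\<bar> * (1 / sqrt r)"
    proof -
      have "u = cis (k * \<rho> r) * of_real (1 / sqrt (\<rho> r) - 1 / sqrt r) + (cis (k * \<rho> r) - cis (k * (r - \<delta>))) * of_real (1 / sqrt r)"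
        by (simp add: u_def algebra_simps)
      then have "norm u \<le> norm (cis (k * \<rho> r) * of_real (1 / sqrt (\<rho> r) - 1 / sqrt r)) + norm ((cis (k * \<rho> r) - cis (k * (r - \<delta>))) * of_real (1 / sqrt r))"
        by (simp only: norm_triangle_ineq)
      also have "norm (cis (k * \<rho> r) * of_real (1 / sqrt (\<rho> r) - 1 / sqrt r)) = \<bar>1 / sqrt (\<rho> r) - 1 / sqrt r\<bar>"
        unfolding norm_mult norm_of_real by simp
      also have "norm ((cis (k * \<rho> r) - cis (k * (r - \<delta>))) * of_real (1 / sqrt r)) \<le> k * \<bar>\<rho> r - (r - \<delta>)\<bar> * (1 / sqrt r)"
      proof -
        have "norm (cis (k * \<rho> r) - cis (k * (r - \<delta>))) \<le> \<bar>k * \<rho> r - k * (r - \<delta>)\<bar>" by (rule norm_cis_diff_le)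
        also have "\<dots> = k * \<bar>\<rho> r - (r - \<delta>)\<bar>" using k by (simp flip: right_diff_distrib add: abs_mult)
        finally show ?thesis unfolding norm_mult norm_of_real using r by (simp add: mult_right_mono divide_right_mono)
      qed
      finally show ?thesis by simp
    qed
    then have "norm (far_const k * u) \<le> norm (far_const k) * (\<bar>1 / sqrt (\<rho> r) - 1 / sqrt r\<bar> + k * \<bar>\<rho> r - (r - \<delta>)\<bar> * (1 / sqrt r))"
      unfolding norm_mult by (intro mult_left_mono) auto
    ultimately show "norm (\<i> / 4 * hankel1_0 (k * \<rho> r) - cis (k * r) / of_real (sqrt r) * (far_const k * cis (- (k * \<delta>)))) \<le> err r"
      unfolding err_def by linarith
  qed
  then show thesis using lim by (rule that)
qed

section \<open>The two-layered Green function at the critical angle\<close>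

lemma direction_angle:
  assumes "d \<in> circle_upper"
  shows "0 < angle d" "angle d < pi" "d $ 1 = cos (angle d)" "d $ 2 = sin (angle d)"
proof -
  have d2: "d $ 2 > 0" and "norm d = 1" using assms by (auto simp: circle_upper_def upper_half_def)
  then have "(d $ 1)\<^sup>2 + (d $ 2)\<^sup>2 = 1" by (simp add: norm_vec_def L2_set_def sum_2)
  then obtain t where t: "0 \<le> t" "t \<le> pi" "d $ 1 = cos t" "d $ 2 = sin t"
    using sincos_total_pi[of "d $ 2" "d $ 1"] d2 by auto
  then have "0 < t" "t < pi" using d2 by (auto simp: less_le)
  moreover have "d = vector [cos t, sin t]" using t by (simp add: vec_eq_iff forall_2)
  ultimately have "angle d = t" using angle_eqI[of t] by simp
  then show "0 < angle d" "angle d < pi" "d $ 1 = cos (angle d)" "d $ 2 = sin (angle d)"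
    using t \<open>0 < t\<close> \<open>t < pi\<close> by auto
qed

lemma smooth_amplitude:
  fixes a a' p p' :: "real \<Rightarrow> real" and c :: complex
  assumes "\<And>\<phi>. (a has_real_derivative a' \<phi>) (at \<phi>)" "continuous_on UNIV a'"
    and "\<And>\<phi>. (p has_real_derivative p' \<phi>) (at \<phi>)" "continuous_on UNIV p'"
  obtains A' where "\<And>\<phi>. ((\<lambda>\<phi>. c * of_real (a \<phi>) * cis (p \<phi>)) has_vector_derivative A' \<phi>) (at \<phi>)" "continuous_on UNIV A'"
proof
  have cont: "continuous_on UNIV a" "continuous_on UNIV p"
    using assms(1,3) by (auto intro!: continuous_at_imp_continuous_on DERIV_isCont)
  show "continuous_on UNIV (\<lambda>\<phi>. c * of_real (a \<phi>) * (of_real (p' \<phi>) * (\<i> * cis (p \<phi>))) + c * of_real (a' \<phi>) * cis (p \<phi>))"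
    by (intro continuous_intros assms cont)
  fix \<phi>
  have "((\<lambda>x. cis x) has_vector_derivative \<i> * cis (p \<phi>)) (at (p \<phi>))"
  proof -
    have "((\<lambda>z. exp (\<i> * z)) has_field_derivative exp (\<i> * of_real (p \<phi>)) * \<i>) (at (of_real (p \<phi>)))"
      by (auto intro!: derivative_eq_intros)
    from has_vector_derivative_real_field[OF this] show ?thesis by (simp add: cis_conv_exp mult.commute)
  qed
  from vector_diff_chain_at[of p "p' \<phi>" \<phi> cis, OF _ this] assms(3)[of \<phi>]
  have "((\<lambda>\<phi>. cis (p \<phi>)) has_vector_derivative of_real (p' \<phi>) * (\<i> * cis (p \<phi>))) (at \<phi>)"
    by (simp add: comp_def has_real_derivative_iff_has_vector_derivative scaleR_conv_of_real)
  moreover have "((\<lambda>\<phi>. c * of_real (a \<phi>)) has_vector_derivative c * of_real (a' \<phi>)) (at \<phi>)"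
    by (intro has_vector_derivative_mult_right has_vector_derivative_of_real assms)
  ultimately show "((\<lambda>\<phi>. c * of_real (a \<phi>) * cis (p \<phi>)) has_vector_derivative
     c * of_real (a \<phi>) * (of_real (p' \<phi>) * (\<i> * cis (p \<phi>))) + c * of_real (a' \<phi>) * cis (p \<phi>)) (at \<phi>)"
    by (rule has_vector_derivative_mult[rotated])
qed

text \<open>
  Reflection and transmission coefficients are rationalised: with \<open>a = sin \<phi>\<close> and \<open>s\<close> the vertical wave
  number below, \<open>a\<^sup>2 + s\<^sup>2 = 1 - n\<^sup>2\<close> does not depend on \<open>\<phi>\<close>. Thus both become linear in \<open>s\<close> with smooth
  coefficients, the form \<open>A + B * S\<close> that the stationary phase lemma requires.
\<close>

lemma interface_identities:
  fixes a s N :: complex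
  assumes N: "N \<noteq> 0" "a * a + s * s = N"
  shows "1 / (- (\<i> * a) + s) = (\<i> * a + s) / N"
    and "(- (\<i> * a) - s) / (- (\<i> * a) + s) = (a * a - s * s - 2 * \<i> * a * s) / N"
proof -
  have p: "(- (\<i> * a) + s) * (\<i> * a + s) = N" unfolding N(2)[symmetric] by (simp add: algebra_simps)
  then have nz: "- (\<i> * a) + s \<noteq> 0" using N(1) by auto
  show 1: "1 / (- (\<i> * a) + s) = (\<i> * a + s) / N" using nz N(1) p by (simp add: frac_eq_eq mult.commute)
  have "(- (\<i> * a) - s) / (- (\<i> * a) + s) = (- (\<i> * a) - s) * (1 / (- (\<i> * a) + s))" by simp
  also have "\<dots> = ((- (\<i> * a) - s) * (\<i> * a + s)) / N" unfolding 1 by simp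
  also have "(- (\<i> * a) - s) * (\<i> * a + s) = a * a - s * s - 2 * \<i> * a * s" by (simp add: algebra_simps)
  finally show "(- (\<i> * a) - s) / (- (\<i> * a) + s) = (a * a - s * s - 2 * \<i> * a * s) / N" .
qed

context
  fixes kp km t :: real
  assumes km: "km > 0" and kp: "kp > km" and t: "0 < t" "t < pi" and crit: "(cos t)\<^sup>2 = (km / kp)\<^sup>2"
begin

abbreviation (input) vert :: "real \<Rightarrow> complex" where "vert \<phi> \<equiv> ssq ((cos \<phi>)\<^sup>2 - (cos t)\<^sup>2)"

lemma kp_pos: "kp > 0" using km kp by simp

lemma sin_direction_pos: "sin t > 0" "(sin t)\<^sup>2 > 0"
proof -
  show "sin t > 0" using t by (intro sin_gt_zero)
  then show "(sin t)\<^sup>2 > 0" by simp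
qed

lemma t_not_half: "t \<noteq> pi / 2"
proof
  assume h: "t = pi / 2"
  have "cos t = 0" unfolding h by simp
  with crit have "(km / kp)\<^sup>2 = 0" by simp
  then show False using km kp by simp
qed

lemma ssq_inside:
  assumes "0 < \<phi>" "\<phi> < pi"
  shows "ssq ((kp * cos \<phi>)\<^sup>2 - kp\<^sup>2) = of_real kp * (- (\<i> * of_real (sin \<phi>)))"
    and "ssq ((kp * cos \<phi>)\<^sup>2 - km\<^sup>2) = of_real kp * vert \<phi>"
proof -
  have s: "sin \<phi> > 0" using assms by (intro sin_gt_zero)
  have "(kp * cos \<phi>)\<^sup>2 - kp\<^sup>2 = kp\<^sup>2 * - (sin \<phi>)\<^sup>2" by (simp add: power_mult_distrib sin_squared_eq algebra_simps)
  then show "ssq ((kp * cos \<phi>)\<^sup>2 - kp\<^sup>2) = of_real kp * (- (\<i> * of_real (sin \<phi>)))"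
    using kp_pos s by (simp only: ssq_scale less_imp_le) (simp add: ssq_neg)
  have "(kp * cos \<phi>)\<^sup>2 - km\<^sup>2 = kp\<^sup>2 * ((cos \<phi>)\<^sup>2 - (cos t)\<^sup>2)"
    unfolding crit using kp_pos by (simp add: power_mult_distrib power_divide right_diff_distrib)
  then show "ssq ((kp * cos \<phi>)\<^sup>2 - km\<^sup>2) = of_real kp * vert \<phi>"
    using kp_pos by (simp only: ssq_scale less_imp_le)
qed

lemma vert_sum: "complex_of_real (sin \<phi>) * of_real (sin \<phi>) + vert \<phi> * vert \<phi> = of_real ((sin t)\<^sup>2)"
proof -
  have "sin \<phi> * sin \<phi> + ((cos \<phi>)\<^sup>2 - (cos t)\<^sup>2) = (sin t)\<^sup>2"
    using sin_cos_squared_add[of \<phi>] sin_cos_squared_add[of t] by (simp add: power2_eq_square)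
  then show ?thesis unfolding ssq_square of_real_mult[symmetric] of_real_add[symmetric] by (simp only:)
qed

lemma ssq_outside:
  assumes "\<bar>\<xi>\<bar> > kp"
  shows "ssq (\<xi>\<^sup>2 - kp\<^sup>2) = of_real (sqrt (\<xi>\<^sup>2 - kp\<^sup>2))" "ssq (\<xi>\<^sup>2 - km\<^sup>2) = of_real (sqrt (\<xi>\<^sup>2 - km\<^sup>2))"
    "sqrt (\<xi>\<^sup>2 - kp\<^sup>2) > 0" "sqrt (\<xi>\<^sup>2 - km\<^sup>2) > 0"
proof -
  have "kp\<^sup>2 < \<xi>\<^sup>2" using assms kp_pos power_strict_mono[of kp "\<bar>\<xi>\<bar>" 2] by simp
  moreover have "km\<^sup>2 < kp\<^sup>2" using km kp by (intro power_strict_mono) auto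
  ultimately show "ssq (\<xi>\<^sup>2 - kp\<^sup>2) = of_real (sqrt (\<xi>\<^sup>2 - kp\<^sup>2))" "ssq (\<xi>\<^sup>2 - km\<^sup>2) = of_real (sqrt (\<xi>\<^sup>2 - km\<^sup>2))"
    "sqrt (\<xi>\<^sup>2 - kp\<^sup>2) > 0" "sqrt (\<xi>\<^sup>2 - km\<^sup>2) > 0"
    by (auto simp: ssq_pos)
qed

lemma S_crit: "S (of_real (cos t)) (km / kp) = 0"
  using km kp crit by (subst S_eq_ssq) auto

text \<open>
  Total reflection sets in at the critical angle, where the vertical wave number below is zero.
\<close>

lemma refl_crit: "refl_coeff (km / kp) t = 1"
  using sin_direction_pos(1) unfolding refl_coeff_def S_crit by simp

text \<open>
  The Fourier integral is the wave reflected at the interface. Its amplitude is the reflection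
  coefficient times the phase \<open>p\<close> of the image source, without an exponential in \<open>S\<close>, so \<open>\<kappa> = 0\<close>; the
  square root enters through the reflection coefficient alone and \<open>B t \<noteq> 0\<close>.
\<close>

lemma residual_upper:
  assumes y: "y \<in> upper_half" and d: "d $ 1 = cos t" "d $ 2 = sin t" "norm d = 1" "angle d = t"
  shows "\<exists>L::real. L \<noteq> 0 \<and> ((\<lambda>r. norm (green_res kp km (r *\<^sub>R d) y) * r powr (3/4)) \<longlongrightarrow> L) at_top"
proof -
  define p where "p \<phi> = kp * (y $ 2 * sin \<phi> - y $ 1 * cos \<phi>)" for \<phi>
  define a where "a \<phi> = ((sin \<phi>)\<^sup>2 - (cos \<phi>)\<^sup>2 + (cos t)\<^sup>2) / (sin t)\<^sup>2" for \<phi>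
  define b where "b \<phi> = sin \<phi> / (sin t)\<^sup>2" for \<phi>
  define A where "A \<phi> = 1 * complex_of_real (a \<phi>) * cis (p \<phi>)" for \<phi>
  define B where "B \<phi> = (- 2 * \<i>) * complex_of_real (b \<phi>) * cis (p \<phi>)" for \<phi>
  have dp: "(p has_real_derivative kp * (y $ 2 * cos \<phi> + y $ 1 * sin \<phi>)) (at \<phi>)" for \<phi>
    unfolding p_def by (auto intro!: derivative_eq_intros)
  have da: "(a has_real_derivative 4 * sin \<phi> * cos \<phi> / (sin t)\<^sup>2) (at \<phi>)" for \<phi>
    unfolding a_def by (rule DERIV_cdivide) (auto intro!: derivative_eq_intros)
  have db: "(b has_real_derivative cos \<phi> / (sin t)\<^sup>2) (at \<phi>)" for \<phi>
    unfolding b_def by (rule DERIV_cdivide) (auto intro!: derivative_eq_intros)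
  have cont: "continuous_on UNIV (\<lambda>\<phi>. kp * (y $ 2 * cos \<phi> + y $ 1 * sin \<phi>))"
    "continuous_on UNIV (\<lambda>\<phi>. 4 * sin \<phi> * cos \<phi> / (sin t)\<^sup>2)" "continuous_on UNIV (\<lambda>\<phi>. cos \<phi> / (sin t)\<^sup>2)"
    using sin_direction_pos(2) by (auto intro!: continuous_intros)
  obtain A' where A': "\<And>\<phi>. (A has_vector_derivative A' \<phi>) (at \<phi>)" "continuous_on UNIV A'"
    using smooth_amplitude[OF da cont(2) dp cont(1), of 1] unfolding A_def[abs_def] by blast
  obtain B' where B': "\<And>\<phi>. (B has_vector_derivative B' \<phi>) (at \<phi>)" "continuous_on UNIV B'"
    using smooth_amplitude[OF db cont(3) dp cont(1), of "- 2 * \<i>"] unfolding B_def[abs_def] by blast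
  have nz: "B t + 0 * A t \<noteq> 0" using sin_direction_pos by (simp add: B_def b_def)
  have At: "A t = cis (p t)"
    using sin_direction_pos by (simp add: A_def a_def)
  define \<delta> where "\<delta> = cos t * y $ 1 + sin t * y $ 2"
  define q where "q = (y $ 1)\<^sup>2 + (y $ 2)\<^sup>2"
  obtain err where err: "\<forall>\<^sub>F r in at_top. norm (\<i> / 4 * hankel1_0 (kp * sqrt (r\<^sup>2 - 2 * r * \<delta> + q)) - cis (kp * r) / of_real (sqrt r) * (far_const kp * cis (- (kp * \<delta>)))) \<le> err r"
      "((\<lambda>r. err r * r powr (3/4)) \<longlongrightarrow> 0) at_top"
    using free_space_far_field[OF kp_pos, of \<delta> q] by blast
  have y2: "y $ 2 > 0" using y by (simp add: upper_half_def)
  define f where "f r \<xi> = (ssq (\<xi>\<^sup>2 - kp\<^sup>2) - ssq (\<xi>\<^sup>2 - km\<^sup>2)) / (ssq (\<xi>\<^sup>2 - kp\<^sup>2) + ssq (\<xi>\<^sup>2 - km\<^sup>2)) *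
      (exp (- ssq (\<xi>\<^sup>2 - kp\<^sup>2) * of_real (r * sin t + y $ 2)) / ssq (\<xi>\<^sup>2 - kp\<^sup>2)) * exp (\<i> * of_real (\<xi> * (r * cos t - y $ 1)))" for r \<xi> :: real
  let ?H = "\<lambda>r. \<i> / 4 * hankel1_0 (kp * sqrt (r\<^sup>2 - 2 * r * \<delta> + q)) - cis (kp * r) / of_real (sqrt r) * (far_const kp * cis (- (kp * \<delta>)))"
  show ?thesis
  proof (rule critical_residual_limit[OF t t_not_half kp_pos less_imp_le[OF y2] A' B' nz _ err, where f = f and ?c0.0 = "1 / (4 * of_real pi)" and q = \<i>])
    show "green_res kp km (r *\<^sub>R d) y = ?H r + 1 / (4 * of_real pi) * (LINT \<xi>|lborel. f r \<xi>) - cis (kp * r) / of_real (sqrt r) * (far_const kp * A t)" if r: "r > 0" for r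
    proof -
      have nrm: "norm (r *\<^sub>R d) = r" using r d by simp
      have dir: "(r *\<^sub>R d) /\<^sub>R r = d" using r by simp
      have "(norm (r *\<^sub>R d - y))\<^sup>2 = r\<^sup>2 - 2 * r * \<delta> + q"
      proof -
        have "(norm (r *\<^sub>R d - y))\<^sup>2 = (r * cos t - y $ 1)\<^sup>2 + (r * sin t - y $ 2)\<^sup>2"
          by (simp add: norm_vec_def L2_set_def sum_2 d)
        also have "\<dots> = r\<^sup>2 * ((sin t)\<^sup>2 + (cos t)\<^sup>2) - 2 * r * \<delta> + q"
          unfolding \<delta>_def q_def by algebra
        finally show ?thesis by simp
      qed
      then have dist: "norm (r *\<^sub>R d - y) = sqrt (r\<^sup>2 - 2 * r * \<delta> + q)"
        by (metis norm_ge_zero real_sqrt_unique)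
      have green: "green kp km (r *\<^sub>R d) y = \<i> / 4 * hankel1_0 (kp * sqrt (r\<^sup>2 - 2 * r * \<delta> + q)) + 1 / (4 * of_real pi) * (LINT \<xi>|lborel. f r \<xi>)"
        unfolding green_def dist S_eq_ssq[OF kp_pos] S_eq_ssq[OF km] using y r sin_direction_pos(1) y2
        by (simp add: f_def[abs_def] d)
      have "d \<bullet> y = \<delta>" "d \<bullet> reflect y = - (p t / kp)"
        using kp_pos by (simp_all add: inner_vec_def sum_2 d \<delta>_def reflect_def p_def)
      then have far: "green_far kp km d y = far_const kp * (cis (- (kp * \<delta>)) + cis (p t))"
        using y kp_pos unfolding green_far_def Let_def d(4) refl_crit far_const_def cis_conv_exp by simp
      show ?thesis
        unfolding green_res_def nrm dir green far At cis_conv_exp[of "kp * r"] by (simp add: distrib_left)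
    qed
    show "f r \<in> borel_measurable borel" for r unfolding f_def by measurable
    show "norm (f r \<xi>) \<le> exp (- (sqrt (\<xi>\<^sup>2 - kp\<^sup>2) * (r * sin t + y $ 2))) / sqrt (\<xi>\<^sup>2 - kp\<^sup>2)" if "r > 0" "\<bar>\<xi>\<bar> > kp" for r \<xi>
    proof -
      note o = ssq_outside[OF that(2)]
      define u v where "u = sqrt (\<xi>\<^sup>2 - kp\<^sup>2)" and "v = sqrt (\<xi>\<^sup>2 - km\<^sup>2)"
      have uv: "u > 0" "v > 0" using o by (simp_all add: u_def v_def)
      have "f r \<xi> = of_real ((u - v) / (u + v) * (exp (- (u * (r * sin t + y $ 2))) / u)) * exp (\<i> * of_real (\<xi> * (r * cos t - y $ 1)))"
        unfolding f_def o(1,2) u_def v_def by (simp flip: exp_of_real)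
      then have "norm (f r \<xi>) = \<bar>(u - v) / (u + v)\<bar> * (exp (- (u * (r * sin t + y $ 2))) / u)"
        using uv by (simp only: norm_mult norm_of_real norm_exp_i_times) (simp add: abs_mult)
      also have "\<dots> \<le> 1 * (exp (- (u * (r * sin t + y $ 2))) / u)" using uv by (intro mult_right_mono) (auto simp: divide_le_eq)
      finally show ?thesis by (simp add: u_def)
    qed
    show "of_real (kp * sin \<phi>) * f r (kp * cos \<phi>) = \<i> * ((A \<phi> + B \<phi> * vert \<phi>) * exp (0 * vert \<phi>) * cis (kp * r * cos (\<phi> - t)))" if "r > 0" and \<phi>: "0 < \<phi>" "\<phi> < pi" for r \<phi>
    proof -
      define s where "s = vert \<phi>"
      define e where "e = complex_of_real (sin \<phi>)"
      have e0: "e \<noteq> 0" using sin_gt_zero[OF \<phi>] by (simp add: e_def)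
      have K0: "complex_of_real kp \<noteq> 0" using kp_pos by simp
      have N0: "complex_of_real ((sin t)\<^sup>2) \<noteq> 0" using sin_direction_pos(2) by (simp del: of_real_diff of_real_power of_real_divide)
      note id = interface_identities[OF N0 vert_sum[of \<phi>], folded s_def e_def]
      have "(of_real kp * (- (\<i> * e)) - of_real kp * s) / (of_real kp * (- (\<i> * e)) + of_real kp * s) = (- (\<i> * e) - s) / (- (\<i> * e) + s)"
        by (simp only: distrib_left[symmetric] right_diff_distrib[symmetric] mult_divide_mult_cancel_left[OF K0])
      also have "\<dots> = (e * e - s * s - 2 * \<i> * e * s) / of_real ((sin t)\<^sup>2)" by (rule id(2))
      also have "\<dots> = of_real (a \<phi>) + (- 2 * \<i>) * of_real (b \<phi>) * s"
      proof -
        have "e * e - s * s = of_real ((sin \<phi>)\<^sup>2 - (cos \<phi>)\<^sup>2 + (cos t)\<^sup>2)"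
          unfolding s_def ssq_square e_def by (simp add: power2_eq_square)
        then have a: "of_real (a \<phi>) = (e * e - s * s) / of_real ((sin t)\<^sup>2)" unfolding a_def of_real_divide by (simp only:)
        have b: "of_real (b \<phi>) = e / of_real ((sin t)\<^sup>2)" unfolding b_def e_def of_real_divide ..
        show ?thesis unfolding a b by (simp add: diff_divide_distrib)
      qed
      finally have R: "(of_real kp * (- (\<i> * e)) - of_real kp * s) / (of_real kp * (- (\<i> * e)) + of_real kp * s) = of_real (a \<phi>) + (- 2 * \<i>) * of_real (b \<phi>) * s" .
      have pf: "of_real kp * e / (of_real kp * (- (\<i> * e))) = \<i>" using K0 e0 by (simp add: field_simps)
      have ex: "exp (- (of_real kp * (- (\<i> * e))) * of_real (r * sin t + y $ 2)) * exp (\<i> * of_real (kp * cos \<phi> * (r * cos t - y $ 1))) = cis (p \<phi>) * cis (kp * r * cos (\<phi> - t))"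
      proof -
        have "exp (- (of_real kp * (- (\<i> * e))) * of_real (r * sin t + y $ 2)) * exp (\<i> * of_real (kp * cos \<phi> * (r * cos t - y $ 1)))
          = cis (kp * sin \<phi> * (r * sin t + y $ 2)) * cis (kp * cos \<phi> * (r * cos t - y $ 1))"
          by (simp add: cis_conv_exp e_def mult_ac)
        also have "\<dots> = cis (p \<phi> + kp * r * cos (\<phi> - t))"
          unfolding cis_mult by (rule arg_cong[of _ _ cis]) (simp add: p_def cos_diff algebra_simps)
        finally show ?thesis by (simp add: cis_mult)
      qed
      have "of_real (kp * sin \<phi>) * f r (kp * cos \<phi>) = ((of_real kp * (- (\<i> * e)) - of_real kp * s) / (of_real kp * (- (\<i> * e)) + of_real kp * s))
         * (of_real kp * e / (of_real kp * (- (\<i> * e)))) * (exp (- (of_real kp * (- (\<i> * e))) * of_real (r * sin t + y $ 2)) * exp (\<i> * of_real (kp * cos \<phi> * (r * cos t - y $ 1))))"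
        unfolding f_def ssq_inside[OF \<phi>] s_def[symmetric] e_def[symmetric] of_real_mult[of kp "sin \<phi>"]
        by (simp only: divide_inverse mult_ac)
      also have "\<dots> = (of_real (a \<phi>) + (- 2 * \<i>) * of_real (b \<phi>) * s) * \<i> * (cis (p \<phi>) * cis (kp * r * cos (\<phi> - t)))"
        by (simp only: R pf ex)
      finally show ?thesis unfolding A_def B_def s_def by (simp add: algebra_simps)
    qed
  qed (simp add: field_simps)
qed

text \<open>
  Here the whole field is transmitted, and \<open>S\<close> also occurs in the exponential because the wave has
  travelled the depth \<open>\<bar>y $ 2\<bar>\<close> in the lower medium. Up to a factor of modulus \<open>1\<close>, \<open>B t + \<kappa> * A t\<close> has
  imaginary part \<open>- 2 / sin t\<close> and real part \<open>2 * kp * y $ 2\<close>, so the two contributions cannot cancel.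
\<close>

lemma residual_lower:
  assumes y: "y \<in> lower_half" and d: "d $ 1 = cos t" "d $ 2 = sin t" "norm d = 1" "angle d = t"
  shows "\<exists>L::real. L \<noteq> 0 \<and> ((\<lambda>r. norm (green_res kp km (r *\<^sub>R d) y) * r powr (3/4)) \<longlongrightarrow> L) at_top"
proof -
  define p where "p \<phi> = - (kp * (y $ 1 * cos \<phi>))" for \<phi>
  define a where "a \<phi> = 2 * (sin \<phi>)\<^sup>2 / (sin t)\<^sup>2" for \<phi>
  define b where "b \<phi> = sin \<phi> / (sin t)\<^sup>2" for \<phi>
  define A where "A \<phi> = 1 * complex_of_real (a \<phi>) * cis (p \<phi>)" for \<phi>
  define B where "B \<phi> = (- 2 * \<i>) * complex_of_real (b \<phi>) * cis (p \<phi>)" for \<phi>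
  define \<kappa> where "\<kappa> = complex_of_real (kp * y $ 2)"
  have dp: "(p has_real_derivative kp * (y $ 1 * sin \<phi>)) (at \<phi>)" for \<phi>
    unfolding p_def by (auto intro!: derivative_eq_intros)
  have da: "(a has_real_derivative 4 * sin \<phi> * cos \<phi> / (sin t)\<^sup>2) (at \<phi>)" for \<phi>
    unfolding a_def by (rule DERIV_cdivide) (auto intro!: derivative_eq_intros)
  have db: "(b has_real_derivative cos \<phi> / (sin t)\<^sup>2) (at \<phi>)" for \<phi>
    unfolding b_def by (rule DERIV_cdivide) (auto intro!: derivative_eq_intros)
  have cont: "continuous_on UNIV (\<lambda>\<phi>. kp * (y $ 1 * sin \<phi>))"
    "continuous_on UNIV (\<lambda>\<phi>. 4 * sin \<phi> * cos \<phi> / (sin t)\<^sup>2)" "continuous_on UNIV (\<lambda>\<phi>. cos \<phi> / (sin t)\<^sup>2)"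
    using sin_direction_pos(2) by (auto intro!: continuous_intros)
  obtain A' where A': "\<And>\<phi>. (A has_vector_derivative A' \<phi>) (at \<phi>)" "continuous_on UNIV A'"
    using smooth_amplitude[OF da cont(2) dp cont(1), of 1] unfolding A_def[abs_def] by blast
  obtain B' where B': "\<And>\<phi>. (B has_vector_derivative B' \<phi>) (at \<phi>)" "continuous_on UNIV B'"
    using smooth_amplitude[OF db cont(3) dp cont(1), of "- 2 * \<i>"] unfolding B_def[abs_def] by blast
  have At: "A t = 2 * cis (p t)" and Bt: "B t = (- 2 * \<i>) * complex_of_real (1 / sin t) * cis (p t)"
    using sin_direction_pos by (simp_all add: A_def a_def B_def b_def power2_eq_square)
  have nz: "B t + \<kappa> * A t \<noteq> 0"
  proof -
    have "B t + \<kappa> * A t = Complex (2 * (kp * y $ 2)) (- (2 / sin t)) * cis (p t)"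
      unfolding At Bt \<kappa>_def Complex_eq by (simp add: algebra_simps)
    moreover have "Complex (2 * (kp * y $ 2)) (- (2 / sin t)) \<noteq> 0" using sin_direction_pos(1) by (simp add: complex_eq_iff)
    ultimately show ?thesis by simp
  qed
  have y2: "y $ 2 < 0" "y \<notin> upper_half" using y by (simp_all add: lower_half_def upper_half_def)
  define f where "f r \<xi> = exp (ssq (\<xi>\<^sup>2 - km\<^sup>2) * of_real (y $ 2) - ssq (\<xi>\<^sup>2 - kp\<^sup>2) * of_real (r * sin t)) / (ssq (\<xi>\<^sup>2 - kp\<^sup>2) + ssq (\<xi>\<^sup>2 - km\<^sup>2)) *
      exp (\<i> * of_real (\<xi> * (r * cos t - y $ 1)))" for r \<xi> :: real
  show ?thesis
  proof (rule critical_residual_limit[OF t t_not_half kp_pos order_refl A' B' nz, where f = f and R = "\<lambda>r. 0" and err = "\<lambda>r. 0" and ?c0.0 = "1 / (2 * of_real pi)" and q = "\<i> / 2"])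
    show "green_res kp km (r *\<^sub>R d) y = 0 + 1 / (2 * of_real pi) * (LINT \<xi>|lborel. f r \<xi>) - cis (kp * r) / of_real (sqrt r) * (far_const kp * A t)" if r: "r > 0" for r
    proof -
      have nrm: "norm (r *\<^sub>R d) = r" using r d by simp
      have dir: "(r *\<^sub>R d) /\<^sub>R r = d" using r by simp
      have green: "green kp km (r *\<^sub>R d) y = 1 / (2 * of_real pi) * (LINT \<xi>|lborel. f r \<xi>)"
        unfolding green_def S_eq_ssq[OF kp_pos] S_eq_ssq[OF km] using y2
        by (simp add: f_def[abs_def] d)
      have far: "green_far kp km d y = far_const kp * (2 * cis (p t))"
        using y2 unfolding green_far_def Let_def d(4) refl_crit trans_coeff_def S_crit far_const_def cis_conv_exp
        by (simp add: p_def mult_ac)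
      show ?thesis
        unfolding green_res_def nrm dir green far At cis_conv_exp[of "kp * r"] by simp
    qed
    show "f r \<in> borel_measurable borel" for r unfolding f_def by measurable
    show "norm (f r \<xi>) \<le> exp (- (sqrt (\<xi>\<^sup>2 - kp\<^sup>2) * (r * sin t + 0))) / sqrt (\<xi>\<^sup>2 - kp\<^sup>2)" if "r > 0" "\<bar>\<xi>\<bar> > kp" for r \<xi>
    proof -
      note o = ssq_outside[OF that(2)]
      define u v where "u = sqrt (\<xi>\<^sup>2 - kp\<^sup>2)" and "v = sqrt (\<xi>\<^sup>2 - km\<^sup>2)"
      have uv: "u > 0" "v > 0" using o by (simp_all add: u_def v_def)
      have "f r \<xi> = of_real (exp (v * y $ 2 - u * (r * sin t)) / (u + v)) * exp (\<i> * of_real (\<xi> * (r * cos t - y $ 1)))"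
        unfolding f_def o(1,2) u_def v_def by (simp flip: exp_of_real)
      then have "norm (f r \<xi>) = exp (v * y $ 2 - u * (r * sin t)) / (u + v)"
        using uv by (simp only: norm_mult norm_of_real norm_exp_i_times) simp
      also have "\<dots> \<le> exp (- (u * (r * sin t))) / u"
        using uv y2 by (intro frac_le) (auto simp: mult_pos_neg less_imp_le)
      finally show ?thesis by (simp add: u_def)
    qed
    show "of_real (kp * sin \<phi>) * f r (kp * cos \<phi>) = (\<i> / 2) * ((A \<phi> + B \<phi> * vert \<phi>) * exp (\<kappa> * vert \<phi>) * cis (kp * r * cos (\<phi> - t)))" if "r > 0" and \<phi>: "0 < \<phi>" "\<phi> < pi" for r \<phi>
    proof -
      define s where "s = vert \<phi>"
      define e where "e = complex_of_real (sin \<phi>)"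
      have K0: "complex_of_real kp \<noteq> 0" using kp_pos by simp
      have N0: "complex_of_real ((sin t)\<^sup>2) \<noteq> 0" using sin_direction_pos(2) by (simp del: of_real_diff of_real_power of_real_divide)
      note id = interface_identities[OF N0 vert_sum[of \<phi>], folded s_def e_def]
      have "of_real kp * e / (of_real kp * (- (\<i> * e)) + of_real kp * s) = e * (1 / (- (\<i> * e) + s))"
        by (simp only: distrib_left[symmetric] mult_divide_mult_cancel_left[OF K0]) simp
      also have "\<dots> = e * ((\<i> * e + s) / of_real ((sin t)\<^sup>2))" unfolding id(1) ..
      also have "\<dots> = (\<i> / 2) * (of_real (a \<phi>) + (- 2 * \<i>) * of_real (b \<phi>) * s)"
      proof -
        have a: "of_real (a \<phi>) = 2 * (e * e) / of_real ((sin t)\<^sup>2)" unfolding a_def e_def by (simp add: power2_eq_square)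
        have b: "of_real (b \<phi>) = e / of_real ((sin t)\<^sup>2)" unfolding b_def e_def of_real_divide ..
        have "e * ((\<i> * e + s) / N) = (\<i> / 2) * (2 * (e * e) / N + (- 2 * \<i>) * (e / N) * s)" if "N \<noteq> 0" for N
          using that by (simp add: field_simps)
        from this[OF N0] show ?thesis unfolding a b .
      qed
      finally have R: "of_real kp * e / (of_real kp * (- (\<i> * e)) + of_real kp * s) = (\<i> / 2) * (of_real (a \<phi>) + (- 2 * \<i>) * of_real (b \<phi>) * s)" .
      have ex: "exp (of_real kp * s * of_real (y $ 2) - of_real kp * (- (\<i> * e)) * of_real (r * sin t)) * exp (\<i> * of_real (kp * cos \<phi> * (r * cos t - y $ 1)))
         = exp (\<kappa> * s) * (cis (p \<phi>) * cis (kp * r * cos (\<phi> - t)))"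
      proof -
        have "exp (of_real kp * s * of_real (y $ 2) - of_real kp * (- (\<i> * e)) * of_real (r * sin t)) * exp (\<i> * of_real (kp * cos \<phi> * (r * cos t - y $ 1)))
          = exp (\<kappa> * s) * (cis (kp * sin \<phi> * (r * sin t)) * cis (kp * cos \<phi> * (r * cos t - y $ 1)))"
        proof -
          have "of_real kp * s * of_real (y $ 2) - of_real kp * (- (\<i> * e)) * of_real (r * sin t) = \<kappa> * s + \<i> * of_real (kp * sin \<phi> * (r * sin t))"
            by (simp add: e_def \<kappa>_def mult_ac)
          then show ?thesis unfolding cis_conv_exp by (simp only: exp_add mult.assoc)
        qed
        also have "cis (kp * sin \<phi> * (r * sin t)) * cis (kp * cos \<phi> * (r * cos t - y $ 1)) = cis (p \<phi> + kp * r * cos (\<phi> - t))"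
          unfolding cis_mult by (rule arg_cong[of _ _ cis]) (simp add: p_def cos_diff algebra_simps)
        finally show ?thesis by (simp add: cis_mult)
      qed
      have "of_real (kp * sin \<phi>) * f r (kp * cos \<phi>) = (of_real kp * e / (of_real kp * (- (\<i> * e)) + of_real kp * s))
         * (exp (of_real kp * s * of_real (y $ 2) - of_real kp * (- (\<i> * e)) * of_real (r * sin t)) * exp (\<i> * of_real (kp * cos \<phi> * (r * cos t - y $ 1))))"
        unfolding f_def ssq_inside[OF \<phi>] s_def[symmetric] e_def[symmetric] of_real_mult[of kp "sin \<phi>"]
        by (simp only: divide_inverse mult_ac)
      also have "\<dots> = (\<i> / 2) * (of_real (a \<phi>) + (- 2 * \<i>) * of_real (b \<phi>) * s) * (exp (\<kappa> * s) * (cis (p \<phi>) * cis (kp * r * cos (\<phi> - t))))"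
        by (simp only: R ex)
      finally show ?thesis unfolding A_def B_def s_def by (simp add: algebra_simps)
    qed
  qed simp_all
qed

end

theorem mainTheorem7:
  fixes kp km :: real and y d :: "real^2"
  assumes "km > 0" and "kp > km"
    and "y \<in> upper_half \<union> lower_half"
    and "d \<in> circle_upper"
    and "angle d \<in> {crit_angle kp km, pi - crit_angle kp km}"
  shows "(\<exists>L::real. L \<noteq> 0 \<and>
            ((\<lambda>r. cmod (green_res kp km (r *\<^sub>R d) y) * norm (r *\<^sub>R d) powr (3 / 4)) \<longlongrightarrow> L) at_top)
       \<and> (\<lambda>r. cmod (green_res kp km (r *\<^sub>R d) y)) \<notin> O[at_top](\<lambda>r. norm (r *\<^sub>R d) powr (- 3 / 2))"
proof -
  define t where "t = angle d"
  note d = direction_angle[OF assms(4), folded t_def]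
  have nd: "norm d = 1" using assms(4) by (simp add: circle_upper_def)
  have n: "0 < km / kp" "km / kp < 1" using assms by auto
  have "cos t = km / kp \<or> cos t = - (km / kp)"
    using assms(5) n by (auto simp: t_def crit_angle_def)
  then have crit: "(cos t)\<^sup>2 = (km / kp)\<^sup>2" by auto
  have "\<exists>L::real. L \<noteq> 0 \<and> ((\<lambda>r. norm (green_res kp km (r *\<^sub>R d) y) * r powr (3/4)) \<longlongrightarrow> L) at_top"
    using assms(3) residual_upper[OF assms(1,2) d(1,2) crit _ d(3,4) nd t_def[symmetric]]
      residual_lower[OF assms(1,2) d(1,2) crit _ d(3,4) nd t_def[symmetric]] by auto
  then obtain L where L: "L \<noteq> 0" "((\<lambda>r. norm (green_res kp km (r *\<^sub>R d) y) * r powr (3/4)) \<longlongrightarrow> L) at_top" by blast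
  have nr: "\<forall>\<^sub>F r in at_top. norm (r *\<^sub>R d) = r"
    using eventually_gt_at_top[of 0] by eventually_elim (simp add: nd)
  have "((\<lambda>r. cmod (green_res kp km (r *\<^sub>R d) y) * norm (r *\<^sub>R d) powr (3 / 4)) \<longlongrightarrow> L) at_top"
    using L(2) by (rule Lim_transform_eventually) (use nr in eventually_elim, simp)
  moreover have "(\<lambda>r. cmod (green_res kp km (r *\<^sub>R d) y)) \<notin> O[at_top](\<lambda>r. norm (r *\<^sub>R d) powr (- 3 / 2))"
  proof
    assume "(\<lambda>r. cmod (green_res kp km (r *\<^sub>R d) y)) \<in> O[at_top](\<lambda>r. norm (r *\<^sub>R d) powr (- 3 / 2))"
    then obtain c where c: "\<forall>\<^sub>F r in at_top. norm (cmod (green_res kp km (r *\<^sub>R d) y)) \<le> c * norm (norm (r *\<^sub>R d) powr (- 3 / 2))"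
      by (elim landau_o.bigE)
    have "((\<lambda>r. norm (green_res kp km (r *\<^sub>R d) y) * r powr (3/4)) \<longlongrightarrow> 0) at_top"
    proof (rule Lim_null_comparison)
      show "\<forall>\<^sub>F r in at_top. norm (norm (green_res kp km (r *\<^sub>R d) y) * r powr (3/4)) \<le> c * (r powr (-3/2) * r powr (3/4))"
        using c nr by eventually_elim (simp add: mult_right_mono mult.assoc[symmetric])
      show "((\<lambda>r. c * (r powr (-3/2) * r powr (3/4))) \<longlongrightarrow> 0) at_top"
        by real_asymp
    qed
    with L(2) have "L = 0" by (intro tendsto_unique[of at_top]) auto
    with L(1) show False by simp
  qed
  ultimately show ?thesis using L(1) by blast
qed

end
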